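(* As formal power series in $q$ (equivalently, for $|q|<1$), $$\begin{aligned}\sum_{n=0}^\infty p_\omega(40n+12)q^n&=4\Bigg(9\frac{E_{2}^{2}E_5}{E_1^{2}}+3975q\frac{E_2^3E_{10}^3}{E_1^5}+207425q^2\frac{E_2^4E_{10}^{6}}{E_1^{8}E_5}+4229000q^3\frac{E_{2}^{5}E_{10}^{9}}{E_1^{11}E_5^2}\\ &\quad+44850000q^4\frac{E_{2}^{6}E_{10}^{12}}{E_1^{14}E_5^3}+274000000q^5\frac{E_{2}^{7}E_{10}^{15}}{E_1^{17}E_5^4}+980000000q^6\frac{E_{2}^{8}E_{10}^{18}}{E_1^{20}E_5^5}\\ &\quad+1920000000q^7\frac{E_{2}^{9}E_{10}^{21}}{E_1^{23}E_5^6}+1600000000q^8\frac{E_{2}^{10}E_{10}^{24}}{E_1^{26}E_5^7}\Bigg).\end{aligned}$$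
   Context: For a positive integer $j$, $E_j:=(q^j;q^j)_\infty=\prod_{k\ge1}(1-q^{jk})$. $p_\omega(n)$ denotes the number of partitions of $n$ (into positive parts) in which each odd part is less than twice the smallest part. Its generating function is $\sum_{n=1}^\infty p_\omega(n)q^n=q\,\omega(q)$, where $\omega(q):=\sum_{n=0}^\infty \frac{q^{2n^2+2n}}{(q;q^2)_{n+1}^2}$ is the third order mock theta function and $(a;q)_n:=\prod_{k=0}^{n-1}(1-aq^k)$. *)

theory Defs
  imports
    "HOL-Analysis.Analysis"
    "HOL-Library.Multiset"
    "HOL-Computational_Algebra.Formal_Power_Series"
begin

definition p_omega :: "nat \<Rightarrow> nat" where
  "p_omega n = card {M :: nat multiset.
     0 \<notin># M \<and> sum_mset M = n \<and> (\<forall>k\<in>#M. odd k \<longrightarrow> k < 2 * Min (set_mset M))}"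

text \<open>
  The index set of the partitions counted above is finite, so that \<open>card\<close> is
  not the default value 0.
\<close>

lemma finite_partitions: "finite {M :: nat multiset. 0 \<notin># M \<and> sum_mset M = n}"
proof (rule finite_subset)
  show "{M :: nat multiset. 0 \<notin># M \<and> sum_mset M = n}
          \<subseteq> mset ` {xs. set xs \<subseteq> {..n} \<and> length xs \<le> n}"
  proof
    fix M :: "nat multiset"
    assume "M \<in> {M. 0 \<notin># M \<and> sum_mset M = n}"
    then have pos: "0 \<notin># M" and sum: "sum_mset M = n" by auto
    have size: "size M \<le> sum_mset M"
      using pos by (induction M) auto
    have part: "k \<le> n" if "k \<in># M" for k
      using that sum sum_mset.remove[of k M] by simp
    obtain xs where "mset xs = M" using ex_mset by blast
    with size part sum show "M \<in> mset ` {xs. set xs \<subseteq> {..n} \<and> length xs \<le> n}"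
      by (intro image_eqI[of _ _ xs]) auto
  qed
  show "finite (mset ` {xs. set xs \<subseteq> {..n} \<and> length xs \<le> n})"
    by (intro finite_imageI finite_lists_length_le) auto
qed

text \<open>
  The product runs over \<open>k \<ge> 1\<close>, and converges with respect to the metric on formal
  power series; it is only meaningful for \<open>j > 0\<close>.
\<close>

definition E :: "nat \<Rightarrow> complex fps" where
  "E j = (\<Prod>k. 1 - fps_X ^ (j * (k + 1)))"

lemma has_prod_E:
  assumes "j > 0"
  shows "(\<lambda>k. 1 - fps_X ^ (j * (k + 1))) has_prod E j"
proof -
  define f :: "nat \<Rightarrow> complex fps" where "f = (\<lambda>k. 1 - fps_X ^ (j * (k + 1)))"
  define P where "P = (\<lambda>n. \<Prod>i\<le>n. f i)"
  define L where "L = Abs_fps (\<lambda>m. fps_nth (P m) m)"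
  have step: "fps_nth (P (Suc n)) m = fps_nth (P n) m" if "m \<le> n" for m n
  proof -
    have "m < j * (Suc n + 1)"
      using that assms by (cases j) auto
    moreover have "P (Suc n) = P n - P n * fps_X ^ (j * (Suc n + 1))"
      by (simp add: P_def f_def algebra_simps)
    ultimately show ?thesis by (simp add: fps_X_power_mult_right_nth)
  qed
  have stable: "fps_nth (P n) m = fps_nth (P m) m" if "m \<le> n" for m n
    using that by (induction n rule: dec_induct) (simp_all add: step)
  have "P \<longlonglongrightarrow> L"
  proof (rule tendsto_fpsI)
    fix m
    show "eventually (\<lambda>n. fps_nth (P n) m = fps_nth L m) sequentially"
      using eventually_ge_at_top[of m] by eventually_elim (unfold L_def fps_nth_Abs_fps, rule stable)
  qed
  moreover have "fps_nth L 0 = 1"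
    using assms by (simp add: L_def P_def f_def)
  then have "L \<noteq> 0" by auto
  ultimately have "f has_prod L"
    by (simp add: has_prod_def raw_has_prod_def P_def)
  then have "f has_prod prodinf f"
    using has_prod_unique[of f L] by simp
  then show ?thesis by (simp add: E_def f_def)
qed

end

theory Submission
  imports Defs
begin

text \<open>
  Write \<open>\<phi>\<close> and \<open>\<psi>\<close> for the theta series \<open>\<Sum> q ^ (n\<^sup>2)\<close> over \<open>n \<in> \<int>\<close> and \<open>\<Sum> q ^ (n (n + 1) / 2)\<close> over
  \<open>n \<ge> 0\<close>. The even part of \<open>q \<omega>(q)\<close> is, up to the factor \<open>2 / E 1\<close>, a Lerch sum, which also occurs in
  the partial fraction expansion of \<open>\<Prod> 1 / ((1 + q ^ (4 i))\<^sup>2 (1 - q ^ (2 i + 1))\<^sup>2)\<close>; the other poles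
  contribute a series in \<open>q ^ 4\<close>. Hence \<open>2 (\<Sum> p_omega (2 n) q ^ n)\<close> is an eta quotient up to a series
  in \<open>q ^ 4\<close>, and the identity \<open>\<phi>(q)\<^sup>2 = \<phi>(q\<^sup>2)\<^sup>2 + 4 q \<psi>(q ^ 4)\<^sup>2\<close>, applied twice, gives
  \<open>\<Sum> p_omega (8 n + 4) q ^ n = 4 E 2 ^ 10 / E 1 ^ 9\<close>.

  This quotient is \<open>\<psi> ^ 5 / E 1 ^ 4\<close>. Its 5-section is found by inserting the 5-dissections of \<open>\<psi>\<close> and of \<open>E 1\<close>,
  the denominator being cleared by the norm of \<open>E 1\<close> over the fifth roots of unity. Everything is then
  a rational function of Ramanujan's level 10 parameter \<open>k\<close>, and the theorem becomes a polynomial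
  identity in \<open>k\<close>.
\<close>

section \<open>Limits and infinite sums of formal power series\<close>

text \<open>The underlying q-series arguments have a second variable z, while everything here is a
  formal power series in q alone. So z is specialised or avoided: q-difference equations are used
  only at z = q^(2j), partial fractions are taken over finitely many monomial poles, and infinite
  products and sums are limits of finite identities, convergence meaning that every coefficient is
  eventually constant. The unknown series in q^4 decides which progression is reachable. One even
  section leaves it a series in q^2, and the next odd section removes it; this is why the residue is
  4 modulo 8. The shape of the right side comes from k. Consecutive eta quotients in the theorem,
  with their powers of q, have the constant ratio w = q E_2 E_10^3 / (E_1^3 E_5), and w = k / (1 -
  4k - k^2). The nine terms are therefore a polynomial of degree 8 in w, and clearing (1 - 4k -
  k^2)^8 makes the claim polynomial in k.\<close>

lemma X_power_dvd_iff: "fps_X ^ n dvd (f :: 'a::idom fps) \<longleftrightarrow> (\<forall>m<n. fps_nth f m = 0)"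
proof
  assume "fps_X ^ n dvd f"
  then show "\<forall>m<n. fps_nth f m = 0"
    by (auto simp: dvd_def fps_X_power_mult_nth)
next
  assume "\<forall>m<n. fps_nth f m = 0"
  then have "f = fps_X ^ n * fps_shift n f"
    by (auto simp: fps_eq_iff fps_X_power_mult_nth)
  then show "fps_X ^ n dvd f" by (rule dvdI)
qed

lemma X_power_dvd_all_imp_0:
  assumes "\<And>n. fps_X ^ n dvd (f :: 'a::idom fps)"
  shows "f = 0"
proof (rule fps_ext)
  fix m
  show "fps_nth f m = fps_nth 0 m"
    using assms[of "Suc m"] unfolding X_power_dvd_iff by simp
qed

lemma X_power_dvdI: "fps_X ^ n dvd (f :: 'a::idom fps) \<Longrightarrow> m \<le> n \<Longrightarrow> fps_X ^ m dvd f"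
  using le_imp_power_dvd dvd_trans by blast

lemma fps_tendsto_mult:
  fixes a b :: "'a::idom fps"
  assumes "(f \<longlongrightarrow> a) F" "(g \<longlongrightarrow> b) F"
  shows "((\<lambda>x. f x * g x) \<longlongrightarrow> a * b) F"
proof (rule tendsto_fpsI)
  fix m
  have "eventually (\<lambda>x. \<forall>i\<in>{..m}. fps_nth (f x) i = fps_nth a i) F"
    using assms(1) by (intro eventually_ball_finite) (auto simp: tendsto_fps_iff)
  moreover have "eventually (\<lambda>x. \<forall>i\<in>{..m}. fps_nth (g x) i = fps_nth b i) F"
    using assms(2) by (intro eventually_ball_finite) (auto simp: tendsto_fps_iff)
  ultimately show "eventually (\<lambda>x. fps_nth (f x * g x) m = fps_nth (a * b) m) F"
    by eventually_elim (auto simp: fps_mult_nth intro!: sum.cong)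
qed

lemma fps_tendsto_add:
  fixes a b :: "'a::idom fps"
  assumes "(f \<longlongrightarrow> a) F" "(g \<longlongrightarrow> b) F"
  shows "((\<lambda>x. f x + g x) \<longlongrightarrow> a + b) F"
proof (rule tendsto_fpsI)
  fix m
  have "eventually (\<lambda>x. fps_nth (f x) m = fps_nth a m) F" "eventually (\<lambda>x. fps_nth (g x) m = fps_nth b m) F"
    using assms by (auto simp: tendsto_fps_iff)
  then show "eventually (\<lambda>x. fps_nth (f x + g x) m = fps_nth (a + b) m) F"
    by eventually_elim simp
qed

lemma fps_tendsto_power:
  fixes a :: "'a::idom fps"
  shows "(f \<longlongrightarrow> a) F \<Longrightarrow> ((\<lambda>x. f x ^ k) \<longlongrightarrow> a ^ k) F"
  by (induction k) (auto intro: fps_tendsto_mult)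

text \<open>\<open>inverse g - inverse h\<close> is a multiple of \<open>h - g\<close>, so the
  coefficients of an inverse up to degree m depend only on those of the series up to degree
  m.\<close>

lemma fps_tendsto_inverse:
  fixes a :: "'a::field fps"
  assumes "(f \<longlongrightarrow> a) F" "fps_nth a 0 \<noteq> 0"
  shows "((\<lambda>x. inverse (f x)) \<longlongrightarrow> inverse a) F"
proof (rule tendsto_fpsI)
  fix m
  have inv: "fps_nth (inverse g) m = fps_nth (inverse h) m"
    if eq: "\<forall>i\<in>{..m}. fps_nth g i = fps_nth h i" and nz: "fps_nth h 0 \<noteq> 0" for g h :: "'a fps"
  proof -
    have g0: "fps_nth g 0 \<noteq> 0" using eq nz by auto
    have "fps_X ^ Suc m dvd h - g"
      using eq unfolding X_power_dvd_iff by auto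
    moreover have "inverse g - inverse h = (h - g) * (inverse g * inverse h)"
    proof -
      have "g * inverse g = 1" "h * inverse h = 1" using g0 nz by (auto intro: inverse_mult_eq_1')
      moreover have "(h - g) * (inverse g * inverse h) = (h * inverse h) * inverse g - (g * inverse g) * inverse h"
        by (simp add: algebra_simps)
      ultimately show ?thesis by (simp only: mult_1)
    qed
    ultimately have "fps_X ^ Suc m dvd inverse g - inverse h" by simp
    then show ?thesis using X_power_dvd_iff[of "Suc m" "inverse g - inverse h"] by simp
  qed
  have "eventually (\<lambda>x. \<forall>i\<in>{..m}. fps_nth (f x) i = fps_nth a i) F"
    using assms(1) by (intro eventually_ball_finite) (auto simp: tendsto_fps_iff)
  then show "eventually (\<lambda>x. fps_nth (inverse (f x)) m = fps_nth (inverse a) m) F"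
    by eventually_elim (rule inv[OF _ assms(2)])
qed

lemma fps_nth_0_tendsto:
  assumes "(f \<longlongrightarrow> (a :: 'a::idom fps)) sequentially" "\<And>n. fps_nth (f n) 0 = c"
  shows "fps_nth a 0 = c"
proof -
  have "eventually (\<lambda>n. fps_nth (f n) 0 = fps_nth a 0) sequentially"
    using assms(1) by (auto simp: tendsto_fps_iff)
  then show ?thesis using assms(2) by auto
qed

text \<open>Only used for families with finitely many nonzero coefficients in each degree.\<close>

definition fsum :: "('i \<Rightarrow> 'a::idom fps) \<Rightarrow> 'a fps" where
  "fsum g = Abs_fps (\<lambda>m. \<Sum>i | fps_nth (g i) m \<noteq> 0. fps_nth (g i) m)"

definition locally_finite :: "('i \<Rightarrow> 'a::idom fps) \<Rightarrow> bool" where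
  "locally_finite g \<longleftrightarrow> (\<forall>m. finite {i. fps_nth (g i) m \<noteq> 0})"

lemma fsum_nth_superset:
  assumes "finite A" "{i. fps_nth (g i) m \<noteq> 0} \<subseteq> A"
  shows "fps_nth (fsum g) m = (\<Sum>i\<in>A. fps_nth (g i) m)"
  unfolding fsum_def fps_nth_Abs_fps
  using assms by (intro sum.mono_neutral_left) auto

lemma locally_finiteI:
  assumes "\<And>m. finite {i. e i \<le> m}" "\<And>i. fps_X ^ (e i) dvd g i"
  shows "locally_finite g"
  unfolding locally_finite_def
proof
  fix m :: nat
  have "{i. fps_nth (g i) m \<noteq> 0} \<subseteq> {i. e i \<le> m}"
    using assms(2) unfolding X_power_dvd_iff by (metis (mono_tags, lifting) mem_Collect_eq not_le subsetI)
  then show "finite {i. fps_nth (g i) m \<noteq> 0}" using assms(1) finite_subset by blast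
qed

lemma locally_finite_natI: "(\<And>n. fps_X ^ n dvd g n) \<Longrightarrow> locally_finite g"
  by (rule locally_finiteI[where e = "\<lambda>n. n"]) auto

lemma locally_finite_upto:
  assumes "locally_finite g"
  shows "finite {i. \<exists>l\<le>m. fps_nth (g i) l \<noteq> 0}"
proof -
  have "{i. \<exists>l\<le>m. fps_nth (g i) l \<noteq> 0} = (\<Union>l\<le>m. {i. fps_nth (g i) l \<noteq> 0})" by auto
  then show ?thesis using assms by (auto simp: locally_finite_def)
qed

lemma locally_finite_mult:
  assumes "locally_finite g"
  shows "locally_finite (\<lambda>i. c * g i)"
  unfolding locally_finite_def
proof
  fix m
  have "fps_nth (c * g i) m = 0" if "\<forall>l\<le>m. fps_nth (g i) l = 0" for i
    using that by (auto simp: fps_mult_nth)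
  then have "{i. fps_nth (c * g i) m \<noteq> 0} \<subseteq> {i. \<exists>l\<le>m. fps_nth (g i) l \<noteq> 0}" by blast
  then show "finite {i. fps_nth (c * g i) m \<noteq> 0}"
    using locally_finite_upto[OF assms] finite_subset by blast
qed

lemma fsum_mult:
  assumes "locally_finite g"
  shows "fsum (\<lambda>i. c * g i) = c * fsum g"
proof (rule fps_ext)
  fix m
  define A where "A = {i. \<exists>l\<le>m. fps_nth (g i) l \<noteq> 0}"
  have A: "finite A" unfolding A_def by (rule locally_finite_upto[OF assms])
  have *: "fps_nth (c * g i) m = 0" if "i \<notin> A" for i
    using that by (auto simp: fps_mult_nth A_def)
  have "fps_nth (fsum (\<lambda>i. c * g i)) m = (\<Sum>i\<in>A. fps_nth (c * g i) m)"
    using * by (intro fsum_nth_superset A) auto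
  also have "\<dots> = (\<Sum>k=0..m. fps_nth c k * (\<Sum>i\<in>A. fps_nth (g i) (m - k)))"
    unfolding fps_mult_nth by (subst sum.swap) (simp add: sum_distrib_left)
  also have "\<dots> = (\<Sum>k=0..m. fps_nth c k * fps_nth (fsum g) (m - k))"
  proof (intro sum.cong refl arg_cong2[where f = "(*)"] fsum_nth_superset[symmetric] A)
    fix k
    have "m - k \<le> m" by simp
    then show "{i. fps_nth (g i) (m - k) \<noteq> 0} \<subseteq> A" unfolding A_def by blast
  qed
  finally show "fps_nth (fsum (\<lambda>i. c * g i)) m = fps_nth (c * fsum g) m"
    by (simp add: fps_mult_nth)
qed

lemma fsum_add:
  assumes "locally_finite f" "locally_finite g"
  shows "fsum (\<lambda>i. f i + g i) = fsum f + fsum g"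
proof (rule fps_ext)
  fix m
  define A where "A = {i. fps_nth (f i) m \<noteq> 0} \<union> {i. fps_nth (g i) m \<noteq> 0}"
  have A: "finite A" using assms by (auto simp: A_def locally_finite_def)
  have "fps_nth (fsum (\<lambda>i. f i + g i)) m = (\<Sum>i\<in>A. fps_nth (f i + g i) m)"
       "fps_nth (fsum f) m = (\<Sum>i\<in>A. fps_nth (f i) m)"
       "fps_nth (fsum g) m = (\<Sum>i\<in>A. fps_nth (g i) m)"
    by (intro fsum_nth_superset A; auto simp: A_def)+
  then show "fps_nth (fsum (\<lambda>i. f i + g i)) m = fps_nth (fsum f + fsum g) m"
    by (simp add: sum.distrib)
qed

lemma fsum_diff:
  assumes "locally_finite f" "locally_finite g"
  shows "fsum (\<lambda>i. f i - g i) = fsum f - fsum g"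
  using fsum_add[OF assms(1) locally_finite_mult[OF assms(2), of "-1"]] fsum_mult[OF assms(2), of "-1"]
  by simp

text \<open>Tannery's theorem for formal series: the orders \<open>e i\<close> bound the terms
  uniformly in \<open>N\<close>, so in each degree only finitely many indices ever contribute. The
  limit terms \<open>h i\<close> inherit the bound.\<close>

lemma tendsto_fsum:
  fixes h :: "'i \<Rightarrow> 'a::idom fps"
  assumes lim: "\<And>i. (\<lambda>N. g N i) \<longlonglongrightarrow> h i"
    and bound: "\<And>N i. i \<in> A N \<Longrightarrow> fps_X ^ (e i) dvd g N i"
    and fin: "\<And>m. finite {i. e i \<le> m}"
    and A: "\<And>N. finite (A N)" "\<And>i. eventually (\<lambda>N. i \<in> A N) sequentially"
  shows "(\<lambda>N. \<Sum>i\<in>A N. g N i) \<longlonglongrightarrow> fsum h"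
proof (rule tendsto_fpsI)
  fix m
  define B where "B = {i. e i \<le> m}"
  have B: "finite B" using fin by (simp add: B_def)
  have g0: "fps_nth (g N i) m = 0" if "i \<notin> B" "i \<in> A N" for N i
    using bound[of i N] that by (auto simp: X_power_dvd_iff B_def)
  have h0: "fps_nth (h i) m = 0" if "i \<notin> B" for i
  proof -
    have "eventually (\<lambda>N. fps_nth (g N i) m = fps_nth (h i) m) sequentially"
      using lim[of i] by (auto simp: tendsto_fps_iff)
    with A(2)[of i] have "eventually (\<lambda>N. fps_nth (h i) m = 0) sequentially"
      by eventually_elim (use g0 that in force)
    then show ?thesis by simp
  qed
  have "eventually (\<lambda>N. \<forall>i\<in>B. fps_nth (g N i) m = fps_nth (h i) m) sequentially"
    using B lim by (intro eventually_ball_finite) (auto simp: tendsto_fps_iff)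
  moreover have "eventually (\<lambda>N. \<forall>i\<in>B. i \<in> A N) sequentially"
    using B A by (intro eventually_ball_finite) auto
  ultimately show "eventually (\<lambda>N. fps_nth (\<Sum>i\<in>A N. g N i) m = fps_nth (fsum h) m) sequentially"
  proof eventually_elim
    case (elim N)
    have "fps_nth (\<Sum>i\<in>A N. g N i) m = (\<Sum>i\<in>A N. fps_nth (g N i) m)"
      by (simp add: fps_sum_nth)
    also have "\<dots> = (\<Sum>i\<in>B. fps_nth (g N i) m)"
      using elim A(1)[of N] by (intro sum.mono_neutral_right) (auto intro: g0)
    also have "\<dots> = (\<Sum>i\<in>B. fps_nth (h i) m)" using elim by simp
    also have "\<dots> = fps_nth (fsum h) m"
      using h0 by (intro fsum_nth_superset[symmetric] B) auto
    finally show ?case .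
  qed
qed

lemma tendsto_fsum_const:
  assumes "locally_finite g" "\<And>N. finite (A N)" "\<And>i. eventually (\<lambda>N. i \<in> A N) sequentially"
  shows "(\<lambda>N. \<Sum>i\<in>A N. g i) \<longlonglongrightarrow> fsum g"
proof (rule tendsto_fpsI)
  fix m
  have B: "finite {i. fps_nth (g i) m \<noteq> 0}" using assms(1) by (simp add: locally_finite_def)
  have "eventually (\<lambda>N. \<forall>i\<in>{i. fps_nth (g i) m \<noteq> 0}. i \<in> A N) sequentially"
    using B assms(3) by (intro eventually_ball_finite) auto
  then show "eventually (\<lambda>N. fps_nth (\<Sum>i\<in>A N. g i) m = fps_nth (fsum g) m) sequentially"
  proof eventually_elim
    case (elim N)
    then show ?case
      using assms(2)[of N] by (subst fsum_nth_superset[of "A N"]) (auto simp: fps_sum_nth)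
  qed
qed

lemma tendsto_fsum_nat:
  assumes "\<And>n. fps_X ^ n dvd g n"
  shows "(\<lambda>N. \<Sum>n<N. g n) \<longlonglongrightarrow> fsum g"
  using assms by (intro tendsto_fsum_const locally_finite_natI) (auto intro: eventually_gt_at_top)

lemma X_power_tendsto_0:
  assumes "\<And>n. fps_X ^ n dvd (c n :: 'a::idom fps)"
  shows "c \<longlonglongrightarrow> 0"
proof (rule tendsto_fpsI)
  fix m
  show "eventually (\<lambda>n. fps_nth (c n) m = fps_nth 0 m) sequentially"
    using eventually_gt_at_top[of m] by eventually_elim (use assms in \<open>auto simp: X_power_dvd_iff\<close>)
qed

lemma fsum_telescope:
  fixes c :: "nat \<Rightarrow> 'a::idom fps"
  assumes "\<And>n. fps_X ^ n dvd c n"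
  shows "fsum (\<lambda>n. c n - c (Suc n)) = c 0"
proof -
  have "(\<lambda>N. \<Sum>n<N. c n - c (Suc n)) \<longlonglongrightarrow> fsum (\<lambda>n. c n - c (Suc n))"
  proof (rule tendsto_fsum_nat)
    fix n
    have "fps_X ^ n dvd c (Suc n)" by (rule X_power_dvdI[OF assms]) simp
    then show "fps_X ^ n dvd c n - c (Suc n)" using assms by (simp add: dvd_diff)
  qed
  also have "(\<lambda>N. \<Sum>n<N. c n - c (Suc n)) = (\<lambda>N. c 0 + - c N)"
    by (simp add: sum_lessThan_telescope')
  finally have "(\<lambda>N. c 0 + - c N) \<longlonglongrightarrow> fsum (\<lambda>n. c n - c (Suc n))" .
  moreover have "(\<lambda>N. c 0 + - c N) \<longlonglongrightarrow> c 0 + 0"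
    by (intro fps_tendsto_add tendsto_const X_power_tendsto_0) (use assms in auto)
  ultimately show ?thesis using LIMSEQ_unique by force
qed

lemma fsum_swap:
  fixes g :: "'i \<Rightarrow> 'j \<Rightarrow> 'a::idom fps"
  assumes fin: "\<And>m. finite {(i, j). fps_nth (g i j) m \<noteq> 0}"
  shows "fsum (\<lambda>i. fsum (\<lambda>j. g i j)) = fsum (\<lambda>j. fsum (\<lambda>i. g i j))"
proof (rule fps_ext)
  fix m
  define S where "S = {(i, j). fps_nth (g i j) m \<noteq> 0}"
  define A B where "A = fst ` S" and "B = snd ` S"
  have AB: "finite A" "finite B" using fin[of m] by (auto simp: A_def B_def S_def)
  have out: "fps_nth (g i j) m = 0" if "i \<notin> A \<or> j \<notin> B" for i j
    using that by (force simp: A_def B_def S_def)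
  have 1: "fps_nth (fsum (\<lambda>j. g i j)) m = (\<Sum>j\<in>B. fps_nth (g i j) m)" for i
    using out by (intro fsum_nth_superset AB) auto
  have 2: "fps_nth (fsum (\<lambda>i. g i j)) m = (\<Sum>i\<in>A. fps_nth (g i j) m)" for j
    using out by (intro fsum_nth_superset AB) auto
  have "fps_nth (fsum (\<lambda>i. fsum (\<lambda>j. g i j))) m = (\<Sum>i\<in>A. \<Sum>j\<in>B. fps_nth (g i j) m)"
    by (subst fsum_nth_superset[OF AB(1)]) (auto simp: 1 intro!: out sum.neutral)
  moreover have "fps_nth (fsum (\<lambda>j. fsum (\<lambda>i. g i j))) m = (\<Sum>j\<in>B. \<Sum>i\<in>A. fps_nth (g i j) m)"
    by (subst fsum_nth_superset[OF AB(2)]) (auto simp: 2 intro!: out sum.neutral)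
  ultimately show "fps_nth (fsum (\<lambda>i. fsum (\<lambda>j. g i j))) m = fps_nth (fsum (\<lambda>j. fsum (\<lambda>i. g i j))) m"
    by (simp only: sum.swap[of _ B A])
qed

section \<open>Dilations and arithmetic sections\<close>

definition dil :: "nat \<Rightarrow> 'a::idom fps \<Rightarrow> 'a fps" where
  "dil k f = f oo fps_X ^ k"

definition sect :: "nat \<Rightarrow> nat \<Rightarrow> 'a fps \<Rightarrow> 'a::idom fps" where
  "sect k r f = Abs_fps (\<lambda>n. fps_nth f (k * n + r))"

lemma dil_nth: "k > 0 \<Longrightarrow> fps_nth (dil k f) m = (if k dvd m then fps_nth f (m div k) else 0)"
proof -
  assume k: "k > 0"
  have "fps_nth (dil k f) m = (\<Sum>i=0..m. fps_nth f i * fps_nth (fps_X ^ (k * i)) m)"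
    unfolding dil_def fps_compose_def by (simp add: power_mult)
  also have "\<dots> = (\<Sum>i\<in>(if k dvd m then {m div k} else {}). fps_nth f i * fps_nth (fps_X ^ (k * i)) m)"
    using k by (intro sum.mono_neutral_right) auto
  also have "\<dots> = (if k dvd m then fps_nth f (m div k) else 0)"
    using k by auto
  finally show ?thesis .
qed

context
  fixes k :: nat
  assumes k: "k > 0"
begin

lemma dil_mult: "dil k (f * g) = dil k f * dil k g"
  unfolding dil_def by (rule fps_compose_mult_distrib) (use k in simp)

lemma dil_power: "dil k (f ^ n) = dil k f ^ n"
  unfolding dil_def by (rule fps_compose_power[symmetric]) (use k in simp)

lemma dil_add: "dil k (f + g) = dil k f + dil k g"
  unfolding dil_def by (rule fps_compose_add_distrib)

lemma dil_diff: "dil k (f - g) = dil k f - dil k g"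
  unfolding dil_def by (rule fps_compose_sub_distrib)

lemma dil_1: "dil k 1 = 1"
  unfolding dil_def by simp

lemma dil_X: "dil k fps_X = fps_X ^ k"
  using k unfolding dil_def by simp

lemma dil_X_power: "dil k (fps_X ^ n) = fps_X ^ (k * n)"
  by (simp add: dil_power dil_X power_mult)

lemma dil_numeral: "dil k (numeral n) = numeral n"
  unfolding dil_def using k by (metis fps_compose_nth_0 fps_const_compose numeral_fps_const)

lemma dil_prod: "dil k (\<Prod>i\<in>A. f i) = (\<Prod>i\<in>A. dil k (f i))"
  by (induction A rule: infinite_finite_induct) (auto simp: dil_mult dil_1)

lemma dil_inverse: "fps_nth f 0 \<noteq> 0 \<Longrightarrow> dil k (inverse f) = inverse (dil k (f :: 'a::field fps))"
  unfolding dil_def by (rule fps_inverse_compose) (use k in auto)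

lemma dil_nth_0: "fps_nth (dil k f) 0 = fps_nth f 0"
  using k by (simp add: dil_nth)

lemma dil_inject: "dil k f = dil k g \<longleftrightarrow> f = g"
proof
  assume *: "dil k f = dil k g"
  show "f = g"
  proof (rule fps_ext)
    fix m
    have "fps_nth (dil k f) (k * m) = fps_nth (dil k g) (k * m)" by (simp add: *)
    then show "fps_nth f m = fps_nth g m" using k by (simp add: dil_nth)
  qed
qed simp

lemma dil_dil: "l > 0 \<Longrightarrow> dil k (dil l f) = dil (k * l) f"
proof (rule fps_ext)
  fix m
  assume l: "l > 0"
  have "l dvd m div k \<longleftrightarrow> k * l dvd m" if "k dvd m"
    using that k by (auto simp: dvd_def)
  moreover have "k dvd m" if "k * l dvd m" using that by (rule dvd_mult_left)
  ultimately show "fps_nth (dil k (dil l f)) m = fps_nth (dil (k * l) f) m"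
    using k l by (auto simp: dil_nth div_mult2_eq)
qed

lemma dil_tendsto:
  assumes "(f \<longlongrightarrow> a) F"
  shows "((\<lambda>x. dil k (f x)) \<longlongrightarrow> dil k a) F"
proof (rule tendsto_fpsI)
  fix m
  have "eventually (\<lambda>x. fps_nth (f x) (m div k) = fps_nth a (m div k)) F"
    using assms by (auto simp: tendsto_fps_iff)
  then show "eventually (\<lambda>x. fps_nth (dil k (f x)) m = fps_nth (dil k a) m) F"
    by eventually_elim (use k in \<open>auto simp: dil_nth\<close>)
qed

lemma sect_add: "sect k r (f + g) = sect k r f + sect k r g"
  and sect_diff: "sect k r (f - g) = sect k r f - sect k r g"
  by (simp_all add: sect_def fps_eq_iff)

lemma sect_X_dil:
  assumes "r < k"
  shows "sect k r (fps_X ^ s * dil k g) = (if s mod k = r then fps_X ^ (s div k) * g else 0)"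
proof (rule fps_ext)
  fix n
  show "fps_nth (sect k r (fps_X ^ s * dil k g)) n =
    fps_nth (if s mod k = r then fps_X ^ (s div k) * g else 0) n"
  proof (cases "s mod k = r")
    case True
    define t where "t = s div k"
    have s: "s = k * t + r" using mult_div_mod_eq[of k s] True unfolding t_def by (simp only:)
    have "k * n + r < k * t + r \<longleftrightarrow> n < t" using k by simp
    moreover have "k * n + r - (k * t + r) = k * (n - t)" by (simp add: diff_mult_distrib2)
    ultimately show ?thesis using True assms k
      by (simp add: s sect_def fps_X_power_mult_nth dil_nth)
  next
    case False
    have "\<not> k dvd k * n + r - s" if "\<not> k * n + r < s"
    proof
      assume "k dvd k * n + r - s"
      then obtain c where "k * n + r - s = k * c" by (rule dvdE)
      then have "k * n + r = s + k * c" using that by simp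
      then have "(k * n + r) mod k = (s + k * c) mod k" by simp
      then show False using False assms by simp
    qed
    then show ?thesis using False k
      by (simp add: sect_def fps_X_power_mult_nth dil_nth)
  qed
qed

end

lemma sect_dissection:
  assumes "k > 0"
  shows "f = (\<Sum>r<k. fps_X ^ r * dil k (sect k r f))"
proof (rule fps_ext)
  fix m
  have "fps_nth (fps_X ^ r * dil k (sect k r f)) m = (if r = m mod k then fps_nth f m else 0)" if "r < k" for r
  proof (cases "r = m mod k")
    case True
    then have "k dvd m - r" by (simp add: dvd_minus_mod)
    moreover have "\<not> m < r" using True mod_less_eq_dividend[of m k] by linarith
    ultimately show ?thesis using True assms by (simp add: fps_X_power_mult_nth dil_nth sect_def)
  next
    case False
    have "\<not> k dvd m - r" if "\<not> m < r"
    proof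
      assume "k dvd m - r"
      then have "m mod k = r mod k" using that by (simp add: mod_eq_dvd_iff_nat)
      then show False using False \<open>r < k\<close> by simp
    qed
    then show ?thesis using False assms by (simp add: fps_X_power_mult_nth dil_nth)
  qed
  then have "fps_nth (\<Sum>r<k. fps_X ^ r * dil k (sect k r f)) m = (\<Sum>r<k. if r = m mod k then fps_nth f m else 0)"
    by (simp add: fps_sum_nth)
  then show "fps_nth f m = fps_nth (\<Sum>r<k. fps_X ^ r * dil k (sect k r f)) m"
    using assms by simp
qed

lemma sect_dil_sum:
  assumes "r < k"
  shows "sect k r (\<Sum>s<k. fps_X ^ s * dil k (h s)) = h r"
proof -
  have k: "k > 0" using assms by simp
  have "sect k r (\<Sum>s\<in>A. fps_X ^ s * dil k (h s)) = (\<Sum>s\<in>A. if s = r then h s else 0)" if "A \<subseteq> {..<k}" for A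
  proof -
    have "finite A" using that finite_subset by blast
    then show ?thesis using that
    proof (induction A)
      case (insert s A)
      then have "s < k" by simp
      then show ?case using insert sect_X_dil[OF k assms, of s "h s"] by (auto simp: sect_add)
    qed (simp add: sect_def fps_eq_iff)
  qed
  from this[of "{..<k}"] show ?thesis using assms by simp
qed

text \<open>Sections are linear over the series in q^k. This is the rule by which known factors are
  moved through a section in all that follows.\<close>

lemma sect_mult_dil:
  assumes "r < k"
  shows "sect k r (f * dil k g) = sect k r f * g"
proof -
  have k: "k > 0" using assms by simp
  have "f * dil k g = (\<Sum>s<k. fps_X ^ s * dil k (sect k s f)) * dil k g"
    by (subst sect_dissection[OF k, of f]) simp
  also have "\<dots> = (\<Sum>s<k. fps_X ^ s * dil k (sect k s f * g))"
    using k by (simp add: sum_distrib_right dil_mult mult.assoc)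
  finally show ?thesis using sect_dil_sum[OF assms, of "\<lambda>s. sect k s f * g"] by simp
qed

section \<open>Reindexing infinite sums\<close>

lemma fsum_cong_inj:
  fixes g :: "'j \<Rightarrow> 'a::idom fps"
  assumes "inj p" "\<And>j. j \<notin> range p \<Longrightarrow> g j = 0"
  shows "fsum (\<lambda>i. g (p i)) = fsum g"
proof (rule fps_ext)
  fix m
  have "bij_betw p {i. fps_nth (g (p i)) m \<noteq> 0} {j. fps_nth (g j) m \<noteq> 0}"
  proof (rule bij_betw_imageI)
    show "inj_on p {i. fps_nth (g (p i)) m \<noteq> 0}"
      using assms by (meson inj_on_subset subset_UNIV)
    show "p ` {i. fps_nth (g (p i)) m \<noteq> 0} = {j. fps_nth (g j) m \<noteq> 0}"
    proof (intro equalityI subsetI)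
      fix j assume j: "j \<in> {j. fps_nth (g j) m \<noteq> 0}"
      then have "j \<in> range p" by (metis (mono_tags) assms(2) fps_zero_nth mem_Collect_eq)
      with j show "j \<in> p ` {i. fps_nth (g (p i)) m \<noteq> 0}" by auto
    qed auto
  qed
  then show "fps_nth (fsum (\<lambda>i. g (p i))) m = fps_nth (fsum g) m"
    unfolding fsum_def fps_nth_Abs_fps
    by (rule sum.reindex_bij_betw[where g = "\<lambda>j. fps_nth (g j) m"])
qed

lemma fsum_Suc:
  assumes "\<And>n. fps_X ^ n dvd (g n :: 'a::idom fps)"
  shows "fsum (\<lambda>n. g (Suc n)) = fsum g - g 0"
proof -
  let ?h = "\<lambda>n. if n = 0 then 0 else g n"
  let ?k = "\<lambda>n::nat. if n = 0 then g 0 else 0"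
  have "fsum (\<lambda>n. ?h (Suc n)) = fsum ?h"
  proof (rule fsum_cong_inj[of Suc])
    fix j assume "j \<notin> range Suc"
    then have "j = 0" by (cases j) auto
    then show "?h j = 0" by simp
  qed auto
  moreover have "fsum g = fsum (\<lambda>n. ?h n + ?k n)" by (rule arg_cong[of _ _ fsum]) auto
  moreover have "fsum (\<lambda>n. ?h n + ?k n) = fsum ?h + fsum ?k"
  proof (rule fsum_add)
    show "locally_finite ?h" "locally_finite ?k"
      by (rule locally_finite_natI, use assms in auto)+
  qed
  moreover have "fsum ?k = g 0"
  proof (rule fps_ext)
    fix m
    show "fps_nth (fsum ?k) m = fps_nth (g 0) m"
      by (subst fsum_nth_superset[of "{0}"]) (auto split: if_splits)
  qed
  ultimately show ?thesis by simp
qed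

lemma X_power_dvd_fsum:
  assumes "\<And>i. fps_X ^ n dvd (g i :: 'a::idom fps)"
  shows "fps_X ^ n dvd fsum g"
  using assms by (auto simp: X_power_dvd_iff fsum_def)

lemma sect_fsum: "sect k r (fsum g) = fsum (\<lambda>i. sect k r (g i))"
  by (auto simp: fps_eq_iff sect_def fsum_def)

lemma dil_fsum:
  assumes "k > 0"
  shows "dil k (fsum g) = fsum (\<lambda>i. dil k (g i))"
  using assms by (intro fps_ext) (simp add: dil_nth fsum_def)

section \<open>The Jacobi triple product\<close>

definition eprod :: "nat \<Rightarrow> nat \<Rightarrow> complex fps" where
  "eprod c n = (\<Prod>k<n. 1 - fps_X ^ (c * (k + 1)))"

lemma eprod_0 [simp]: "eprod c 0 = 1"
  and eprod_Suc: "eprod c (Suc n) = eprod c n * (1 - fps_X ^ (c * (n + 1)))"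
  by (simp_all add: eprod_def)

lemma eprod_nth_0 [simp]: "c > 0 \<Longrightarrow> fps_nth (eprod c n) 0 = 1"
  by (induction n) (auto simp: eprod_Suc)

lemma eprod_tendsto:
  assumes "c > 0"
  shows "eprod c \<longlonglongrightarrow> E c"
proof -
  have "(\<lambda>n. \<Prod>k\<le>n. 1 - fps_X ^ (c * (k + 1))) \<longlonglongrightarrow> E c"
    by (rule has_prod_imp_tendsto[OF has_prod_E[OF assms]])
  then have "(\<lambda>n. eprod c (Suc n)) \<longlonglongrightarrow> E c"
    by (simp add: eprod_def lessThan_Suc_atMost)
  then show ?thesis by (rule LIMSEQ_imp_Suc)
qed

lemma E_nth_0 [simp]: "c > 0 \<Longrightarrow> fps_nth (E c) 0 = 1"
  by (rule fps_nth_0_tendsto[OF eprod_tendsto]) auto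

lemma E_nonzero [simp]: "c > 0 \<Longrightarrow> E c \<noteq> 0"
  using E_nth_0[of c] by (metis fps_zero_nth zero_neq_one)

lemma dil_E:
  assumes "k > 0" "c > 0"
  shows "dil k (E c) = E (k * c)"
proof -
  have "dil k (eprod c n) = eprod (k * c) n" for n
    using assms by (simp add: eprod_def dil_prod dil_diff dil_1 dil_X_power distrib_left mult.assoc)
  then have "eprod (k * c) \<longlonglongrightarrow> dil k (E c)"
    using dil_tendsto[OF assms(1) eprod_tendsto[OF assms(2)]] by simp
  moreover have "eprod (k * c) \<longlonglongrightarrow> E (k * c)" using assms by (intro eprod_tendsto) simp
  ultimately show ?thesis by (rule LIMSEQ_unique)
qed

definition ieprod :: "nat \<Rightarrow> nat \<Rightarrow> complex fps" where
  "ieprod c n = inverse (eprod c n)"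

lemma ieprod_0 [simp]: "ieprod c 0 = 1"
  by (simp add: ieprod_def)

lemma ieprod_mult [simp]:
  assumes "c > 0"
  shows "eprod c n * ieprod c n = 1" "ieprod c n * eprod c n = 1"
  using assms by (simp_all add: ieprod_def inverse_mult_eq_1 inverse_mult_eq_1')

lemma ieprod_Suc:
  assumes "c > 0"
  shows "ieprod c (Suc n) * (1 - fps_X ^ (c * (n + 1))) = ieprod c n"
proof -
  have "ieprod c (Suc n) * (1 - fps_X ^ (c * (n + 1))) * (eprod c n * ieprod c n)
    = ieprod c (Suc n) * eprod c (Suc n) * ieprod c n"
    by (simp only: eprod_Suc mult_ac)
  then show ?thesis using assms by simp
qed

lemma ieprod_tendsto: "c > 0 \<Longrightarrow> ieprod c \<longlonglongrightarrow> inverse (E c)"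
  unfolding ieprod_def by (intro fps_tendsto_inverse eprod_tendsto) auto

text \<open>The division is exact and the value nonnegative. Exponents are compared through
  \<open>double_texp\<close>, where neither \<open>div\<close> nor \<open>nat\<close>
  occurs.\<close>

definition texp :: "nat \<Rightarrow> nat \<Rightarrow> int \<Rightarrow> nat" where
  "texp a b j = nat ((int a * (j * (j + 1)) + int b * (j * (j - 1))) div 2)"

text \<open>For \<open>s = 1\<close> or \<open>s = -1\<close>, where \<open>s ^ nat \<bar>j\<bar>\<close> is the integer power of \<open>s\<close>, this is
  Ramanujan's theta function \<open>f(s q\<^sup>a, s q\<^sup>b)\<close>.\<close>

definition theta :: "complex fps \<Rightarrow> nat \<Rightarrow> nat \<Rightarrow> complex fps" where
  "theta s a b = fsum (\<lambda>j :: int. s ^ nat \<bar>j\<bar> * fps_X ^ texp a b j)"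

lemma texp_nonneg: "0 \<le> (int a * (j * (j + 1)) + int b * (j * (j - 1))) div 2"
proof -
  have "0 \<le> j * (j + 1)" "0 \<le> j * (j - 1)" by (auto simp: zero_le_mult_iff)
  then show ?thesis by simp
qed

lemma double_texp: "2 * int (texp a b j) = int a * (j * (j + 1)) + int b * (j * (j - 1))"
  unfolding texp_def using texp_nonneg[of a j b] by (auto simp: dvd_mult)

lemma double_int_cancel: "2 * int x = 2 * int y \<Longrightarrow> x = y"
  by simp

lemma texp_ge:
  assumes "a > 0" "b > 0"
  shows "nat \<bar>j\<bar> \<le> texp a b j"
proof -
  have 1: "j * (j + 1) \<ge> 0" "j * (j - 1) \<ge> 0" by (auto simp: zero_le_mult_iff)
  have "1 * (j * (j + 1)) \<le> int a * (j * (j + 1))" "1 * (j * (j - 1)) \<le> int b * (j * (j - 1))"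
    using assms 1 by (intro mult_right_mono; simp)+
  then have "2 * (j * j) \<le> 2 * int (texp a b j)" unfolding double_texp by (simp add: algebra_simps)
  moreover have "\<bar>j\<bar> \<le> j * j"
  proof (cases "j = 0")
    case False
    then have "1 * \<bar>j\<bar> \<le> \<bar>j\<bar> * \<bar>j\<bar>" by (intro mult_right_mono) auto
    then show ?thesis by simp
  qed simp
  ultimately show ?thesis by linarith
qed

lemma finite_texp_le:
  assumes "a > 0" "b > 0"
  shows "finite {j. texp a b j \<le> m}"
proof (rule finite_subset)
  show "{j. texp a b j \<le> m} \<subseteq> {- int m..int m}"
  proof
    fix j assume "j \<in> {j. texp a b j \<le> m}"
    then have "nat \<bar>j\<bar> \<le> m" using texp_ge[OF assms, of j] by simp
    then show "j \<in> {- int m..int m}" by (simp add: nat_le_iff abs_le_iff)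
  qed
qed auto

lemma locally_finite_theta:
  assumes "a > 0" "b > 0"
  shows "locally_finite (\<lambda>j. s ^ nat \<bar>j\<bar> * fps_X ^ texp a b j)"
  by (rule locally_finiteI[where e = "texp a b"]) (auto intro: finite_texp_le assms)

section \<open>A finite form of the triple product\<close>

context
  fixes a b :: nat and s :: "complex fps"
  assumes ab: "a > 0" "b > 0" and s: "s * s = 1"
begin

private definition "c = a + b"
private definition "e j = s ^ nat \<bar>j\<bar> * fps_X ^ texp a b j" for j :: int
text \<open>The Gaussian binomial coefficient of 2n over n + j in base q^c, divided by (q^c;
  q^c)_(2n).\<close>

private definition "G n j = (if \<bar>j\<bar> \<le> int n then ieprod c (nat (int n - j)) * ieprod c (nat (int n + j)) else 0)" for n j

private lemma c: "c > 0" using ab by (simp add: c_def)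

private lemma s_shift: "s ^ nat \<bar>j + 1\<bar> = s * s ^ nat \<bar>j\<bar>"
proof (cases "j \<ge> 0")
  case True
  then have "nat \<bar>j + 1\<bar> = Suc (nat \<bar>j\<bar>)" by simp
  then show ?thesis by (simp only: power_Suc)
next
  case False
  then have "nat \<bar>j\<bar> = Suc (nat \<bar>j + 1\<bar>)" by simp
  then have "s * s ^ nat \<bar>j\<bar> = (s * s) * s ^ nat \<bar>j + 1\<bar>" by (simp only: power_Suc mult.assoc)
  then show ?thesis by (simp only: s mult_1)
qed

text \<open>This shift and \<open>e_down\<close> carry the neighbours of index j in
  \<open>G_rec\<close> back to j; the price is exactly the q-power in one of the two new factors of
  the product.\<close>

private lemma e_up:
  assumes "\<bar>j\<bar> \<le> int m"
  shows "e (j + 1) * fps_X ^ (c * nat (int m - j)) = s * fps_X ^ (a + c * m) * e j"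
proof -
  have n: "int (nat (int m - j)) = int m - j" using assms by simp
  have "2 * int (texp a b (j + 1) + c * nat (int m - j)) = 2 * int (texp a b j + (a + c * m))"
    unfolding of_nat_add of_nat_mult distrib_left double_texp n
    by (simp add: c_def algebra_simps)
  then have "texp a b (j + 1) + c * nat (int m - j) = texp a b j + (a + c * m)" by (rule double_int_cancel)
  then have "(fps_X :: complex fps) ^ texp a b (j + 1) * fps_X ^ (c * nat (int m - j)) = fps_X ^ texp a b j * fps_X ^ (a + c * m)"
    by (simp only: flip: power_add)
  then show ?thesis by (simp add: e_def s_shift mult_ac)
qed

private lemma e_down:
  assumes "\<bar>j\<bar> \<le> int m"
  shows "e (j - 1) * fps_X ^ (c * nat (int m + j)) = s * fps_X ^ (b + c * m) * e j"
proof -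
  have n: "int (nat (int m + j)) = int m + j" using assms by simp
  have "2 * int (texp a b (j - 1) + c * nat (int m + j)) = 2 * int (texp a b j + (b + c * m))"
    unfolding of_nat_add of_nat_mult distrib_left double_texp n
    by (simp add: c_def algebra_simps)
  then have "texp a b (j - 1) + c * nat (int m + j) = texp a b j + (b + c * m)" by (rule double_int_cancel)
  then have *: "(fps_X :: complex fps) ^ texp a b (j - 1) * fps_X ^ (c * nat (int m + j)) = fps_X ^ texp a b j * fps_X ^ (b + c * m)"
    by (simp only: flip: power_add)
  have "s ^ nat \<bar>j - 1\<bar> = s * s ^ nat \<bar>j\<bar>"
    using s_shift[of "j - 1"] s by (simp add: mult.assoc[symmetric])
  with * show ?thesis by (simp add: e_def mult_ac)
qed

text \<open>Two steps of the q-Pascal rule at once. At the ends j = m + 1 and j = -(m + 1) only one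
  of the three terms on the right survives, which is why these cases are separated.\<close>

private lemma G_rec:
  assumes "\<bar>j\<bar> \<le> int m + 1"
  shows "G (Suc m) j * ((1 - fps_X ^ (c * (2 * m + 1))) * (1 - fps_X ^ (c * (2 * m + 2)))) =
     G m j * (1 + fps_X ^ (c * (2 * m + 1))) + G m (j - 1) * fps_X ^ (c * nat (int m + 1 - j))
     + G m (j + 1) * fps_X ^ (c * nat (int m + 1 + j))"
proof -
  let ?p = "fps_X ^ c :: complex fps"
  have "ieprod c (Suc (Suc (2 * m))) * (1 - fps_X ^ (c * (2 * m + 2))) = ieprod c (Suc (2 * m))"
    "ieprod c (Suc (2 * m)) * (1 - fps_X ^ (c * (2 * m + 1))) = ieprod c (2 * m)"
    using ieprod_Suc[OF c, of "2 * m"] ieprod_Suc[OF c, of "Suc (2 * m)"] by simp_all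
  moreover have "x * (p * q) = z" if "x * q = y" "y * p = z" for x y z p q :: "complex fps"
    using that by (simp add: mult_ac)
  ultimately have two: "ieprod c (Suc (Suc (2 * m))) * ((1 - fps_X ^ (c * (2 * m + 1))) * (1 - fps_X ^ (c * (2 * m + 2)))) = ieprod c (2 * m)"
    by blast
  consider "\<bar>j\<bar> \<le> int m" | "j = int m + 1" | "j = - (int m + 1)" using assms by linarith
  then show ?thesis
  proof cases
    case 1
    define u v where "u = nat (int m - j)" and "v = nat (int m + j)"
    have uv: "int m - j = int u" "int m + j = int v" using 1 by (auto simp: u_def v_def)
    have sum: "u + v = 2 * m" using uv by linarith
    have jj: "j = int m - int u" using uv by linarith
    define x y where "x = ?p ^ u" and "y = ?p ^ v"
    define Q R where "Q = ieprod c (Suc u)" and "R = ieprod c (Suc v)"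
    have iu: "ieprod c u = Q * (1 - ?p * x)" and iv: "ieprod c v = R * (1 - ?p * y)"
      using ieprod_Suc[OF c] by (simp_all add: Q_def R_def x_def y_def power_add power_mult)
    have g0: "G (Suc m) j = Q * R"
    proof -
      have "nat (int (Suc m) - j) = Suc u" "nat (int (Suc m) + j) = Suc v" using uv by linarith+
      then show ?thesis using 1 by (simp add: G_def Q_def R_def)
    qed
    have g1: "G m j = ieprod c u * ieprod c v" using 1 by (simp add: G_def u_def v_def)
    have g2: "G m (j - 1) = Q * ieprod c v * (1 - y)"
    proof (cases v)
      case 0
      then have "j = - int m" using uv by linarith
      then show ?thesis using 0 by (simp add: G_def y_def)
    next
      case (Suc w)
      have "\<bar>j - 1\<bar> \<le> int m" "nat (int m - (j - 1)) = Suc u" "nat (int m + (j - 1)) = w"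
        using uv 1 Suc by linarith+
      moreover have "ieprod c w = ieprod c v * (1 - y)"
        using ieprod_Suc[OF c, of w] by (simp only: Suc y_def power_mult Suc_eq_plus1)
      ultimately show ?thesis by (simp add: G_def Q_def)
    qed
    have g3: "G m (j + 1) = R * ieprod c u * (1 - x)"
    proof (cases u)
      case 0
      then have "j = int m" using uv by linarith
      then show ?thesis using 0 by (simp add: G_def x_def)
    next
      case (Suc w)
      have "\<bar>j + 1\<bar> \<le> int m" "nat (int m + (j + 1)) = Suc v" "nat (int m - (j + 1)) = w"
        using uv 1 Suc by linarith+
      moreover have "ieprod c w = ieprod c u * (1 - x)"
        using ieprod_Suc[OF c, of w] by (simp only: Suc x_def power_mult Suc_eq_plus1)
      ultimately show ?thesis by (simp add: G_def R_def)
    qed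
    have e1: "fps_X ^ (c * (2 * m + 1)) = x * y * ?p"
      by (simp add: x_def y_def power_add power_mult flip: sum)
    have e2: "fps_X ^ (c * (2 * m + 2)) = x * y * ?p * ?p"
      by (simp add: x_def y_def power_add power_mult power2_eq_square flip: sum)
    have e3: "fps_X ^ (c * nat (int m + 1 - j)) = x * ?p"
    proof -
      have "nat (int m + 1 - j) = Suc u" using uv by linarith
      then show ?thesis by (simp only: x_def power_mult power_Suc2)
    qed
    have e4: "fps_X ^ (c * nat (int m + 1 + j)) = y * ?p"
    proof -
      have "nat (int m + 1 + j) = Suc v" using uv by linarith
      then show ?thesis by (simp only: y_def power_mult power_Suc2)
    qed
    show ?thesis unfolding g0 g1 g2 g3 e1 e2 e3 e4 iu iv by algebra
  next
    case 2
    have "nat (int (Suc m) - j) = 0" "nat (int (Suc m) + j) = Suc (Suc (2 * m))"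
      "nat (int m - (j - 1)) = 0" "nat (int m + (j - 1)) = 2 * m" "nat (int m + 1 - j) = 0"
      using 2 by linarith+
    then have "G (Suc m) j = ieprod c (Suc (Suc (2 * m)))" "G m (j - 1) = ieprod c (2 * m)"
      "G m j = 0" "G m (j + 1) = 0" "nat (int m + 1 - j) = 0"
      using 2 by (simp_all add: G_def)
    then show ?thesis using two by simp
  next
    case 3
    have "nat (int (Suc m) + j) = 0" "nat (int (Suc m) - j) = Suc (Suc (2 * m))"
      "nat (int m + (j + 1)) = 0" "nat (int m - (j + 1)) = 2 * m" "nat (int m + 1 + j) = 0"
      using 3 by linarith+
    then have "G (Suc m) j = ieprod c (Suc (Suc (2 * m)))" "G m (j + 1) = ieprod c (2 * m)"
      "G m j = 0" "G m (j - 1) = 0" "nat (int m + 1 + j) = 0"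
      using 3 by (simp_all add: G_def)
    then show ?thesis using two by simp
  qed
qed

private definition "F m = (\<Sum>j\<in>{- int m..int m}. e j * G m j)" for m

private lemma F_superset:
  assumes "{- int m..int m} \<subseteq> A" "finite A"
  shows "(\<Sum>j\<in>A. f j * G m j) = (\<Sum>j\<in>{- int m..int m}. f j * G m j)"
  using assms by (intro sum.mono_neutral_right) (auto simp: G_def)

private lemma F_rec:
  "F (Suc m) * ((1 - fps_X ^ (c * (2 * m + 1))) * (1 - fps_X ^ (c * (2 * m + 2))))
    = F m * ((1 + s * fps_X ^ (a + c * m)) * (1 + s * fps_X ^ (b + c * m)))"
proof -
  let ?I = "{- int (Suc m)..int (Suc m)}" and ?J = "{- int m..int m}"
  have 1: "(\<Sum>j\<in>?I. e j * fps_X ^ (c * nat (int m + 1 - j)) * G m (j - 1)) = (\<Sum>j\<in>?J. s * fps_X ^ (a + c * m) * e j * G m j)"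
  proof -
    have "(\<Sum>j\<in>?I. e j * fps_X ^ (c * nat (int m + 1 - j)) * G m (j - 1))
        = (\<Sum>j\<in>(\<lambda>j. j - 1) ` ?I. e (j + 1) * fps_X ^ (c * nat (int m - j)) * G m j)"
      by (subst sum.reindex) (auto simp: inj_on_def algebra_simps)
    also have "\<dots> = (\<Sum>j\<in>?J. e (j + 1) * fps_X ^ (c * nat (int m - j)) * G m j)"
      by (rule F_superset) (auto simp: image_iff Bex_def intro!: exI[of _ "_ + 1"])
    also have "\<dots> = (\<Sum>j\<in>?J. s * fps_X ^ (a + c * m) * e j * G m j)"
    proof (intro sum.cong refl)
      fix j assume "j \<in> ?J"
      then have "\<bar>j\<bar> \<le> int m" by auto
      then show "e (j + 1) * fps_X ^ (c * nat (int m - j)) * G m j = s * fps_X ^ (a + c * m) * e j * G m j"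
        by (simp only: e_up)
    qed
    finally show ?thesis .
  qed
  have 2: "(\<Sum>j\<in>?I. e j * fps_X ^ (c * nat (int m + 1 + j)) * G m (j + 1)) = (\<Sum>j\<in>?J. s * fps_X ^ (b + c * m) * e j * G m j)"
  proof -
    have "(\<Sum>j\<in>?I. e j * fps_X ^ (c * nat (int m + 1 + j)) * G m (j + 1))
        = (\<Sum>j\<in>(\<lambda>j. j + 1) ` ?I. e (j - 1) * fps_X ^ (c * nat (int m + j)) * G m j)"
      by (subst sum.reindex) (auto simp: inj_on_def algebra_simps)
    also have "\<dots> = (\<Sum>j\<in>?J. e (j - 1) * fps_X ^ (c * nat (int m + j)) * G m j)"
      by (rule F_superset) (auto simp: image_iff Bex_def intro!: exI[of _ "_ - 1"])
    also have "\<dots> = (\<Sum>j\<in>?J. s * fps_X ^ (b + c * m) * e j * G m j)"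
    proof (intro sum.cong refl)
      fix j assume "j \<in> ?J"
      then have "\<bar>j\<bar> \<le> int m" by auto
      then show "e (j - 1) * fps_X ^ (c * nat (int m + j)) * G m j = s * fps_X ^ (b + c * m) * e j * G m j"
        by (simp only: e_down)
    qed
    finally show ?thesis .
  qed
  have 0: "(\<Sum>j\<in>?I. e j * G m j) = F m" unfolding F_def by (rule F_superset) auto
  have "F (Suc m) * ((1 - fps_X ^ (c * (2 * m + 1))) * (1 - fps_X ^ (c * (2 * m + 2))))
     = (\<Sum>j\<in>?I. e j * (G (Suc m) j * ((1 - fps_X ^ (c * (2 * m + 1))) * (1 - fps_X ^ (c * (2 * m + 2))))))"
    unfolding F_def by (simp add: sum_distrib_right mult.assoc)
  also have "\<dots> = (\<Sum>j\<in>?I. e j * (G m j * (1 + fps_X ^ (c * (2 * m + 1))) + G m (j - 1) * fps_X ^ (c * nat (int m + 1 - j))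
     + G m (j + 1) * fps_X ^ (c * nat (int m + 1 + j))))"
    by (intro sum.cong refl arg_cong2[where f = "(*)"] G_rec) auto
  also have "\<dots> = (\<Sum>j\<in>?I. e j * G m j) * (1 + fps_X ^ (c * (2 * m + 1)))
     + (\<Sum>j\<in>?I. e j * fps_X ^ (c * nat (int m + 1 - j)) * G m (j - 1))
     + (\<Sum>j\<in>?I. e j * fps_X ^ (c * nat (int m + 1 + j)) * G m (j + 1))"
    unfolding sum_distrib_right sum.distrib[symmetric]
    by (intro sum.cong refl) (simp only: distrib_left mult_ac)
  also have "\<dots> = F m * (1 + fps_X ^ (c * (2 * m + 1))) + s * fps_X ^ (a + c * m) * F m + s * fps_X ^ (b + c * m) * F m"
    unfolding 0 1 2 by (simp add: F_def sum_distrib_left mult.assoc)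
  also have "\<dots> = F m * ((1 + s * fps_X ^ (a + c * m)) * (1 + s * fps_X ^ (b + c * m)))"
  proof -
    have "(s * fps_X ^ (a + c * m)) * (s * fps_X ^ (b + c * m)) = (s * s) * fps_X ^ ((a + c * m) + (b + c * m))"
      unfolding power_add by (simp add: mult_ac)
    also have "(a + c * m) + (b + c * m) = c * (2 * m + 1)" by (simp add: c_def algebra_simps)
    finally show ?thesis using s by (simp add: algebra_simps)
  qed
  finally show ?thesis .
qed

private lemma F_prod:
  "F m * eprod c (2 * m) = (\<Prod>k<m. (1 + s * fps_X ^ (a + c * k)) * (1 + s * fps_X ^ (b + c * k)))"
proof (induction m)
  case 0
  show ?case by (simp add: F_def e_def G_def texp_def)
next
  case (Suc m)
  have "eprod c (2 * Suc m) = ((1 - fps_X ^ (c * (2 * m + 1))) * (1 - fps_X ^ (c * (2 * m + 2)))) * eprod c (2 * m)"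
    by (simp add: eprod_Suc mult_ac)
  then have "F (Suc m) * eprod c (2 * Suc m) = F (Suc m) * ((1 - fps_X ^ (c * (2 * m + 1))) * (1 - fps_X ^ (c * (2 * m + 2)))) * eprod c (2 * m)"
    by (simp only: mult.assoc)
  also have "\<dots> = F m * eprod c (2 * m) * ((1 + s * fps_X ^ (a + c * m)) * (1 + s * fps_X ^ (b + c * m)))"
    unfolding F_rec by (simp only: mult_ac)
  finally show ?case unfolding Suc.IH by (simp add: mult_ac)
qed

private lemma F_tendsto: "F \<longlonglongrightarrow> inverse (E c) * inverse (E c) * theta s a b"
proof -
  have "F \<longlonglongrightarrow> fsum (\<lambda>j. inverse (E c) * inverse (E c) * e j)"
    unfolding F_def
  proof (rule tendsto_fsum)
    fix j :: int
    have l: "filterlim (\<lambda>N. nat (int N + d)) at_top sequentially" for d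
      unfolding filterlim_at_top
    proof
      fix Z
      show "eventually (\<lambda>N. Z \<le> nat (int N + d)) sequentially"
        using eventually_ge_at_top[of "Z + nat \<bar>d\<bar>"] by eventually_elim linarith
    qed
    have "(\<lambda>N. ieprod c (nat (int N + - j)) * ieprod c (nat (int N + j))) \<longlonglongrightarrow> inverse (E c) * inverse (E c)"
      by (intro fps_tendsto_mult filterlim_compose[OF ieprod_tendsto[OF c] l])
    then have "(\<lambda>N. e j * (ieprod c (nat (int N + - j)) * ieprod c (nat (int N + j)))) \<longlonglongrightarrow> e j * (inverse (E c) * inverse (E c))"
      by (rule fps_tendsto_mult[OF tendsto_const])
    then show "(\<lambda>N. e j * G N j) \<longlonglongrightarrow> inverse (E c) * inverse (E c) * e j"
    proof (rule Lim_transform_eventually[THEN tendsto_eq_rhs])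
      show "eventually (\<lambda>N. e j * (ieprod c (nat (int N + - j)) * ieprod c (nat (int N + j))) = e j * G N j) sequentially"
        using eventually_ge_at_top[of "nat \<bar>j\<bar>"] by eventually_elim (simp add: G_def)
    qed (simp add: mult_ac)
    show "eventually (\<lambda>N. j \<in> {- int N..int N}) sequentially"
      using eventually_ge_at_top[of "nat \<bar>j\<bar>"] by eventually_elim auto
  next
    show "finite {j. texp a b j \<le> m}" for m by (rule finite_texp_le[OF ab])
  qed (auto simp: e_def)
  also have "fsum (\<lambda>j. inverse (E c) * inverse (E c) * e j) = inverse (E c) * inverse (E c) * theta s a b"
    unfolding theta_def e_def by (rule fsum_mult, rule locally_finite_theta[OF ab])
  finally show ?thesis .
qed

theorem jacobi_triple_product:
  "(\<lambda>m. \<Prod>k<m. (1 + s * fps_X ^ (a + (a + b) * k)) * (1 + s * fps_X ^ (b + (a + b) * k)) *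
     (1 - fps_X ^ ((a + b) * (k + 1)))) \<longlonglongrightarrow> theta s a b"
proof -
  have "filterlim (\<lambda>m::nat. 2 * m) at_top sequentially"
    by (rule filterlim_subseq) (simp add: strict_mono_def)
  then have "(\<lambda>m. F m * eprod c (2 * m) * eprod c m) \<longlonglongrightarrow> (inverse (E c) * inverse (E c) * theta s a b) * E c * E c"
    by (intro fps_tendsto_mult F_tendsto eprod_tendsto[OF c] filterlim_compose[OF eprod_tendsto[OF c]])
  also have "(inverse (E c) * inverse (E c) * theta s a b) * E c * E c = (inverse (E c) * E c) * (inverse (E c) * E c) * theta s a b"
    by (simp only: mult_ac)
  also have "inverse (E c) * E c = 1" by (rule inverse_mult_eq_1) (simp add: c)
  finally show ?thesis unfolding F_prod by (simp add: eprod_def c_def prod.distrib mult_ac)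
qed

end

section \<open>Theta functions as eta quotients\<close>

lemma inverse_E_mult [simp]: "c > 0 \<Longrightarrow> inverse (E c) * E c = 1" "c > 0 \<Longrightarrow> E c * inverse (E c) = 1"
  by (simp_all add: inverse_mult_eq_1 inverse_mult_eq_1')

lemma mult_at_top: "c > 0 \<Longrightarrow> filterlim (\<lambda>m::nat. c * m) at_top sequentially"
  by (rule filterlim_subseq) (simp add: strict_mono_def)

section \<open>Products over all exponents and over odd exponents\<close>

definition plus_prod :: "nat \<Rightarrow> nat \<Rightarrow> complex fps" where
  "plus_prod c n = (\<Prod>k<n. 1 + fps_X ^ (c * (k + 1)))"

definition odd_prod :: "nat \<Rightarrow> nat \<Rightarrow> complex fps" where
  "odd_prod c n = (\<Prod>k<n. 1 - fps_X ^ (c * (2 * k + 1)))"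

definition odd_plus_prod :: "nat \<Rightarrow> nat \<Rightarrow> complex fps" where
  "odd_plus_prod c n = (\<Prod>k<n. 1 + fps_X ^ (c * (2 * k + 1)))"

lemma one_plus_times_one_minus: "(1 + (x :: 'a::comm_ring_1) ^ n) * (1 - x ^ n) = 1 - x ^ (2 * n)"
  by (simp add: algebra_simps power_mult power2_eq_square mult.commute[of 2 n])

lemma plus_prod_mult_eprod: "plus_prod c n * eprod c n = eprod (2 * c) n"
  unfolding plus_prod_def eprod_def prod.distrib[symmetric]
  by (intro prod.cong refl) (simp only: one_plus_times_one_minus mult.assoc)

lemma odd_prod_mult_eprod: "odd_prod c n * eprod (2 * c) n = eprod c (2 * n)"
proof (induction n)
  case (Suc n)
  have "odd_prod c (Suc n) * eprod (2 * c) (Suc n) = (odd_prod c n * eprod (2 * c) n) *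
    ((1 - fps_X ^ (c * (2 * n + 1))) * (1 - fps_X ^ (c * (2 * n + 2))))"
    by (simp add: odd_prod_def eprod_Suc mult_ac)
  also have "\<dots> = eprod c (2 * Suc n)"
    unfolding Suc.IH by (simp add: eprod_Suc mult_ac)
  finally show ?case .
qed (simp add: odd_prod_def)

lemma odd_plus_prod_mult_odd_prod: "odd_plus_prod c n * odd_prod c n = odd_prod (2 * c) n"
  unfolding odd_prod_def odd_plus_prod_def prod.distrib[symmetric]
  by (intro prod.cong refl) (simp only: one_plus_times_one_minus mult.assoc)

lemma odd_prod_nth_0 [simp]: "c > 0 \<Longrightarrow> fps_nth (odd_prod c n) 0 = 1"
  by (induction n) (auto simp: odd_prod_def)

lemma plus_prod_tendsto:
  assumes "c > 0"
  shows "plus_prod c \<longlonglongrightarrow> E (2 * c) * inverse (E c)"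
proof -
  have "(\<lambda>n. eprod (2 * c) n * ieprod c n) \<longlonglongrightarrow> E (2 * c) * inverse (E c)"
    using assms by (intro fps_tendsto_mult eprod_tendsto ieprod_tendsto) auto
  also have "(\<lambda>n. eprod (2 * c) n * ieprod c n) = plus_prod c"
    using assms by (simp add: plus_prod_mult_eprod[symmetric] mult.assoc)
  finally show ?thesis .
qed

lemma odd_prod_tendsto:
  assumes "c > 0"
  shows "odd_prod c \<longlonglongrightarrow> E c * inverse (E (2 * c))"
proof -
  have "(\<lambda>n. eprod c (2 * n) * ieprod (2 * c) n) \<longlonglongrightarrow> E c * inverse (E (2 * c))"
    using assms
    by (intro fps_tendsto_mult filterlim_compose[OF eprod_tendsto mult_at_top] ieprod_tendsto) auto
  also have "(\<lambda>n. eprod c (2 * n) * ieprod (2 * c) n) = odd_prod c"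
    using assms by (simp add: odd_prod_mult_eprod[symmetric] mult.assoc)
  finally show ?thesis .
qed

lemma odd_plus_prod_tendsto:
  assumes "c > 0"
  shows "odd_plus_prod c \<longlonglongrightarrow> E (2 * c) * inverse (E (4 * c)) * inverse (E c * inverse (E (2 * c)))"
proof -
  have nz: "fps_nth (E c * inverse (E (2 * c))) 0 \<noteq> 0" using assms by simp
  have "(\<lambda>n. odd_prod (2 * c) n * inverse (odd_prod c n)) \<longlonglongrightarrow>
      E (2 * c) * inverse (E (2 * (2 * c))) * inverse (E c * inverse (E (2 * c)))"
    using assms by (intro fps_tendsto_mult odd_prod_tendsto fps_tendsto_inverse nz) auto
  also have "(\<lambda>n. odd_prod (2 * c) n * inverse (odd_prod c n)) = odd_plus_prod c"
    using assms by (simp add: odd_plus_prod_mult_odd_prod[symmetric] mult.assoc inverse_mult_eq_1')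
  finally show ?thesis by simp
qed

lemma odd_plus_limit:
  assumes "c > 0"
  shows "E (2 * c) * inverse (E (4 * c)) * inverse (E c * inverse (E (2 * c))) * (E c * E (4 * c)) = E (2 * c) ^ 2"
proof -
  have "inverse (E c * inverse (E (2 * c))) = inverse (E c) * E (2 * c)"
    using assms by (simp add: fps_inverse_mult fps_inverse_idempotent)
  then have "E (2 * c) * inverse (E (4 * c)) * inverse (E c * inverse (E (2 * c))) * (E c * E (4 * c))
     = E (2 * c) ^ 2 * (inverse (E c) * E c) * (inverse (E (4 * c)) * E (4 * c))"
    by (simp only: power2_eq_square mult_ac)
  then show ?thesis using assms by simp
qed

text \<open>The sequence \<open>f\<close> regroups the partial products so that its limit
  \<open>L\<close> is already known; uniqueness of limits then evaluates the theta series.\<close>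

lemma jacobi_triple_product_eqI:
  assumes "a > 0" "b > 0" "s * s = 1" "c = a + b"
    and "f 0 = 1"
    and "\<And>m. f (Suc m) = f m * ((1 + s * fps_X ^ (a + c * m)) * (1 + s * fps_X ^ (b + c * m)) * (1 - fps_X ^ (c * (m + 1))))"
    and "f \<longlonglongrightarrow> L"
  shows "theta s a b = L"
proof -
  have "f m = (\<Prod>k<m. (1 + s * fps_X ^ (a + c * k)) * (1 + s * fps_X ^ (b + c * k)) * (1 - fps_X ^ (c * (k + 1))))" for m
    by (induction m) (simp_all only: assms prod.lessThan_Suc lessThan_0 prod.empty)
  then have "f \<longlonglongrightarrow> theta s a b"
    using jacobi_triple_product[OF assms(1,2,3)] assms(4) by presburger
  then show ?thesis using assms(7) by (rule LIMSEQ_unique)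
qed

lemma pentagonal_number_theorem: "theta (-1) 1 2 = E 1"
proof (rule jacobi_triple_product_eqI[where c = 3 and f = "\<lambda>m. eprod 1 (3 * m)"])
  fix m :: nat
  have *: "3 * Suc m = Suc (Suc (Suc (3 * m)))" by simp
  show "eprod 1 (3 * Suc m) = eprod 1 (3 * m) * ((1 + - 1 * fps_X ^ (1 + 3 * m)) *
      (1 + - 1 * fps_X ^ (2 + 3 * m)) * (1 - fps_X ^ (3 * (m + 1))))"
    unfolding * eprod_Suc by (simp add: numeral_eq_Suc mult_ac add_ac)
  show "(\<lambda>m. eprod 1 (3 * m)) \<longlonglongrightarrow> E 1"
    by (rule filterlim_compose[OF eprod_tendsto mult_at_top]) auto
qed auto

lemma theta_psi: "theta 1 1 3 * E 1 = E 2 ^ 2"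
proof -
  have "theta 1 1 3 = (E (2 * 1) * inverse (E (4 * 1)) * inverse (E 1 * inverse (E (2 * 1)))) * E 4"
  proof (rule jacobi_triple_product_eqI[where c = 4 and f = "\<lambda>m. odd_plus_prod 1 (2 * m) * eprod 4 m"])
    fix m :: nat
    have *: "2 * Suc m = Suc (Suc (2 * m))" by simp
    show "odd_plus_prod 1 (2 * Suc m) * eprod 4 (Suc m) = odd_plus_prod 1 (2 * m) * eprod 4 m *
      ((1 + 1 * fps_X ^ (1 + 4 * m)) * (1 + 1 * fps_X ^ (3 + 4 * m)) * (1 - fps_X ^ (4 * (m + 1))))"
      unfolding * eprod_Suc odd_plus_prod_def prod.lessThan_Suc by (simp add: numeral_eq_Suc mult_ac add_ac)
    show "(\<lambda>m. odd_plus_prod 1 (2 * m) * eprod 4 m) \<longlonglongrightarrow>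
       (E (2 * 1) * inverse (E (4 * 1)) * inverse (E 1 * inverse (E (2 * 1)))) * E 4"
      by (intro fps_tendsto_mult filterlim_compose[OF odd_plus_prod_tendsto mult_at_top] eprod_tendsto) auto
  qed (auto simp: odd_plus_prod_def)
  then show ?thesis using odd_plus_limit[of 1] by (simp add: mult_ac)
qed

lemma theta_phi: "theta 1 1 1 * (E 1 ^ 2 * E 4 ^ 2) = E 2 ^ 5"
proof -
  have "theta 1 1 1 = (E (2 * 1) * inverse (E (4 * 1)) * inverse (E 1 * inverse (E (2 * 1)))) ^ 2 * E 2"
  proof (rule jacobi_triple_product_eqI[where c = 2 and f = "\<lambda>m. odd_plus_prod 1 m ^ 2 * eprod 2 m"])
    fix m :: nat
    show "odd_plus_prod 1 (Suc m) ^ 2 * eprod 2 (Suc m) = odd_plus_prod 1 m ^ 2 * eprod 2 m *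
      ((1 + 1 * fps_X ^ (1 + 2 * m)) * (1 + 1 * fps_X ^ (1 + 2 * m)) * (1 - fps_X ^ (2 * (m + 1))))"
      unfolding eprod_Suc odd_plus_prod_def prod.lessThan_Suc power2_eq_square by (simp add: mult_ac)
    show "(\<lambda>m. odd_plus_prod 1 m ^ 2 * eprod 2 m) \<longlonglongrightarrow>
       (E (2 * 1) * inverse (E (4 * 1)) * inverse (E 1 * inverse (E (2 * 1)))) ^ 2 * E 2"
      by (intro fps_tendsto_mult fps_tendsto_power odd_plus_prod_tendsto eprod_tendsto) auto
  qed (auto simp: odd_plus_prod_def)
  then have "theta 1 1 1 * (E 1 ^ 2 * E 4 ^ 2) =
     (E (2 * 1) * inverse (E (4 * 1)) * inverse (E 1 * inverse (E (2 * 1))) * (E 1 * E (4 * 1))) ^ 2 * E 2"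
    by (simp add: power2_eq_square mult_ac)
  also have "\<dots> = E 2 ^ 5" by (subst odd_plus_limit) (simp_all flip: power_mult power_Suc2)
  finally show ?thesis .
qed

lemma theta_phi_minus: "theta (-1) 1 1 * E 2 = E 1 ^ 2"
proof -
  have "theta (-1) 1 1 = (E 1 * inverse (E 2)) ^ 2 * E 2"
  proof (rule jacobi_triple_product_eqI[where c = 2 and f = "\<lambda>m. odd_prod 1 m ^ 2 * eprod 2 m"])
    fix m :: nat
    show "odd_prod 1 (Suc m) ^ 2 * eprod 2 (Suc m) = odd_prod 1 m ^ 2 * eprod 2 m *
      ((1 + - 1 * fps_X ^ (1 + 2 * m)) * (1 + - 1 * fps_X ^ (1 + 2 * m)) * (1 - fps_X ^ (2 * (m + 1))))"
      unfolding eprod_Suc odd_prod_def prod.lessThan_Suc power2_eq_square by (simp add: mult_ac)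
    show "(\<lambda>m. odd_prod 1 m ^ 2 * eprod 2 m) \<longlonglongrightarrow> (E 1 * inverse (E 2)) ^ 2 * E 2"
      using odd_prod_tendsto[of 1] by (intro fps_tendsto_mult fps_tendsto_power eprod_tendsto) auto
  qed (auto simp: odd_prod_def)
  then have "theta (-1) 1 1 * E 2 = E 1 ^ 2 * (inverse (E 2) * E 2) * (inverse (E 2) * E 2)"
    by (simp only: power2_eq_square mult_ac mult_1_right)
  then show ?thesis by (simp only: inverse_E_mult zero_less_numeral mult_1_right)
qed

text \<open>The factors 1 + q^i of the two triple products have i congruent to 1, 4 and to 2, 3
  modulo 5. The multiples of 5 that are missing from (-q; q) are supplied by
  \<open>plus_prod 5\<close>.\<close>

lemma theta_5_product: "theta 1 1 4 * theta 1 2 3 * (E 1 * E 10) = E 2 * E 5 ^ 3"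
proof -
  define f where "f a b m = (\<Prod>k<m. (1 + 1 * fps_X ^ (a + (a + b) * k)) * (1 + 1 * fps_X ^ (b + (a + b) * k)) *
     (1 - fps_X ^ ((a + b) * (k + 1))) :: complex fps)" for a b m
  have prods: "f 1 4 m * f 2 3 m * plus_prod 5 m = plus_prod 1 (5 * m) * eprod 5 m ^ 2" for m
  proof (induction m)
    case (Suc m)
    have *: "5 * Suc m = Suc (Suc (Suc (Suc (Suc (5 * m)))))" by simp
    have "plus_prod 1 (5 * Suc m) * eprod 5 (Suc m) ^ 2 = (plus_prod 1 (5 * m) * eprod 5 m ^ 2) *
      ((1 + fps_X ^ (1 + 5 * m)) * (1 + fps_X ^ (2 + 5 * m)) * (1 + fps_X ^ (3 + 5 * m)) *
       (1 + fps_X ^ (4 + 5 * m)) * (1 + fps_X ^ (5 + 5 * m)) * (1 - fps_X ^ (5 * (m + 1))) ^ 2)"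
      unfolding * plus_prod_def prod.lessThan_Suc eprod_Suc power2_eq_square
      by (simp add: numeral_eq_Suc mult_ac add_ac)
    also have "\<dots> = f 1 4 (Suc m) * f 2 3 (Suc m) * plus_prod 5 (Suc m)"
      unfolding Suc.IH[symmetric] by (simp add: plus_prod_def f_def power2_eq_square mult_ac)
    finally show ?case ..
  qed (simp add: f_def plus_prod_def)
  have "f 1 4 \<longlonglongrightarrow> theta 1 1 4" "f 2 3 \<longlonglongrightarrow> theta 1 2 3"
    unfolding f_def by (rule jacobi_triple_product; simp)+
  then have "(\<lambda>m. f 1 4 m * f 2 3 m * plus_prod 5 m) \<longlonglongrightarrow> theta 1 1 4 * theta 1 2 3 * (E (2 * 5) * inverse (E 5))"
    by (intro fps_tendsto_mult plus_prod_tendsto) auto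
  moreover have "(\<lambda>m. plus_prod 1 (5 * m) * eprod 5 m ^ 2) \<longlonglongrightarrow> (E (2 * 1) * inverse (E 1)) * E 5 ^ 2"
    by (intro fps_tendsto_mult fps_tendsto_power filterlim_compose[OF plus_prod_tendsto mult_at_top] eprod_tendsto) auto
  ultimately have "theta 1 1 4 * theta 1 2 3 * (E (2 * 5) * inverse (E 5)) = (E (2 * 1) * inverse (E 1)) * E 5 ^ 2"
    unfolding prods by (rule LIMSEQ_unique)
  then have eq: "theta 1 1 4 * theta 1 2 3 * (E 10 * inverse (E 5)) * (E 1 * E 5) = (E 2 * inverse (E 1)) * E 5 ^ 2 * (E 1 * E 5)"
    by simp
  have 1: "theta 1 1 4 * theta 1 2 3 * (E 10 * inverse (E 5)) * (E 1 * E 5) = theta 1 1 4 * theta 1 2 3 * (E 1 * E 10) * (inverse (E 5) * E 5)"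
    by (simp only: mult_ac)
  have 2: "(E 2 * inverse (E 1)) * E 5 ^ 2 * (E 1 * E 5) = E 2 * E 5 ^ 3 * (inverse (E 1) * E 1)"
    by (simp only: power2_eq_square power3_eq_cube mult_ac)
  show ?thesis using eq unfolding 1 2 by (simp only: inverse_E_mult zero_less_numeral zero_less_one mult_1_right)
qed

section \<open>Dissections of theta functions\<close>

lemma theta_nth:
  assumes "a > 0" "b > 0"
  shows "fps_nth (theta (fps_const s) a b) m = (\<Sum>j | texp a b j = m. s ^ nat \<bar>j\<bar>)"
proof -
  have "fps_nth (theta (fps_const s) a b) m =
      (\<Sum>j | texp a b j \<le> m. fps_nth (fps_const s ^ nat \<bar>j\<bar> * fps_X ^ texp a b j) m)"
    unfolding theta_def
    by (rule fsum_nth_superset[OF finite_texp_le[OF assms]]) (auto simp: fps_const_power)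
  also have "\<dots> = (\<Sum>j | texp a b j = m. s ^ nat \<bar>j\<bar>)"
    by (rule sum.mono_neutral_cong_right[OF finite_texp_le[OF assms]]) (auto simp: fps_const_power)
  finally show ?thesis .
qed

lemma sect_theta_eq_0:
  assumes "a > 0" "b > 0" "r < k" "\<And>j. texp a b j mod k \<noteq> r"
  shows "sect k r (theta (fps_const s) a b) = 0"
proof (rule fps_ext)
  fix m
  have "{j. texp a b j = k * m + r} = {}"
  proof (intro equals0I)
    fix j assume "j \<in> {j. texp a b j = k * m + r}"
    then have "texp a b j mod k = r" using assms(3) by simp
    with assms(4) show False by blast
  qed
  then show "fps_nth (sect k r (theta (fps_const s) a b)) m = fps_nth 0 m"
    using assms by (simp add: sect_def theta_nth)
qed

text \<open>The \<open>n\<close> branches \<open>h i\<close> together enumerate the indices whose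
  exponent is \<open>r\<close> modulo \<open>k\<close>. On every branch the exponent is one and the
  same theta exponent, rescaled, and the sign changes by the constant \<open>t\<close>; hence the
  factor \<open>n * t\<close>.\<close>

lemma sect_theta:
  fixes h :: "nat \<Rightarrow> int \<Rightarrow> int"
  assumes pos: "a > 0" "b > 0" "a' > 0" "b' > 0" "d > 0" "r < k"
    and h: "bij_betw (\<lambda>(i, j). h i j) ({..<n} \<times> UNIV) {j. texp a b j mod k = r}"
    and exp: "\<And>i j. i < n \<Longrightarrow> texp a b (h i j) = k * (d * texp a' b' j) + r"
    and sgn: "\<And>i j. i < n \<Longrightarrow> s ^ nat \<bar>h i j\<bar> = t * s' ^ nat \<bar>j\<bar>"
  shows "sect k r (theta (fps_const s) a b) = fps_const (of_nat n * t) * dil d (theta (fps_const s') a' b')"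
proof (rule fps_ext)
  fix m
  have "bij_betw (\<lambda>(i, j). h i j) ({..<n} \<times> {j. d * texp a' b' j = m}) {j. texp a b j = k * m + r}"
    unfolding bij_betw_def
  proof
    show "inj_on (\<lambda>(i, j). h i j) ({..<n} \<times> {j. d * texp a' b' j = m})"
      using h by (auto simp: bij_betw_def intro: inj_on_subset)
    show "(\<lambda>(i, j). h i j) ` ({..<n} \<times> {j. d * texp a' b' j = m}) = {j. texp a b j = k * m + r}"
    proof (intro equalityI subsetI)
      fix j assume j: "j \<in> {j. texp a b j = k * m + r}"
      then have "j \<in> {j. texp a b j mod k = r}" using pos by simp
      then have "j \<in> (\<lambda>(i, j). h i j) ` ({..<n} \<times> UNIV)" using h by (simp add: bij_betw_def)
      then obtain i l where il: "i < n" "j = h i l" by auto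
      then have "k * (d * texp a' b' l) + r = k * m + r" using exp j by auto
      then have "d * texp a' b' l = m" using pos by simp
      then show "j \<in> (\<lambda>(i, j). h i j) ` ({..<n} \<times> {j. d * texp a' b' j = m})"
        using il by (auto intro!: image_eqI[of _ _ "(i, l)"])
    qed (auto simp: exp)
  qed
  then have "(\<Sum>j | texp a b j = k * m + r. s ^ nat \<bar>j\<bar>) =
     (\<Sum>x\<in>{..<n} \<times> {j. d * texp a' b' j = m}. s ^ nat \<bar>case x of (i, j) \<Rightarrow> h i j\<bar>)"
    by (rule sum.reindex_bij_betw[symmetric])
  also have "\<dots> = (\<Sum>x\<in>{..<n} \<times> {j. d * texp a' b' j = m}. t * s' ^ nat \<bar>snd x\<bar>)"
    by (intro sum.cong refl) (auto simp: sgn)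
  also have "\<dots> = of_nat n * t * (\<Sum>j | d * texp a' b' j = m. s' ^ nat \<bar>j\<bar>)"
    by (simp add: sum.cartesian_product' sum_distrib_left mult.assoc)
  also have "(\<Sum>j | d * texp a' b' j = m. s' ^ nat \<bar>j\<bar>) = fps_nth (dil d (theta (fps_const s') a' b')) m"
  proof (cases "d dvd m")
    case True
    then have "{j. d * texp a' b' j = m} = {j. texp a' b' j = m div d}" using pos by auto
    then show ?thesis using True pos by (simp add: dil_nth theta_nth)
  next
    case False
    then have "{j. d * texp a' b' j = m} = {}" by auto
    then show ?thesis using False pos by (simp add: dil_nth)
  qed
  finally show "fps_nth (sect k r (theta (fps_const s) a b)) m =
     fps_nth (fps_const (of_nat n * t) * dil d (theta (fps_const s') a' b')) m"
    using pos by (simp add: sect_def theta_nth)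
qed

section \<open>Theta exponents modulo 5 and modulo 2\<close>

lemma texp_1_2_mod_5:
  "texp 1 2 j mod 5 = (if j mod 5 = 1 then 1 else if j mod 5 = 0 \<or> j mod 5 = 2 then 0 else 2)"
proof -
  define q c where "q = j div 5" and "c = j mod 5"
  have j: "j = 5 * q + c" by (simp add: q_def c_def)
  have "c = 0 \<or> c = 1 \<or> c = 2 \<or> c = 3 \<or> c = 4" unfolding c_def by presburger
  moreover have "2 * int (texp 1 2 j) = 5 * (15 * q * q + 6 * q * c - q) + (3 * c * c - c)"
    unfolding double_texp j by (simp add: algebra_simps)
  then obtain K where "2 * int (texp 1 2 j) = 5 * K + (3 * c * c - c)" by blast
  ultimately show ?thesis
    unfolding c_def[symmetric] by (elim disjE) (simp; presburger)+
qed

lemma texp_1_3_mod_5: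
  "texp 1 3 j mod 5 = (if j mod 5 = 4 then 3 else if j mod 5 = 0 \<or> j mod 5 = 3 then 0 else 1)"
proof -
  define q c where "q = j div 5" and "c = j mod 5"
  have j: "j = 5 * q + c" by (simp add: q_def c_def)
  have "c = 0 \<or> c = 1 \<or> c = 2 \<or> c = 3 \<or> c = 4" unfolding c_def by presburger
  moreover have "2 * int (texp 1 3 j) = 5 * (20 * q * q + 8 * q * c - 2 * q) + (4 * c * c - 2 * c)"
    unfolding double_texp j by (simp add: algebra_simps)
  then obtain K where "2 * int (texp 1 3 j) = 5 * K + (4 * c * c - 2 * c)" by blast
  ultimately show ?thesis
    unfolding c_def[symmetric] by (elim disjE) (simp; presburger)+
qed

lemma texp_1_1: "int (texp 1 1 j) = j * j"
  using double_texp[of 1 1 j] by (simp add: algebra_simps)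

lemma texp_1_3: "int (texp 1 3 j) = 2 * (j * j) - j"
  using double_texp[of 1 3 j] by (simp add: algebra_simps)

lemma texp_1_2: "2 * int (texp 1 2 j) = 3 * (j * j) - j"
  using double_texp[of 1 2 j] by (simp add: algebra_simps)

lemma texp_1_4: "2 * int (texp 1 4 j) = 5 * (j * j) - 3 * j"
  using double_texp[of 1 4 j] by (simp add: algebra_simps)

lemma texp_2_3: "2 * int (texp 2 3 j) = 5 * (j * j) - j"
  using double_texp[of 2 3 j] by (simp add: algebra_simps)

lemma texp_1_1_mod_2: "texp 1 1 j mod 2 = (if even j then 0 else 1)"
proof -
  have "even (texp 1 1 j) \<longleftrightarrow> even (int (texp 1 1 j))" by simp
  also have "\<dots> \<longleftrightarrow> even j" unfolding texp_1_1 by simp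
  finally show ?thesis by (auto simp: mod_2_eq_odd)
qed

lemma minus_one_fps: "(-1 :: complex fps) = fps_const (-1)"
  by (metis fps_const_1_eq_1 fps_const_neg)

lemma minus_one_power_abs: "(-1) ^ nat \<bar>j\<bar> = (if even j then 1 else -1 :: 'a::ring_1)"
  by (auto simp: even_nat_iff)

text \<open>Pentagonal numbers are 0, 1 or 2 modulo 5. The residue 1 belongs to the indices 1 - 5j,
  where the exponent is 25 times the one at j plus 1, and the sign is reversed.\<close>

lemma sect_5_E:
  "sect 5 1 (E 1) = - E 5" "sect 5 3 (E 1) = 0" "sect 5 4 (E 1) = 0"
proof -
  have *: "sect 5 1 (theta (fps_const (-1)) 1 2) = fps_const (of_nat 1 * (-1)) * dil 5 (theta (fps_const (-1)) 1 2)"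
  proof (rule sect_theta[where h = "\<lambda>_ j. 1 - 5 * j"])
    show "bij_betw (\<lambda>(i, j). 1 - 5 * j) ({..<(1::nat)} \<times> UNIV) {j. texp 1 2 j mod 5 = 1}"
    proof (rule bij_betw_byWitness[where f' = "\<lambda>j. (0, (1 - j) div 5)"])
      show "\<forall>j\<in>{j. texp 1 2 j mod 5 = 1}. (case (0, (1 - j) div 5) of (i, j) \<Rightarrow> 1 - 5 * j) = j"
        unfolding texp_1_2_mod_5 by (auto split: if_splits) presburger
    next
      have "(1 - 5 * j) mod 5 = 1" for j :: int by presburger
      then show "(\<lambda>(i, j). 1 - 5 * j) ` ({..<(1::nat)} \<times> UNIV) \<subseteq> {j. texp 1 2 j mod 5 = 1}"
        unfolding texp_1_2_mod_5 by (auto, presburger)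
    qed auto
    fix i :: nat and j :: int
    have "2 * int (texp 1 2 (1 - 5 * j)) = 2 * int (5 * (5 * texp 1 2 j) + 1)"
      using texp_1_2[of "1 - 5 * j"] texp_1_2[of j] by (simp add: algebra_simps)
    then show "texp 1 2 (1 - 5 * j) = 5 * (5 * texp 1 2 j) + 1" by (rule double_int_cancel)
    show "(-1 :: complex) ^ nat \<bar>1 - 5 * j\<bar> = - 1 * (- 1) ^ nat \<bar>j\<bar>"
      unfolding minus_one_power_abs by auto
  qed auto
  show "sect 5 1 (E 1) = - E 5"
    using * unfolding minus_one_fps[symmetric] pentagonal_number_theorem
    by (simp add: dil_E minus_one_fps[symmetric] del: fps_const_neg)
  have "sect 5 r (theta (fps_const (-1)) 1 2) = 0" if "r = 3 \<or> r = 4" for r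
  proof (rule sect_theta_eq_0)
    show "texp 1 2 j mod 5 \<noteq> r" for j
      unfolding texp_1_2_mod_5 using that by auto
  qed (use that in auto)
  from this[of 3] this[of 4] have "sect 5 3 (theta (fps_const (-1)) 1 2) = 0" "sect 5 4 (theta (fps_const (-1)) 1 2) = 0"
    by blast+
  then show "sect 5 3 (E 1) = 0" "sect 5 4 (E 1) = 0"
    unfolding minus_one_fps[symmetric] pentagonal_number_theorem by auto
qed

lemma sect_5_psi:
  "sect 5 0 (theta 1 1 3) = theta 1 2 3" "sect 5 1 (theta 1 1 3) = theta 1 1 4"
  "sect 5 2 (theta 1 1 3) = 0" "sect 5 3 (theta 1 1 3) = dil 5 (theta 1 1 3)"
  "sect 5 4 (theta 1 1 3) = 0"
proof -
  have "sect 5 3 (theta (fps_const 1) 1 3) = fps_const (of_nat 1 * 1) * dil 5 (theta (fps_const 1) 1 3)"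
  proof (rule sect_theta[where h = "\<lambda>_ j. 5 * j - 1"])
    show "bij_betw (\<lambda>(i, j). 5 * j - 1) ({..<(1::nat)} \<times> UNIV) {j. texp 1 3 j mod 5 = 3}"
    proof (rule bij_betw_byWitness[where f' = "\<lambda>j. (0, (j + 1) div 5)"])
      show "\<forall>j\<in>{j. texp 1 3 j mod 5 = 3}. (case (0, (j + 1) div 5) of (i, j) \<Rightarrow> 5 * j - 1) = j"
        unfolding texp_1_3_mod_5 by (auto split: if_splits) presburger
    next
      have "(5 * j - 1) mod 5 = 4" for j :: int by presburger
      then show "(\<lambda>(i, j). 5 * j - 1) ` ({..<(1::nat)} \<times> UNIV) \<subseteq> {j. texp 1 3 j mod 5 = 3}"
        unfolding texp_1_3_mod_5 by (auto, presburger)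
    qed auto
    fix i :: nat and j :: int
    have "2 * int (texp 1 3 (5 * j - 1)) = 2 * int (5 * (5 * texp 1 3 j) + 3)"
      using texp_1_3[of "5 * j - 1"] texp_1_3[of j] by (simp add: algebra_simps)
    then show "texp 1 3 (5 * j - 1) = 5 * (5 * texp 1 3 j) + 3" by (rule double_int_cancel)
  qed auto
  then show "sect 5 3 (theta 1 1 3) = dil 5 (theta 1 1 3)" by simp
  \<comment> \<open>The indices 0 and 3 modulo 5 form two families; even and odd values of the new
    index merge them into one bilateral theta series. \<open>g0\<close> is the inverse.\<close>
  define h0 :: "int \<Rightarrow> int" where "h0 i = (if even i then 5 * (i div 2) else - (5 * (i div 2) + 2))" for i
  define g0 :: "int \<Rightarrow> int" where "g0 j = (if j mod 5 = 0 then 2 * (j div 5) else 2 * ((- j - 2) div 5) + 1)" for j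
  have "sect 5 0 (theta (fps_const 1) 1 3) = fps_const (of_nat 1 * 1) * dil 1 (theta (fps_const 1) 2 3)"
  proof (rule sect_theta[where h = "\<lambda>_. h0"])
    show "bij_betw (\<lambda>(i, j). h0 j) ({..<(1::nat)} \<times> UNIV) {j. texp 1 3 j mod 5 = 0}"
    proof (rule bij_betw_byWitness[where f' = "\<lambda>j. (0, g0 j)"])
      have "h0 (g0 j) = j" if "texp 1 3 j mod 5 = 0" for j
        using that unfolding texp_1_3_mod_5 h0_def g0_def by (auto split: if_splits) presburger+
      then show "\<forall>j\<in>{j. texp 1 3 j mod 5 = 0}. (case (0, g0 j) of (i, j) \<Rightarrow> h0 j) = j" by auto
      have "g0 (h0 j) = j" for j
      proof (cases "even j")
        case True
        then show ?thesis by (auto simp: h0_def g0_def)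
      next
        case False
        then obtain l where l: "j = 2 * l + 1" by (auto elim: oddE)
        have "(- (5 * l + 2)) mod 5 = 3" by presburger
        then show ?thesis by (simp add: h0_def g0_def l)
      qed
      then show "\<forall>a\<in>{..<(1::nat)} \<times> UNIV. (0, g0 (case a of (i, j) \<Rightarrow> h0 j)) = a" by auto
      have "texp 1 3 (h0 j) mod 5 = 0" for j
      proof -
        have "(5 * l) mod 5 = 0" "(- (5 * l + 2)) mod 5 = 3" for l :: int by presburger+
        then have "h0 j mod 5 = 0 \<or> h0 j mod 5 = 3" unfolding h0_def by auto
        then show ?thesis unfolding texp_1_3_mod_5 by auto
      qed
      then show "(\<lambda>(i, j). h0 j) ` ({..<(1::nat)} \<times> UNIV) \<subseteq> {j. texp 1 3 j mod 5 = 0}" by auto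
    qed auto
    fix i :: nat and j :: int
    show "texp 1 3 (h0 j) = 5 * (1 * texp 2 3 j) + 0"
    proof (cases "even j")
      case True
      then obtain l where l: "j = 2 * l" by (auto elim: evenE)
      have "2 * int (texp 1 3 (h0 j)) = 2 * int (5 * (1 * texp 2 3 j) + 0)"
        using texp_1_3[of "5 * l"] texp_2_3[of j] by (simp add: l h0_def algebra_simps)
      then show ?thesis by (rule double_int_cancel)
    next
      case False
      then obtain l where l: "j = 2 * l + 1" by (auto elim: oddE)
      have "2 * int (texp 1 3 (h0 j)) = 2 * int (5 * (1 * texp 2 3 j) + 0)"
        using texp_1_3[of "- (5 * l + 2)"] texp_2_3[of j] by (simp add: l h0_def algebra_simps)
      then show ?thesis by (rule double_int_cancel)
    qed
  qed auto
  then show "sect 5 0 (theta 1 1 3) = theta 1 2 3" by (simp add: dil_def)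
  define h1 :: "int \<Rightarrow> int" where "h1 i = (if even i then 1 - 5 * (i div 2) else 5 * (i div 2) + 2)" for i
  define g1 :: "int \<Rightarrow> int" where "g1 j = (if j mod 5 = 1 then 2 * ((1 - j) div 5) else 2 * ((j - 2) div 5) + 1)" for j
  have "sect 5 1 (theta (fps_const 1) 1 3) = fps_const (of_nat 1 * 1) * dil 1 (theta (fps_const 1) 1 4)"
  proof (rule sect_theta[where h = "\<lambda>_. h1"])
    show "bij_betw (\<lambda>(i, j). h1 j) ({..<(1::nat)} \<times> UNIV) {j. texp 1 3 j mod 5 = 1}"
    proof (rule bij_betw_byWitness[where f' = "\<lambda>j. (0, g1 j)"])
      have "h1 (g1 j) = j" if "texp 1 3 j mod 5 = 1" for j
      proof -
        have "j mod 5 = 1 \<or> j mod 5 = 2"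
          using that unfolding texp_1_3_mod_5 by (auto split: if_splits)
        then show ?thesis unfolding h1_def g1_def by (auto split: if_splits) presburger+
      qed
      then show "\<forall>j\<in>{j. texp 1 3 j mod 5 = 1}. (case (0, g1 j) of (i, j) \<Rightarrow> h1 j) = j" by auto
      have "g1 (h1 j) = j" for j
      proof (cases "even j")
        case True
        then obtain l where l: "j = 2 * l" by (auto elim: evenE)
        have "(1 - 5 * l) mod 5 = 1" by presburger
        then show ?thesis by (simp add: h1_def g1_def l)
      next
        case False
        then obtain l where l: "j = 2 * l + 1" by (auto elim: oddE)
        have "(5 * l + 2) mod 5 = 2" by presburger
        then show ?thesis by (simp add: h1_def g1_def l)
      qed
      then show "\<forall>a\<in>{..<(1::nat)} \<times> UNIV. (0, g1 (case a of (i, j) \<Rightarrow> h1 j)) = a" by auto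
      have "texp 1 3 (h1 j) mod 5 = 1" for j
      proof -
        have "(1 - 5 * l) mod 5 = 1" "(5 * l + 2) mod 5 = 2" for l :: int by presburger+
        then have "h1 j mod 5 = 1 \<or> h1 j mod 5 = 2" unfolding h1_def by auto
        then show ?thesis unfolding texp_1_3_mod_5 by auto
      qed
      then show "(\<lambda>(i, j). h1 j) ` ({..<(1::nat)} \<times> UNIV) \<subseteq> {j. texp 1 3 j mod 5 = 1}" by auto
    qed auto
    fix i :: nat and j :: int
    show "texp 1 3 (h1 j) = 5 * (1 * texp 1 4 j) + 1"
    proof (cases "even j")
      case True
      then obtain l where l: "j = 2 * l" by (auto elim: evenE)
      have "2 * int (texp 1 3 (h1 j)) = 2 * int (5 * (1 * texp 1 4 j) + 1)"
        using texp_1_3[of "1 - 5 * l"] texp_1_4[of j] by (simp add: l h1_def algebra_simps)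
      then show ?thesis by (rule double_int_cancel)
    next
      case False
      then obtain l where l: "j = 2 * l + 1" by (auto elim: oddE)
      have "2 * int (texp 1 3 (h1 j)) = 2 * int (5 * (1 * texp 1 4 j) + 1)"
        using texp_1_3[of "5 * l + 2"] texp_1_4[of j] by (simp add: l h1_def algebra_simps)
      then show ?thesis by (rule double_int_cancel)
    qed
  qed auto
  then show "sect 5 1 (theta 1 1 3) = theta 1 1 4" by (simp add: dil_def)
  have "sect 5 r (theta (fps_const 1) 1 3) = 0" if "r = 2 \<or> r = 4" for r
  proof (rule sect_theta_eq_0)
    show "texp 1 3 j mod 5 \<noteq> r" for j
      unfolding texp_1_3_mod_5 using that by auto
  qed (use that in auto)
  from this[of 2] this[of 4] have "sect 5 2 (theta (fps_const 1) 1 3) = 0" "sect 5 4 (theta (fps_const 1) 1 3) = 0"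
    by blast+
  then show "sect 5 2 (theta 1 1 3) = 0" "sect 5 4 (theta 1 1 3) = 0" by simp_all
qed

lemma sect_2_phi:
  assumes "s = 1 \<or> s = -1"
  shows "sect 2 0 (theta (fps_const s) 1 1) = dil 2 (theta 1 1 1)"
    "sect 2 1 (theta (fps_const s) 1 1) = fps_const (2 * s) * dil 4 (theta 1 1 3)"
proof -
  have "sect 2 0 (theta (fps_const s) 1 1) = fps_const (of_nat 1 * 1) * dil 2 (theta (fps_const 1) 1 1)"
  proof (rule sect_theta[where h = "\<lambda>_ j. 2 * j"])
    show "bij_betw (\<lambda>(i, j). 2 * j) ({..<(1::nat)} \<times> UNIV) {j. texp 1 1 j mod 2 = 0}"
    proof (rule bij_betw_byWitness[where f' = "\<lambda>j. (0, j div 2)"])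
      show "\<forall>j\<in>{j. texp 1 1 j mod 2 = 0}. (case (0, j div 2) of (i, j) \<Rightarrow> 2 * j) = j"
        unfolding texp_1_1_mod_2 by auto
    next
      show "(\<lambda>(i, j). 2 * j) ` ({..<(1::nat)} \<times> UNIV) \<subseteq> {j. texp 1 1 j mod 2 = 0}"
        unfolding texp_1_1_mod_2 by auto
    qed auto
    fix i :: nat and j :: int
    have "2 * int (texp 1 1 (2 * j)) = 2 * int (2 * (2 * texp 1 1 j) + 0)"
      using texp_1_1[of "2 * j"] texp_1_1[of j] by (simp add: algebra_simps)
    then show "texp 1 1 (2 * j) = 2 * (2 * texp 1 1 j) + 0" by (rule double_int_cancel)
    show "s ^ nat \<bar>2 * j\<bar> = 1 * 1 ^ nat \<bar>j\<bar>"
      using assms by (auto simp: even_nat_iff)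
  qed auto
  then show "sect 2 0 (theta (fps_const s) 1 1) = dil 2 (theta 1 1 1)" by simp
  \<comment> \<open>Odd integers are 4j - 1 or 1 - 4j. Both branches have the square 8 (2 j^2 - j) +
    1, so each contributes a full copy of psi, whence the factor 2.\<close>
  define h where "h i j = (if i = 0 then 4 * j - 1 else 1 - 4 * j)" for i :: nat and j :: int
  define g :: "int \<Rightarrow> nat \<times> int" where
    "g j = (if j mod 4 = 3 then (0, (j + 1) div 4) else (1, (1 - j) div 4))" for j
  have "sect 2 1 (theta (fps_const s) 1 1) = fps_const (of_nat 2 * s) * dil 4 (theta (fps_const 1) 1 3)"
  proof (rule sect_theta[where h = h])
    show "bij_betw (\<lambda>(i, j). h i j) ({..<(2::nat)} \<times> UNIV) {j. texp 1 1 j mod 2 = 1}"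
    proof (rule bij_betw_byWitness[where f' = g])
      have "(case g j of (i, j) \<Rightarrow> h i j) = j"
        if "odd j" for j
      proof -
        have "j mod 4 = 1 \<or> j mod 4 = 3" using that by presburger
        then show ?thesis unfolding h_def g_def by (auto split: if_splits) presburger+
      qed
      then show "\<forall>j\<in>{j. texp 1 1 j mod 2 = 1}. (case g j of (i, j) \<Rightarrow> h i j) = j"
        unfolding texp_1_1_mod_2 by auto
      have "g (h i j) = (i, j)" if "i < 2" for i j
      proof -
        have "i = 0 \<or> i = 1" using that by auto
        moreover have "(4 * j - 1) mod 4 = 3" "(1 - 4 * j) mod 4 = 1" by presburger+
        ultimately show ?thesis unfolding h_def g_def by auto
      qed
      then show "\<forall>a\<in>{..<2} \<times> UNIV. g (case a of (i, j) \<Rightarrow> h i j) = a" by auto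
      have "odd (h i j)" for i j
        unfolding h_def by simp
      then show "(\<lambda>(i, j). h i j) ` ({..<(2::nat)} \<times> UNIV) \<subseteq> {j. texp 1 1 j mod 2 = 1}"
        unfolding texp_1_1_mod_2 by auto
      show "g ` {j. texp 1 1 j mod 2 = 1} \<subseteq> {..<2} \<times> UNIV" by (auto simp: g_def)
    qed
    fix i :: nat and j :: int
    have "2 * int (texp 1 1 (h i j)) = 2 * int (2 * (4 * texp 1 3 j) + 1)"
      using texp_1_1[of "h i j"] texp_1_3[of j] by (simp add: h_def algebra_simps)
    then show "texp 1 1 (h i j) = 2 * (4 * texp 1 3 j) + 1" by (rule double_int_cancel)
    have "odd (h i j)" by (simp add: h_def)
    then have "odd (nat \<bar>h i j\<bar>)" by (simp add: even_nat_iff)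
    then show "s ^ nat \<bar>h i j\<bar> = s * 1 ^ nat \<bar>j\<bar>"
      using assms by auto
  qed auto
  then show "sect 2 1 (theta (fps_const s) 1 1) = fps_const (2 * s) * dil 4 (theta 1 1 3)" by simp
qed

section \<open>Quadratic relations between phi and psi\<close>

lemma phi_psi_mult: "theta 1 1 1 * dil 2 (theta 1 1 3) = theta 1 1 3 ^ 2"
proof -
  have d: "dil 2 (theta 1 1 3) * E 2 = E 4 ^ 2"
    using arg_cong[OF theta_psi, of "dil 2"] by (simp add: dil_mult dil_power dil_E)
  have "(theta 1 1 1 * dil 2 (theta 1 1 3) - theta 1 1 3 ^ 2) * (E 1 ^ 2 * E 4 ^ 2 * E 2) = 0"
    using d theta_phi theta_psi by algebra
  then show ?thesis by simp
qed

lemma phi_phi_minus: "theta 1 1 1 * theta (-1) 1 1 = dil 2 (theta (-1) 1 1) ^ 2"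
proof -
  have d: "dil 2 (theta (-1) 1 1) * E 4 = E 2 ^ 2"
    using arg_cong[OF theta_phi_minus, of "dil 2"] by (simp add: dil_mult dil_power dil_E)
  have "(theta 1 1 1 * theta (-1) 1 1 - dil 2 (theta (-1) 1 1) ^ 2) * (E 1 ^ 2 * E 4 ^ 2 * E 2) = 0"
    using d theta_phi theta_phi_minus by algebra
  then show ?thesis by simp
qed

text \<open>The series phi(q) and phi(-q) are phi(q^4) plus or minus 2 q psi(q^8). Their product is
  phi(-q^2)^2, and replacing q^2 by q there evaluates phi(-q)^2. The squares of phi(q) and phi(-q)
  differ by 8 q phi(q^4) psi(q^8), which is 8 q psi(q^4)^2.\<close>

lemma phi_squared:
  "theta 1 1 1 ^ 2 = dil 2 (theta 1 1 1) ^ 2 + 4 * fps_X * dil 4 (theta 1 1 3) ^ 2"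
proof -
  let ?phi = "theta 1 1 1" and ?psi = "theta 1 1 3" and ?phim = "theta (-1) 1 1"
  have const: "dil 2 (fps_const c * dil 4 f) = fps_const c * dil 8 f" for c and f :: "complex fps"
    by (simp add: dil_mult dil_dil dil_def[of _ "fps_const _"])
  have split: "f = dil 2 (sect 2 0 f) + fps_X * dil 2 (sect 2 1 f)" for f :: "complex fps"
    by (subst sect_dissection[of 2 f]) (simp_all add: numeral_2_eq_2)
  have d4: "dil 2 (dil 2 f) = dil 4 f" for f :: "complex fps" by (simp add: dil_dil)
  have p: "?phi = dil 4 ?phi + 2 * fps_X * dil 8 ?psi"
    using split[of "theta (fps_const 1) 1 1"] unfolding sect_2_phi[of 1, OF disjI1, OF refl] const d4
    by (simp add: numeral_fps_const mult_ac)
  have m: "?phim = dil 4 ?phi - 2 * fps_X * dil 8 ?psi"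
  proof -
    have c: "dil 2 (fps_const (2 * - 1) * dil 4 f) = - 2 * dil 8 f" for f :: "complex fps"
      unfolding const by (simp add: numeral_fps_const)
    show ?thesis
      using split[of "theta (fps_const (-1)) 1 1"] unfolding sect_2_phi[of "-1", OF disjI2, OF refl] c d4 minus_one_fps
      by (simp add: mult_ac)
  qed
  have "dil 2 (?phim ^ 2) = dil 4 ?phi ^ 2 - 4 * fps_X ^ 2 * dil 8 ?psi ^ 2"
    using phi_phi_minus p m unfolding dil_power[OF zero_less_numeral] by algebra
  also have "\<dots> = dil 2 (dil 2 ?phi ^ 2 - 4 * fps_X * dil 4 ?psi ^ 2)"
    by (simp add: dil_diff dil_mult dil_power dil_dil dil_X dil_numeral)
  finally have 1: "?phim ^ 2 = dil 2 ?phi ^ 2 - 4 * fps_X * dil 4 ?psi ^ 2"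
    by (simp add: dil_inject)
  have "dil 4 (?phi * dil 2 ?psi) = dil 4 (?psi ^ 2)" by (simp only: phi_psi_mult)
  then have 2: "dil 4 ?phi * dil 8 ?psi = dil 4 ?psi ^ 2" by (simp add: dil_mult dil_power dil_dil)
  have "?phi ^ 2 = ?phim ^ 2 + 8 * fps_X * (dil 4 ?phi * dil 8 ?psi)"
    using p m by algebra
  then show ?thesis unfolding 1 2 by simp
qed

section \<open>The generating function of \<open>p_omega\<close>\<close>

subsection \<open>Partitions with parts in a given set\<close>

definition part_count :: "nat set \<Rightarrow> nat \<Rightarrow> nat" where
  "part_count A n = card {M :: nat multiset. set_mset M \<subseteq> A \<and> sum_mset M = n}"

definition part_gf :: "nat set \<Rightarrow> complex fps" where
  "part_gf A = Abs_fps (\<lambda>n. of_nat (part_count A n))"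

lemma finite_parts:
  assumes "0 \<notin> A"
  shows "finite {M :: nat multiset. set_mset M \<subseteq> A \<and> sum_mset M = n}"
  using assms by (intro finite_subset[OF _ finite_partitions[of n]]) auto

lemma part_gf_empty: "part_gf {} = 1"
proof (rule fps_ext)
  fix n
  have "{M :: nat multiset. set_mset M \<subseteq> {} \<and> sum_mset M = n} = (if n = 0 then {{#}} else {})" by auto
  then show "fps_nth (part_gf {}) n = fps_nth 1 n" by (simp add: part_gf_def part_count_def)
qed

lemma part_count_insert:
  assumes "0 \<notin> A" "a > 0" "a \<notin> A"
  shows "part_count (insert a A) n = part_count A n + (if a \<le> n then part_count (insert a A) (n - a) else 0)"
proof -
  let ?S = "\<lambda>A n. {M :: nat multiset. set_mset M \<subseteq> A \<and> sum_mset M = n}"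
  let ?T = "if a \<le> n then add_mset a ` ?S (insert a A) (n - a) else {}"
  have "?S (insert a A) n = ?S A n \<union> ?T"
  proof (intro equalityI subsetI)
    fix M assume M: "M \<in> ?S (insert a A) n"
    show "M \<in> ?S A n \<union> ?T"
    proof (cases "a \<in># M")
      case True
      then obtain M' where M': "M = add_mset a M'" by (meson multi_member_split)
      then show ?thesis using M by auto
    next
      case False
      then show ?thesis using M by auto
    qed
  qed (auto split: if_splits)
  moreover have "?S A n \<inter> ?T = {}"
  proof (intro equals0I)
    fix M assume M: "M \<in> ?S A n \<inter> ?T"
    then have "M \<in> add_mset a ` ?S (insert a A) (n - a)" by (simp split: if_splits)
    then have "a \<in># M" by (elim imageE) simp
    then show False using M assms(3) by blast
  qed
  moreover have "finite (?S A n)" by (rule finite_parts[OF assms(1)])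
  moreover have "finite (?S (insert a A) (n - a))" by (rule finite_parts) (use assms in simp)
  then have "finite ?T" by simp
  ultimately have "card (?S (insert a A) n) = card (?S A n) + card ?T" by (simp add: card_Un_disjoint)
  moreover have "card ?T = (if a \<le> n then card (?S (insert a A) (n - a)) else 0)"
    by (simp add: card_image inj_on_def)
  ultimately show ?thesis by (simp only: part_count_def)
qed

lemma part_gf_prod:
  assumes "finite A" "0 \<notin> A"
  shows "part_gf A * (\<Prod>a\<in>A. 1 - fps_X ^ a) = 1"
  using assms
proof (induction A)
  case (insert a A)
  have "fps_nth (part_gf (insert a A) * (1 - fps_X ^ a)) n = fps_nth (part_gf A) n" for n
    using part_count_insert[of A a n] insert
    by (simp add: part_gf_def right_diff_distrib fps_X_power_mult_right_nth)
  then have "part_gf (insert a A) * (1 - fps_X ^ a) = part_gf A" by (simp add: fps_eq_iff)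
  then have "part_gf (insert a A) * ((1 - fps_X ^ a) * (\<Prod>a\<in>A. 1 - fps_X ^ a)) = 1"
    using insert by (simp flip: mult.assoc)
  then show ?case using insert by simp
qed (simp add: part_gf_empty)

lemma sum_mset_ge_member: "k \<in># M \<Longrightarrow> (k :: nat) \<le> sum_mset M"
  using sum_mset.remove[of k M] by simp

lemma part_gf_tendsto:
  assumes "\<And>N. B N \<subseteq> A" "\<And>N. A \<inter> {..N} \<subseteq> B N"
  shows "(\<lambda>N. part_gf (B N)) \<longlonglongrightarrow> part_gf A"
proof (rule tendsto_fpsI)
  fix m
  have eq: "part_count (B N) m = part_count A m" if "N \<ge> m" for N
  proof -
    have "set_mset M \<subseteq> B N" if "set_mset M \<subseteq> A" "sum_mset M = m" for M
    proof
      fix k assume k: "k \<in># M"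
      then have "k \<le> N" using sum_mset_ge_member[OF k] that \<open>N \<ge> m\<close> by simp
      then show "k \<in> B N" using assms(2)[of N] k that by auto
    qed
    then have "{M. set_mset M \<subseteq> B N \<and> sum_mset M = m} = {M. set_mset M \<subseteq> A \<and> sum_mset M = m}"
      using assms(1)[of N] by blast
    then show ?thesis by (simp add: part_count_def)
  qed
  show "eventually (\<lambda>N. fps_nth (part_gf (B N)) m = fps_nth (part_gf A) m) sequentially"
    using eventually_ge_at_top[of m] by eventually_elim (simp add: part_gf_def eq)
qed

section \<open>Sorting partitions by their smallest part\<close>

definition omega_parts :: "nat \<Rightarrow> nat set" where
  "omega_parts m = {k. m \<le> k \<and> (odd k \<longrightarrow> k < 2 * m)}"

text \<open>The empty partition makes \<open>p_omega 0\<close> equal to 1, whereas q omega(q) has no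
  constant term.\<close>

definition omega_gf :: "complex fps" where
  "omega_gf = Abs_fps (\<lambda>n. if n = 0 then 0 else of_nat (p_omega n))"

text \<open>Remove one copy of the smallest part \<open>Suc m\<close>. The families for different m
  are disjoint because \<open>Min\<close> recovers the removed part.\<close>

lemma p_omega_sum:
  assumes "n > 0"
  shows "p_omega n = (\<Sum>m<n. part_count (omega_parts (Suc m)) (n - Suc m))"
proof -
  let ?S = "\<lambda>m. {M :: nat multiset. set_mset M \<subseteq> omega_parts (Suc m) \<and> sum_mset M = n - Suc m}"
  have min: "Min (set_mset M) = Suc i" if M: "M \<in> add_mset (Suc i) ` ?S i" for M i
  proof -
    obtain M' where "M = add_mset (Suc i) M'" "set_mset M' \<subseteq> omega_parts (Suc i)"
      using M by auto
    then show ?thesis by (intro Min_eqI) (auto simp: omega_parts_def)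
  qed
  have "{M. 0 \<notin># M \<and> sum_mset M = n \<and> (\<forall>k\<in>#M. odd k \<longrightarrow> k < 2 * Min (set_mset M))}
      = (\<Union>m\<in>{..<n}. add_mset (Suc m) ` ?S m)" (is "?L = ?R")
  proof (intro equalityI subsetI)
    fix M assume "M \<in> ?L"
    then have M: "0 \<notin># M" "sum_mset M = n" "\<And>k. k \<in># M \<Longrightarrow> odd k \<Longrightarrow> k < 2 * Min (set_mset M)" by auto
    have ne: "M \<noteq> {#}" using M assms by auto
    define m where "m = Min (set_mset M)"
    have mM: "m \<in># M" using ne by (simp add: m_def)
    then have "m > 0" using M(1) by (cases m) auto
    then obtain m' where m': "m = Suc m'" by (cases m) auto
    obtain M' where M': "M = add_mset m M'" using mM by (meson multi_member_split)
    have ge: "m \<le> k" if "k \<in># M" for k using that by (simp add: m_def)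
    have lt: "k < 2 * m" if "k \<in># M" "odd k" for k using M(3)[OF that] by (simp add: m_def)
    have "set_mset M' \<subseteq> omega_parts (Suc m')"
      using ge lt M' by (auto simp: omega_parts_def m'[symmetric])
    moreover have "sum_mset M' = n - Suc m'" "m' < n" using M(2) M' m' by auto
    ultimately show "M \<in> ?R" using M' m' by auto
  next
    fix M assume "M \<in> ?R"
    then obtain m M' where m: "m < n" "M = add_mset (Suc m) M'" "set_mset M' \<subseteq> omega_parts (Suc m)"
      "sum_mset M' = n - Suc m" by auto
    have "Min (set_mset M) = Suc m" using m by (intro min) auto
    then show "M \<in> ?L" using m by (auto simp: omega_parts_def)
  qed
  moreover have "card ?R = (\<Sum>m<n. card (add_mset (Suc m) ` ?S m))"
  proof (rule card_UN_disjoint)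
    show "\<forall>i\<in>{..<n}. \<forall>j\<in>{..<n}. i \<noteq> j \<longrightarrow> add_mset (Suc i) ` ?S i \<inter> add_mset (Suc j) ` ?S j = {}"
    proof (intro ballI impI equals0I)
      fix i j M assume ij: "i \<noteq> j" and M: "M \<in> add_mset (Suc i) ` ?S i \<inter> add_mset (Suc j) ` ?S j"
      then have "Min (set_mset M) = Suc i" "Min (set_mset M) = Suc j" using min by blast+
      then show False using ij by simp
    qed
  qed (auto intro!: finite_parts simp: omega_parts_def)
  ultimately show ?thesis
    by (simp add: p_omega_def part_count_def card_image inj_on_def)
qed

lemma omega_gf_fsum: "omega_gf = fsum (\<lambda>m. fps_X ^ Suc m * part_gf (omega_parts (Suc m)))"
proof (rule fps_ext)
  fix n
  have "fps_nth (fsum (\<lambda>m. fps_X ^ Suc m * part_gf (omega_parts (Suc m)))) n =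
      (\<Sum>m<n. fps_nth (fps_X ^ Suc m * part_gf (omega_parts (Suc m))) n)"
    by (rule fsum_nth_superset) (auto simp: fps_X_power_mult_nth simp del: power_Suc)
  also have "\<dots> = (\<Sum>m<n. of_nat (part_count (omega_parts (Suc m)) (n - Suc m)))"
    by (intro sum.cong refl) (auto simp: fps_X_power_mult_nth part_gf_def simp del: power_Suc)
  also have "\<dots> = fps_nth omega_gf n"
    by (cases "n = 0") (simp_all add: omega_gf_def p_omega_sum)
  finally show "fps_nth omega_gf n = fps_nth (fsum (\<lambda>m. fps_X ^ Suc m * part_gf (omega_parts (Suc m)))) n" ..
qed

text \<open>\<open>even_tail n\<close> is the product of \<open>1 - q ^ (2 * k)\<close> over \<open>k > n\<close>.\<close>

definition even_tail :: "nat \<Rightarrow> complex fps" where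
  "even_tail n = E 2 * ieprod 2 n"

lemma even_tail_Suc: "even_tail n = (1 - fps_X ^ (2 * n + 2)) * even_tail (Suc n)"
  using ieprod_Suc[of 2 n] by (simp add: even_tail_def mult_ac)

lemma ieprod_nth_0 [simp]: "c > 0 \<Longrightarrow> fps_nth (ieprod c n) 0 = 1"
  by (simp add: ieprod_def)

lemma even_tail_nth_0 [simp]: "fps_nth (even_tail n) 0 = 1"
  by (simp add: even_tail_def)

lemma even_tail_dvd: "fps_X ^ n dvd even_tail n - 1"
proof -
  have "fps_X ^ n dvd even_tail (n + d) - even_tail n" for d
  proof (induction d)
    case (Suc d)
    have "even_tail (n + Suc d) - even_tail n = (even_tail (n + d) - even_tail n) + fps_X ^ (2 * (n + d) + 2) * even_tail (n + Suc d)"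
      using even_tail_Suc[of "n + d"] by (simp add: algebra_simps)
    moreover have "fps_X ^ n dvd (fps_X :: complex fps) ^ (2 * (n + d) + 2)" by (rule le_imp_power_dvd) simp
    ultimately show ?case using Suc.IH by (simp only: dvd_add dvd_mult2)
  qed simp
  then have stable: "(\<forall>m<n. fps_nth (even_tail N) m = fps_nth (even_tail n) m)" if "N \<ge> n" for N
    using that by (metis X_power_dvd_iff eq_iff_diff_eq_0 fps_sub_nth le_add_diff_inverse)
  have "even_tail \<longlonglongrightarrow> 1"
    using fps_tendsto_mult[OF tendsto_const[of "E 2"] ieprod_tendsto[of 2]] by (simp add: even_tail_def[abs_def])
  then have lim: "eventually (\<lambda>N. fps_nth (even_tail N) m = fps_nth 1 m) sequentially" for m
    by (auto simp: tendsto_fps_iff)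
  have "fps_nth (even_tail n) m = fps_nth 1 m" if "m < n" for m
  proof -
    have "eventually (\<lambda>N. fps_nth (even_tail n) m = fps_nth 1 m) sequentially"
      using lim[of m] eventually_ge_at_top[of n] 
    proof eventually_elim
      case (elim N)
      then show ?case using stable[of N] that by simp
    qed
    then show ?thesis by simp
  qed
  then show ?thesis by (auto simp: X_power_dvd_iff)
qed

text \<open>With z = q^(2j), this is the product of 1 - z q^i over m <= i <= 2m and of 1 - z q^(2k)
  over k > m.\<close>

definition omega_den :: "nat \<Rightarrow> nat \<Rightarrow> complex fps" where
  "omega_den j m = (\<Prod>i=m..2 * m. 1 - fps_X ^ (i + 2 * j)) * even_tail (m + j)"

text \<open>Every size from m to 2m is allowed, 2m itself being even, and beyond 2m exactly the even
  sizes. The sets \<open>B N\<close> cut this off after \<open>N\<close> further even sizes.\<close>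

lemma part_gf_omega_parts:
  assumes "m > 0"
  shows "part_gf (omega_parts m) = inverse (omega_den 0 m)"
proof -
  define B where "B N = {m..2 * m} \<union> (\<lambda>i. 2 * (m + i + 1)) ` {..<N}" for N
  have inj: "inj_on (\<lambda>i. 2 * (m + i + 1)) {..<N}" for N by (auto simp: inj_on_def)
  have prodB: "(\<Prod>a\<in>B N. 1 - fps_X ^ a) = (\<Prod>i=m..2 * m. 1 - fps_X ^ i) * (eprod 2 (m + N) * ieprod 2 m)" for N
  proof -
    have "(\<Prod>a\<in>B N. 1 - fps_X ^ a :: complex fps) = (\<Prod>i=m..2 * m. 1 - fps_X ^ i) * (\<Prod>i<N. 1 - fps_X ^ (2 * (m + i + 1)))"
    proof -
      have "(\<Prod>a\<in>B N. 1 - fps_X ^ a :: complex fps) =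
          (\<Prod>i=m..2 * m. 1 - fps_X ^ i) * (\<Prod>a\<in>(\<lambda>i. 2 * (m + i + 1)) ` {..<N}. 1 - fps_X ^ a)"
        unfolding B_def by (rule prod.union_disjoint) auto
      then show ?thesis by (simp only: prod.reindex[OF inj] o_def)
    qed
    moreover have "eprod 2 (m + N) = eprod 2 m * (\<Prod>i<N. 1 - fps_X ^ (2 * (m + i + 1)))"
      by (induction N) (simp_all add: eprod_Suc)
    ultimately show ?thesis by (simp add: mult_ac)
  qed
  have "part_gf (B N) * (\<Prod>a\<in>B N. 1 - fps_X ^ a) = 1" for N
    using assms by (intro part_gf_prod) (auto simp: B_def)
  moreover have "(\<lambda>N. part_gf (B N) * (\<Prod>a\<in>B N. 1 - fps_X ^ a)) \<longlonglongrightarrow>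
      part_gf (omega_parts m) * ((\<Prod>i=m..2 * m. 1 - fps_X ^ i) * (E 2 * ieprod 2 m))"
    unfolding prodB
  proof (intro fps_tendsto_mult tendsto_const part_gf_tendsto filterlim_compose[OF eprod_tendsto])
    show "B N \<subseteq> omega_parts m" for N
      by (auto simp: B_def omega_parts_def) (metis dvd_triv_left le_neq_implies_less)
    show "omega_parts m \<inter> {..N} \<subseteq> B N" for N
    proof
      fix k assume k: "k \<in> omega_parts m \<inter> {..N}"
      show "k \<in> B N"
      proof (cases "k \<le> 2 * m")
        case True
        then show ?thesis using k by (auto simp: B_def omega_parts_def)
      next
        case False
        then have "even k" using k by (auto simp: omega_parts_def)
        then obtain l where l: "k = 2 * l" by (auto elim: evenE)
        then have "k = 2 * (m + (l - m - 1) + 1)" "l - m - 1 < N" using False k by auto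
        then show ?thesis by (auto simp: B_def)
      qed
    qed
    show "filterlim ((+) m) sequentially sequentially"
      by (rule filterlim_subseq) (simp add: strict_mono_def)
  qed simp
  ultimately have "part_gf (omega_parts m) * omega_den 0 m = 1"
    using LIMSEQ_unique[of "\<lambda>_. 1 :: complex fps"] by (simp add: omega_den_def even_tail_def)
  then have "omega_den 0 m * part_gf (omega_parts m) = 1" by (simp only: mult.commute)
  then show ?thesis by (rule fps_inverse_unique[symmetric])
qed

subsection \<open>A recurrence identifying the generating function with \<open>q\<close> times \<open>omega(q)\<close>\<close>

text \<open>Both sides are the case \<open>z = 1\<close> of a function of \<open>z\<close> satisfying
  \<open>(1 - q z) A(z) - q A(z q^2) = q\<close>. Only the values at \<open>z = q ^ (2 * j)\<close> occur below.\<close>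

definition omega_V :: "nat \<Rightarrow> nat \<Rightarrow> complex fps" where
  "omega_V j n = (\<Prod>i=Suc n..2 * n. 1 - fps_X ^ (i + 2 * j)) * even_tail (n + j)"

lemma omega_V_nth_0 [simp]: "fps_nth (omega_V j n) 0 = 1"
proof -
  have "fps_nth (\<Prod>i\<in>A. 1 - fps_X ^ (i + 2 * j) :: complex fps) 0 = 1" if "A \<subseteq> {1..}" for A
    using that by (induction A rule: infinite_finite_induct) auto
  from this[of "{Suc n..2 * n}"] show ?thesis by (simp add: omega_V_def)
qed

lemma omega_den_V:
  "omega_den j (Suc n) = omega_V j n * (1 - fps_X ^ (2 * n + 1 + 2 * j))" (is ?A)
  "omega_den j (Suc n) = (1 - fps_X ^ (Suc n + 2 * j)) * omega_V j (Suc n)" (is ?B)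
  "omega_den j (Suc n) = (1 - fps_X ^ (Suc n + 2 * j)) * omega_den (Suc j) n" (is ?C)
proof -
  have 2: "2 * Suc n = Suc (Suc (2 * n))" by simp
  have "{Suc n..2 * Suc n} = insert (Suc (Suc (2 * n))) (insert (Suc (2 * n)) {Suc n..2 * n})" by auto
  then have "(\<Prod>i=Suc n..2 * Suc n. 1 - fps_X ^ (i + 2 * j) :: complex fps) =
      (1 - fps_X ^ (Suc (Suc (2 * n)) + 2 * j)) * ((1 - fps_X ^ (Suc (2 * n) + 2 * j)) * (\<Prod>i=Suc n..2 * n. 1 - fps_X ^ (i + 2 * j)))"
    by simp
  moreover have "Suc (Suc (2 * n)) + 2 * j = 2 * (n + j) + 2" "Suc (2 * n) + 2 * j = 2 * n + 1 + 2 * j" by simp_all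
  ultimately show ?A
    unfolding omega_den_def omega_V_def even_tail_Suc[of "n + j"] by (simp only: mult_ac add_Suc)
  have *: "(\<Prod>i=Suc n..2 * Suc n. 1 - fps_X ^ (i + 2 * j) :: complex fps) =
      (1 - fps_X ^ (Suc n + 2 * j)) * (\<Prod>i=Suc (Suc n)..2 * Suc n. 1 - fps_X ^ (i + 2 * j))"
    by (rule prod.atLeast_Suc_atMost) simp
  show ?B unfolding omega_den_def omega_V_def * by (simp only: mult_ac)
  have "(\<Prod>i=Suc (Suc n)..2 * Suc n. 1 - fps_X ^ (i + 2 * j) :: complex fps) = (\<Prod>i=n..2 * n. 1 - fps_X ^ (i + 2 * Suc j))"
    unfolding 2 prod.shift_bounds_cl_Suc_ivl by simp
  then show ?C unfolding omega_den_def * by (simp add: mult_ac)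
qed

definition alpha_seq :: "nat \<Rightarrow> complex fps" where
  "alpha_seq j = fsum (\<lambda>n. fps_X ^ Suc n * inverse (omega_den j (Suc n)))"

lemma inverse_mult_cancel:
  fixes f g :: "complex fps"
  assumes "f = g * h" "fps_nth g 0 \<noteq> 0"
  shows "inverse h = g * inverse f"
  using assms by (simp add: fps_inverse_mult inverse_mult_eq_1' flip: mult.assoc)

lemma omega_V_dvd: "fps_X ^ n dvd inverse (omega_V j n) - 1"
proof -
  have "fps_X ^ n dvd (\<Prod>i\<in>A. 1 - fps_X ^ (i + 2 * j) :: complex fps) - 1" if "A \<subseteq> {n..}" for A
    using that
  proof (induction A rule: infinite_finite_induct)
    case (insert i A)
    have "(\<Prod>i\<in>insert i A. 1 - fps_X ^ (i + 2 * j) :: complex fps) - 1 =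
       ((\<Prod>i\<in>A. 1 - fps_X ^ (i + 2 * j)) - 1) - fps_X ^ (i + 2 * j) * (\<Prod>i\<in>A. 1 - fps_X ^ (i + 2 * j))"
      using insert by (simp add: algebra_simps)
    moreover have "fps_X ^ n dvd (fps_X :: complex fps) ^ (i + 2 * j)" using insert by (intro le_imp_power_dvd) auto
    ultimately show ?case using insert by (simp only: dvd_diff dvd_mult2 insert_subset)
  qed auto
  then have 1: "fps_X ^ n dvd (\<Prod>i=Suc n..2 * n. 1 - fps_X ^ (i + 2 * j) :: complex fps) - 1" by auto
  have 2: "fps_X ^ n dvd even_tail (n + j) - 1" by (rule X_power_dvdI[OF even_tail_dvd]) simp
  have "omega_V j n - 1 = ((\<Prod>i=Suc n..2 * n. 1 - fps_X ^ (i + 2 * j)) - 1) * even_tail (n + j) + (even_tail (n + j) - 1)"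
    by (simp add: omega_V_def algebra_simps)
  then have 3: "fps_X ^ n dvd omega_V j n - 1" using 1 2 by (simp only: dvd_add dvd_mult2)
  have "inverse (omega_V j n) - 1 = (omega_V j n - 1) * (- inverse (omega_V j n))"
    by (simp add: algebra_simps inverse_mult_eq_1')
  then show ?thesis using 3 by (simp only: dvd_mult2)
qed

text \<open>After an index shift in the second series the terms telescope: each equals -q (V n - V
  (n + 1)), where V n is the reciprocal of \<open>omega_V j n\<close>. Since V n tends to 1, the
  telescoping is applied to V n - 1. The boundary value V 0 cancels against the term lost in the
  shift, and q remains.\<close>

lemma alpha_seq_rec: "(1 - fps_X ^ (2 * j + 1)) * alpha_seq j - fps_X * alpha_seq (Suc j) = fps_X"
proof -
  define g where "g n = fps_X ^ Suc n * inverse (omega_den j (Suc n))" for n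
  define V where "V n = inverse (omega_V j n)" for n
  have dvd: "fps_X ^ n dvd g n" for n
    unfolding g_def by (intro dvd_mult2 le_imp_power_dvd) simp
  have lf: "locally_finite g" by (rule locally_finite_natI[OF dvd])
  have V: "V n = (1 - fps_X ^ (2 * n + 1 + 2 * j)) * inverse (omega_den j (Suc n))"
    "V (Suc n) = (1 - fps_X ^ (Suc n + 2 * j)) * inverse (omega_den j (Suc n))" for n
    unfolding V_def
    by (rule inverse_mult_cancel; simp add: omega_den_V(1) mult.commute)
       (rule inverse_mult_cancel; simp add: omega_den_V(2))
  have "fps_X * (fps_X ^ Suc n * inverse (omega_den (Suc j) (Suc n))) = (1 - fps_X ^ (Suc (Suc n) + 2 * j)) * g (Suc n)" for n
  proof -
    have "inverse (omega_den (Suc j) (Suc n)) = (1 - fps_X ^ (Suc (Suc n) + 2 * j)) * inverse (omega_den j (Suc (Suc n)))"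
      by (rule inverse_mult_cancel) (use omega_den_V(3)[of j "Suc n"] in auto)
    then show ?thesis by (simp add: g_def mult_ac)
  qed
  moreover have "locally_finite (\<lambda>n. fps_X ^ Suc n * inverse (omega_den (Suc j) (Suc n)))"
    by (intro locally_finite_natI dvd_mult2 le_imp_power_dvd) simp
  ultimately have "fps_X * alpha_seq (Suc j) = fsum (\<lambda>n. (1 - fps_X ^ (Suc (Suc n) + 2 * j)) * g (Suc n))"
    unfolding alpha_seq_def by (simp only: flip: fsum_mult)
  also have "\<dots> = fsum (\<lambda>n. (1 - fps_X ^ (Suc n + 2 * j)) * g n) - (1 - fps_X ^ (Suc 0 + 2 * j)) * g 0"
    by (rule fsum_Suc[where g = "\<lambda>n. (1 - fps_X ^ (Suc n + 2 * j)) * g n"]) (use dvd in \<open>auto intro: dvd_mult\<close>)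
  finally have 1: "fps_X * alpha_seq (Suc j) = \<dots>" .
  have 2: "(1 - fps_X ^ (2 * j + 1)) * alpha_seq j = fsum (\<lambda>n. (1 - fps_X ^ (2 * j + 1)) * g n)"
    unfolding alpha_seq_def g_def[symmetric] by (rule fsum_mult[OF lf, symmetric])
  have 3: "fsum (\<lambda>n. (1 - fps_X ^ (2 * j + 1)) * g n) - fsum (\<lambda>n. (1 - fps_X ^ (Suc n + 2 * j)) * g n)
     = fsum (\<lambda>n. - fps_X * ((V n - 1) - (V (Suc n) - 1)))"
  proof (subst fsum_diff[symmetric])
    have "(1 - fps_X ^ (2 * j + 1)) * g n - (1 - fps_X ^ (Suc n + 2 * j)) * g n = - fps_X * ((V n - 1) - (V (Suc n) - 1))" for n
      unfolding V(1)[of n] V(2)[of n] g_def by (simp add: algebra_simps power_add mult_2 mult_2_right)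
    then show "fsum (\<lambda>n. (1 - fps_X ^ (2 * j + 1)) * g n - (1 - fps_X ^ (Suc n + 2 * j)) * g n) =
       fsum (\<lambda>n. - fps_X * ((V n - 1) - (V (Suc n) - 1)))" by simp
  qed (use dvd in \<open>auto intro!: locally_finite_natI dvd_mult\<close>)
  have Vd: "fps_X ^ n dvd V n - 1" for n unfolding V_def by (rule omega_V_dvd)
  have Vd': "fps_X ^ n dvd V (Suc n) - 1" for n by (rule X_power_dvdI[OF Vd]) simp
  have lfV: "locally_finite (\<lambda>n. (V n - 1) - (V (Suc n) - 1))"
    by (rule locally_finite_natI, rule dvd_diff[OF Vd Vd'])
  have "fsum (\<lambda>n. - fps_X * ((V n - 1) - (V (Suc n) - 1))) = - fps_X * (V 0 - 1)"
    by (simp only: fsum_mult[OF lfV] fsum_telescope[of "\<lambda>n. V n - 1", OF Vd])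
  moreover have "(1 - fps_X ^ (Suc 0 + 2 * j)) * g 0 = fps_X * V 0"
    using V(1)[of 0] by (simp add: g_def mult_ac)
  moreover have "a - (b - c) = fps_X" if "a - b = s" "s = - fps_X * (v - 1)" "c = fps_X * v"
    for a b c s v :: "complex fps"
  proof -
    have "a = s + b" using that(1) by (simp add: diff_eq_eq)
    then show ?thesis by (simp add: that(2,3) algebra_simps)
  qed
  ultimately show ?thesis unfolding 1 2 using 3 by blast
qed

definition odd_tail_prod :: "nat \<Rightarrow> nat \<Rightarrow> complex fps" where
  "odd_tail_prod j n = (\<Prod>k<n. 1 - fps_X ^ (2 * j + 2 * k + 1))"

lemma odd_tail_prod_Suc: "odd_tail_prod j (Suc n) = (1 - fps_X ^ (2 * j + 2 * n + 1)) * odd_tail_prod j n"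
  by (simp add: odd_tail_prod_def)

lemma odd_tail_prod_Suc': "odd_tail_prod j (Suc n) = (1 - fps_X ^ (2 * j + 1)) * odd_tail_prod (Suc j) n"
  unfolding odd_tail_prod_def by (subst prod.lessThan_Suc_shift) simp

text \<open>With z = q^(2j), the sum of z^n q^(2n^2+2n+1) / ((q; q^2)_(n+1) (zq; q^2)_(n+1)), which
  is q omega(q) at z = 1.\<close>

definition beta_seq :: "nat \<Rightarrow> complex fps" where
  "beta_seq j = fsum (\<lambda>n. fps_X ^ (2 * j * n + 2 * n ^ 2 + 2 * n + 1) *
     (inverse (odd_tail_prod 0 (Suc n)) * inverse (odd_tail_prod j (Suc n))))"

lemma beta_seq_rec: "(1 - fps_X ^ (2 * j + 1)) * beta_seq j - fps_X * beta_seq (Suc j) = fps_X"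
proof -
  define b where "b j n = fps_X ^ (2 * j * n + 2 * n ^ 2 + 2 * n + 1) *
     (inverse (odd_tail_prod 0 (Suc n)) * inverse (odd_tail_prod j (Suc n)))" for j n
  \<comment> \<open>The antidifference: the n-th term of the left side equals
    \<open>c n - c (Suc n)\<close>, and \<open>c 0\<close> is q.\<close>
  define c where "c n = fps_X ^ (2 * j * n + 2 * n ^ 2 + 2 * n + 1) *
     (inverse (odd_tail_prod 0 n) * inverse (odd_tail_prod (Suc j) n))" for n
  have lf: "locally_finite (b j)" for j
    unfolding b_def by (intro locally_finite_natI dvd_mult2 le_imp_power_dvd) simp
  have c: "fps_X ^ n dvd c n" for n
    unfolding c_def by (intro dvd_mult2 le_imp_power_dvd) simp
  have "(1 - fps_X ^ (2 * j + 1)) * b j n - fps_X * b (Suc j) n = c n - c (Suc n)" for n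
  proof -
    define I J where "I = inverse (odd_tail_prod 0 (Suc n))" and "J = inverse (odd_tail_prod (Suc j) (Suc n))"
    have 1: "inverse (odd_tail_prod 0 n) = (1 - fps_X ^ (2 * n + 1)) * I"
      unfolding I_def by (rule inverse_mult_cancel) (simp_all add: odd_tail_prod_Suc)
    have 2: "inverse (odd_tail_prod (Suc j) n) = (1 - fps_X ^ (2 * j + 2 * n + 3)) * J"
      unfolding J_def by (rule inverse_mult_cancel) (simp_all add: odd_tail_prod_Suc numeral_3_eq_3)
    have 3: "inverse (odd_tail_prod (Suc j) n) = (1 - fps_X ^ (2 * j + 1)) * inverse (odd_tail_prod j (Suc n))"
      by (rule inverse_mult_cancel) (simp_all add: odd_tail_prod_Suc')
    define Y where "Y = (fps_X :: complex fps) ^ (2 * j * n + 2 * n ^ 2 + 2 * n + 1)"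
    define A B where "A = (fps_X :: complex fps) ^ (2 * n)" and "B = (fps_X :: complex fps) ^ (2 * j)"
    have b1: "(1 - fps_X ^ (2 * j + 1)) * b j n = Y * (I * ((1 - fps_X ^ (2 * j + 2 * n + 3)) * J))"
      using 3 2 by (simp add: b_def Y_def I_def mult_ac)
    have b2: "b (Suc j) n = Y * A * (I * J)"
    proof -
      have "2 * Suc j * n + 2 * n ^ 2 + 2 * n + 1 = (2 * j * n + 2 * n ^ 2 + 2 * n + 1) + 2 * n" by simp
      then show ?thesis by (simp only: b_def Y_def A_def I_def J_def power_add)
    qed
    have c1: "c n = Y * (((1 - fps_X ^ (2 * n + 1)) * I) * ((1 - fps_X ^ (2 * j + 2 * n + 3)) * J))"
      by (simp add: c_def 1 2 Y_def)
    have "2 * j * Suc n + 2 * Suc n ^ 2 + 2 * Suc n + 1 = (2 * j * n + 2 * n ^ 2 + 2 * n + 1) + (2 * j + 2 * n + 2 * n + 4)"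
      by (simp add: power2_eq_square algebra_simps)
    then have c2: "c (Suc n) = Y * (B * A * A * fps_X ^ 4) * (I * J)"
      by (simp only: c_def Y_def A_def B_def I_def J_def power_add mult.assoc)
    have e: "fps_X ^ (2 * n + 1) = A * fps_X" "fps_X ^ (2 * j + 2 * n + 3) = B * A * (fps_X :: complex fps) ^ 3"
      by (simp_all add: A_def B_def power_add)
    show ?thesis unfolding b1 b2 c1 c2 e by algebra
  qed
  then have "fsum (\<lambda>n. (1 - fps_X ^ (2 * j + 1)) * b j n - fps_X * b (Suc j) n) = c 0"
    using fsum_telescope[of c, OF c] by simp
  moreover have "fsum (\<lambda>n. (1 - fps_X ^ (2 * j + 1)) * b j n - fps_X * b (Suc j) n) =
      (1 - fps_X ^ (2 * j + 1)) * beta_seq j - fps_X * beta_seq (Suc j)"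
    unfolding beta_seq_def b_def[symmetric] using lf
    by (subst fsum_diff) (auto intro: locally_finite_mult simp: fsum_mult)
  ultimately show ?thesis by (simp add: c_def odd_tail_prod_def)
qed

text \<open>By the common recurrence the difference at j is q times a unit times the difference at j
  + 1. Iterating makes it divisible by every power of q.\<close>

lemma alpha_seq_eq_beta_seq: "alpha_seq j = beta_seq j"
proof -
  have "fps_X ^ n dvd alpha_seq j - beta_seq j" for n
  proof (induction n arbitrary: j)
    case (Suc n)
    have unit: "inverse (1 - fps_X ^ (2 * j + 1)) * (1 - fps_X ^ (2 * j + 1)) = (1 :: complex fps)"
      by (rule inverse_mult_eq_1) simp
    have "(1 - fps_X ^ (2 * j + 1)) * (alpha_seq j - beta_seq j) = fps_X * (alpha_seq (Suc j) - beta_seq (Suc j))"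
    proof -
      have "(1 - fps_X ^ (2 * j + 1)) * (alpha_seq j - beta_seq j) =
        ((1 - fps_X ^ (2 * j + 1)) * alpha_seq j - fps_X * alpha_seq (Suc j)) -
        ((1 - fps_X ^ (2 * j + 1)) * beta_seq j - fps_X * beta_seq (Suc j)) + fps_X * (alpha_seq (Suc j) - beta_seq (Suc j))"
        by (simp only: right_diff_distrib) simp
      then show ?thesis by (simp only: alpha_seq_rec beta_seq_rec) simp
    qed
    then have "inverse (1 - fps_X ^ (2 * j + 1)) * (1 - fps_X ^ (2 * j + 1)) * (alpha_seq j - beta_seq j) =
      inverse (1 - fps_X ^ (2 * j + 1)) * (fps_X * (alpha_seq (Suc j) - beta_seq (Suc j)))"
      by (simp only: mult.assoc)
    then have "alpha_seq j - beta_seq j = inverse (1 - fps_X ^ (2 * j + 1)) * (fps_X * (alpha_seq (Suc j) - beta_seq (Suc j)))"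
      by (simp only: unit mult_1)
    moreover have "fps_X ^ Suc n dvd fps_X * (alpha_seq (Suc j) - beta_seq (Suc j))"
      unfolding power_Suc by (rule mult_dvd_mono[OF dvd_refl Suc.IH])
    ultimately show ?case by (simp only: dvd_mult)
  qed simp
  then have "alpha_seq j - beta_seq j = 0" by (rule X_power_dvd_all_imp_0)
  then show ?thesis by simp
qed

lemma omega_gf_eq: "omega_gf = fsum (\<lambda>n. fps_X ^ (2 * n ^ 2 + 2 * n + 1) * inverse (odd_prod 1 (Suc n)) ^ 2)"
proof -
  have "omega_gf = alpha_seq 0"
    unfolding omega_gf_fsum alpha_seq_def by (simp add: part_gf_omega_parts)
  also have "\<dots> = beta_seq 0" by (rule alpha_seq_eq_beta_seq)
  also have "odd_tail_prod 0 n = odd_prod 1 n" for n by (simp add: odd_tail_prod_def odd_prod_def)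
  then have "beta_seq 0 = fsum (\<lambda>n. fps_X ^ (2 * n ^ 2 + 2 * n + 1) * inverse (odd_prod 1 (Suc n)) ^ 2)"
    by (simp add: beta_seq_def power2_eq_square)
  finally show ?thesis .
qed

subsection \<open>A Lerch sum\<close>

text \<open>Up to normalisation a Bailey pair relative to q^2 in base q^2. The induction on n needs
  the ratio of consecutive sums, which is obtained by telescoping in k.\<close>

lemma partial_fraction_odd_prod:
  "inverse (odd_prod 1 (Suc n)) ^ 2 = (\<Sum>k\<le>n. (-1) ^ k * fps_X ^ (k * (k + 1)) *
      ((1 + fps_X ^ (2 * k + 1)) * inverse (1 - fps_X ^ (2 * k + 1))) * (ieprod 2 (n - k) * ieprod 2 (n + k + 1)))"
    (is "_ = (\<Sum>k\<le>n. ?t n k)")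
proof (induction n)
  case 0
  have i: "inverse (1 - fps_X) * (1 - fps_X) = (1 :: complex fps)" by (rule inverse_mult_eq_1) simp
  have "ieprod 2 1 * (1 - fps_X ^ 2) = 1" using ieprod_Suc[of 2 0] by simp
  then have "(inverse (1 - fps_X) ^ 2 - (1 + fps_X) * inverse (1 - fps_X) * ieprod 2 1) = 0"
    using i by algebra
  then show ?case by (simp add: odd_prod_def)
next
  case (Suc m)
  define n where "n = Suc m"
  define Q where "Q k = ieprod 2 (n - k)" for k
  define R where "R k = ieprod 2 (n + k + 1)" for k
  define J where "J k = inverse (1 - fps_X ^ (2 * k + 1) :: complex fps)" for k
  have J: "J k * (1 - fps_X ^ (2 * k + 1)) = 1" for k
    unfolding J_def by (rule inverse_mult_eq_1) simp
  have t: "?t n k = (-1) ^ k * fps_X ^ (k * (k + 1)) * ((1 + fps_X ^ (2 * k + 1)) * J k) * (Q k * R k)" for k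
    by (simp add: Q_def R_def J_def)
  \<comment> \<open>For k = n the factor 1 - q^(2(n-k)) vanishes, which accounts for the term that
    the shorter sum lacks.\<close>
  have tm: "(if k \<le> m then ?t m k else 0) = ?t n k * ((1 - fps_X ^ (2 * (n - k))) * (1 - fps_X ^ (2 * (n + k + 1))))"
    if "k \<le> n" for k
  proof (cases "k \<le> m")
    case True
    have "n - k = Suc (m - k)" using True by (simp add: n_def)
    then have 1: "ieprod 2 (m - k) = Q k * (1 - fps_X ^ (2 * (n - k)))"
      using ieprod_Suc[of 2 "m - k"] by (simp add: Q_def)
    have 2: "ieprod 2 (m + k + 1) = R k * (1 - fps_X ^ (2 * (n + k + 1)))"
      using ieprod_Suc[of 2 "m + k + 1"] by (simp add: R_def n_def)
    show ?thesis using True unfolding t 1 2 J_def[symmetric] by (simp only: if_True mult_ac Q_def R_def)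
  next
    case False
    then have "k = n" using that by (simp add: n_def)
    then show ?thesis using False by simp
  qed
  \<comment> \<open>the certificate of the creative telescoping in \<open>k\<close>\<close>
  define L where "L k = (if k \<le> n then (-1) ^ k * fps_X ^ (2 * n + k * (k - 1)) * (1 - fps_X ^ (2 * k))
      * (Q k * ieprod 2 (n + k)) else 0)" for k
  \<comment> \<open>The factor 1 - q^(2n) clears the denominator of the certificate. It can be
    cancelled later because n = Suc m is positive.\<close>
  have step: "(1 - fps_X ^ (2 * n)) * (?t n k * (1 - fps_X ^ (2 * n + 1)) ^ 2
       - ?t n k * ((1 - fps_X ^ (2 * (n - k))) * (1 - fps_X ^ (2 * (n + k + 1))))) = L k - L (Suc k)"
    if kn: "k \<le> n" for k
  proof -
    define A B K where "A = (fps_X :: complex fps) ^ (2 * (n - k))" and "B = (fps_X :: complex fps) ^ (2 * k)"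
      and "K = (-1) ^ k * (fps_X :: complex fps) ^ (k * (k - 1))"
    have AB: "(fps_X :: complex fps) ^ (2 * n) = A * B" using kn by (simp add: A_def B_def flip: power_add)
    have e1: "(fps_X :: complex fps) ^ (2 * n + 1) = A * B * fps_X" by (simp add: AB)
    have e2: "(fps_X :: complex fps) ^ (2 * (n + k + 1)) = A * B * B * fps_X ^ 2"
    proof -
      have "2 * (n + k + 1) = 2 * n + 2 * k + 2" by simp
      then show ?thesis by (simp only: power_add AB B_def)
    qed
    have e3: "(fps_X :: complex fps) ^ (2 * k + 1) = B * fps_X" by (simp add: B_def)
    have e4: "(-1) ^ k * (fps_X :: complex fps) ^ (k * (k + 1)) = K * B"
    proof -
      have "k * (k + 1) = k * (k - 1) + 2 * k" by (cases k) (simp_all add: algebra_simps)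
      then show ?thesis by (simp only: K_def B_def power_add mult.assoc)
    qed
    have L1: "L k = K * (A * B) * (1 - B) * (Q k * (R k * (1 - A * B * B * fps_X ^ 2)))"
    proof -
      have ie: "ieprod 2 (n + k) = R k * (1 - A * B * B * fps_X ^ 2)"
        using ieprod_Suc[of 2 "n + k"] by (simp add: R_def flip: e2)
      show ?thesis using kn unfolding L_def ie power_add AB K_def B_def by (simp only: if_True mult_ac)
    qed
    have L2: "L (Suc k) = - K * (A * B) * B * (1 - B * fps_X ^ 2) * (Q k * (1 - A) * R k)"
    proof (cases "k < n")
      case True
      have "n - k = Suc (n - Suc k)" using True by simp
      then have "Q (Suc k) = Q k * (1 - A)"
        using ieprod_Suc[of 2 "n - Suc k"] by (simp add: Q_def A_def)
      moreover have "(-1) ^ Suc k * (fps_X :: complex fps) ^ (2 * n + Suc k * (Suc k - 1)) = - K * (A * B) * B"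
      proof -
        have "2 * n + Suc k * (Suc k - 1) = 2 * n + k * (k + 1)" by simp
        then have "(-1) ^ Suc k * (fps_X :: complex fps) ^ (2 * n + Suc k * (Suc k - 1)) =
            - ((-1) ^ k * fps_X ^ (k * (k + 1))) * fps_X ^ (2 * n)"
          by (simp only: power_add power_Suc) simp
        then show ?thesis unfolding e4 AB by simp
      qed
      moreover have "(fps_X :: complex fps) ^ (2 * Suc k) = B * fps_X ^ 2"
        by (simp add: B_def power2_eq_square mult_ac)
      moreover have "ieprod 2 (n + Suc k) = R k" by (simp add: R_def)
      ultimately show ?thesis using True by (simp only: L_def Suc_le_eq if_True)
    next
      case False
      then have "k = n" using kn by simp
      then have "A = 1" by (simp add: A_def)
      then show ?thesis using False by (simp add: L_def)
    qed
    have J': "J k * (1 - B * fps_X) = 1" using J[of k] by (simp only: e3)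
    show ?thesis unfolding t unfolding e4 e1 e2 e3 A_def[symmetric] L1 L2 AB
      using J' by algebra
  qed
  have "(1 - fps_X ^ (2 * n)) * ((\<Sum>k\<le>n. ?t n k) * (1 - fps_X ^ (2 * n + 1)) ^ 2 - (\<Sum>k\<le>m. ?t m k)) = 0"
  proof -
    have gen: "x * ((\<Sum>k\<le>n. f k) * y - (\<Sum>k\<le>n. g k)) = (\<Sum>k\<le>n. x * (f k * y - g k))"
      for x y :: "complex fps" and f g
      by (simp add: sum_distrib_left sum_distrib_right sum_subtractf right_diff_distrib)
    have "(\<Sum>k\<le>m. ?t m k) = (\<Sum>k\<le>n. if k \<le> m then ?t m k else 0)"
      by (intro sum.mono_neutral_cong_left) (auto simp: n_def)
    also have "\<dots> = (\<Sum>k\<le>n. ?t n k * ((1 - fps_X ^ (2 * (n - k))) * (1 - fps_X ^ (2 * (n + k + 1)))))"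
      by (intro sum.cong refl tm) simp
    finally have "(1 - fps_X ^ (2 * n)) * ((\<Sum>k\<le>n. ?t n k) * (1 - fps_X ^ (2 * n + 1)) ^ 2 - (\<Sum>k\<le>m. ?t m k)) =
       (\<Sum>k\<le>n. (1 - fps_X ^ (2 * n)) * (?t n k * (1 - fps_X ^ (2 * n + 1)) ^ 2
       - ?t n k * ((1 - fps_X ^ (2 * (n - k))) * (1 - fps_X ^ (2 * (n + k + 1))))))"
      by (simp only: gen)
    also have "\<dots> = (\<Sum>k\<le>n. L k - L (Suc k))" by (intro sum.cong refl step) simp
    also have "\<dots> = L 0 - L (Suc n)" by (rule sum_telescope)
    also have "\<dots> = 0" by (simp add: L_def)
    finally show ?thesis .
  qed
  moreover have "fps_nth (1 - fps_X ^ (2 * n) :: complex fps) 0 = 1" by (simp add: n_def)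
  then have "1 - fps_X ^ (2 * n) \<noteq> (0 :: complex fps)" by force
  ultimately have s: "(\<Sum>k\<le>n. ?t n k) * (1 - fps_X ^ (2 * n + 1)) ^ 2 = inverse (odd_prod 1 (Suc m)) ^ 2"
    unfolding Suc.IH by simp
  define i where "i = inverse (1 - fps_X ^ (2 * n + 1) :: complex fps)"
  have i: "i * (1 - fps_X ^ (2 * n + 1)) = 1" unfolding i_def by (rule inverse_mult_eq_1) simp
  have "odd_prod 1 (Suc n) = (1 - fps_X ^ (2 * n + 1)) * odd_prod 1 (Suc m)" by (simp add: odd_prod_def n_def)
  then have "inverse (odd_prod 1 (Suc n)) = i * inverse (odd_prod 1 (Suc m))" by (simp add: fps_inverse_mult i_def)
  moreover have "w ^ 2 = S * (i * y) ^ 2" if "w = i * v" "S * y ^ 2 = v ^ 2" for w S v y :: "complex fps"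
    by (simp add: that(1) power_mult_distrib mult_ac flip: that(2))
  ultimately have "inverse (odd_prod 1 (Suc n)) ^ 2 = (\<Sum>k\<le>n. ?t n k) * (i * (1 - fps_X ^ (2 * n + 1))) ^ 2"
    using s by blast
  then show ?case unfolding i n_def[symmetric] by (simp only: power_one mult_1_right)
qed

text \<open>The Durfee rectangle identity in base q^2, which serves as the limiting form of Bailey's
  lemma. By telescoping, the sum does not depend on r; as r grows only its term m = 0, the series
  \<open>ieprod 2 r\<close>, survives.\<close>

lemma durfee_rectangle:
  "fsum (\<lambda>m. fps_X ^ (2 * m * (m + r)) * (ieprod 2 m * ieprod 2 (m + r))) = inverse (E 2)"
proof -
  define g where "g r m = fps_X ^ (2 * m * (m + r)) * (ieprod 2 m * ieprod 2 (m + r))" for r m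
  define c where "c r m = fps_X ^ (2 * m * (m + r)) * ((1 - fps_X ^ (2 * m)) * ieprod 2 m * ieprod 2 (m + r))" for r m
  have e: "m \<le> 2 * m * (m + r)" for m r :: nat by (cases m) auto
  have g: "fps_X ^ m dvd g r m" and c: "fps_X ^ m dvd c r m" for r m
    unfolding g_def c_def by (intro dvd_mult2 le_imp_power_dvd e)+
  have step: "fsum (g r) = fsum (g (Suc r))" for r
  proof -
    have "g r m - g (Suc r) m = c r m - c r (Suc m)" for m
    proof -
      define P Q Y A B where "P = ieprod 2 m" and "Q = ieprod 2 (Suc (m + r))" and "Y = (fps_X :: complex fps) ^ (2 * m * (m + r))"
        and "A = (fps_X :: complex fps) ^ (2 * m)" and "B = (fps_X :: complex fps) ^ (2 * r)"
      have q: "ieprod 2 (m + r) = Q * (1 - A * B * fps_X ^ 2)"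
        using ieprod_Suc[of 2 "m + r"] by (simp add: Q_def A_def B_def power_add power2_eq_square mult_ac)
      have p: "(1 - fps_X ^ (2 * Suc m)) * ieprod 2 (Suc m) = P"
        using ieprod_Suc[of 2 m] by (simp add: P_def mult.commute)
      have "2 * m * (m + Suc r) = 2 * m * (m + r) + 2 * m" by simp
      then have g2: "g (Suc r) m = Y * A * (P * Q)" by (simp only: g_def Y_def A_def P_def Q_def power_add add_Suc_right)
      have "2 * Suc m * (Suc m + r) = 2 * m * (m + r) + 2 * m + 2 * m + 2 * r + 2" by (simp add: algebra_simps)
      then have c2: "c r (Suc m) = Y * A * A * B * fps_X ^ 2 * (P * Q)"
        by (simp only: c_def p Y_def A_def B_def Q_def power_add add_Suc)
      have g1: "g r m = Y * (P * (Q * (1 - A * B * fps_X ^ 2)))" by (simp only: g_def Y_def P_def q)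
      have c1: "c r m = Y * ((1 - A) * P * (Q * (1 - A * B * fps_X ^ 2)))" by (simp only: c_def Y_def P_def A_def q)
      show ?thesis unfolding g1 g2 c1 c2 by algebra
    qed
    then have "fsum (\<lambda>m. g r m - g (Suc r) m) = c r 0" using fsum_telescope[of "c r", OF c] by simp
    moreover have "fsum (\<lambda>m. g r m - g (Suc r) m) = fsum (g r) - fsum (g (Suc r))"
      by (rule fsum_diff; rule locally_finite_natI[OF g])
    moreover have "c r 0 = 0" by (simp add: c_def)
    ultimately show ?thesis by simp
  qed
  define C where "C = fsum (g 0)"
  have const: "fsum (g r) = C" for r
    by (induction r) (simp_all only: C_def step[symmetric])
  have "fps_X ^ r dvd fsum (g r) - ieprod 2 r" for r
  proof -
    have "fsum (\<lambda>m. g r (Suc m)) = fsum (g r) - g r 0" by (rule fsum_Suc[OF g])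
    moreover have "fps_X ^ r dvd fsum (\<lambda>m. g r (Suc m))"
      unfolding g_def by (intro X_power_dvd_fsum dvd_mult2 le_imp_power_dvd) simp
    ultimately show ?thesis by (simp add: g_def)
  qed
  then have "(\<lambda>r. fsum (g r) - ieprod 2 r) \<longlonglongrightarrow> 0" by (rule X_power_tendsto_0)
  from fps_tendsto_add[OF this ieprod_tendsto[of 2]]
  have "(\<lambda>r::nat. C) \<longlonglongrightarrow> inverse (E 2)" by (simp add: const)
  then have "C = inverse (E 2)" by (simp add: LIMSEQ_const_iff)
  then show ?thesis using const[of r] unfolding g_def by simp
qed

lemma fsum_if_shift:
  fixes g :: "nat \<Rightarrow> 'a::idom fps"
  shows "fsum (\<lambda>n. if k \<le> n then g n else 0) = fsum (\<lambda>m. g (k + m))"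
proof -
  have "fsum (\<lambda>m. (\<lambda>n. if k \<le> n then g n else 0) (k + m)) = fsum (\<lambda>n. if k \<le> n then g n else 0)"
  proof (rule fsum_cong_inj)
    show "inj ((+) k)" by simp
    fix j assume "j \<notin> range ((+) k)"
    then have "\<not> k \<le> j" by (auto simp: le_iff_add)
    then show "(if k \<le> j then g j else 0) = 0" by simp
  qed
  then show ?thesis by simp
qed

text \<open>Insert the Bailey pair into q omega(q) and exchange the sums. For n = k + m the exponent
  2n^2 + 2n splits into 2k^2 + 2k and 2m (m + 2k + 1), so the inner sum is the Durfee sum with r =
  2k + 1.\<close>

lemma omega_gf_lerch:
  "E 2 * omega_gf = fsum (\<lambda>k. (-1) ^ k * fps_X ^ (3 * k ^ 2 + 3 * k + 1) *
      ((1 + fps_X ^ (2 * k + 1)) * inverse (1 - fps_X ^ (2 * k + 1))))"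
proof -
  define h where "h k = (-1) ^ k * ((1 + fps_X ^ (2 * k + 1)) * inverse (1 - fps_X ^ (2 * k + 1))) * (fps_X :: complex fps) ^ (k * (k + 1))" for k
  define g where "g n k = (if k \<le> n then fps_X ^ (2 * n ^ 2 + 2 * n + 1) * h k * (ieprod 2 (n - k) * ieprod 2 (n + k + 1)) else 0)" for n k
  have dvd: "fps_X ^ n dvd g n k" for n k
  proof -
    have "fps_X ^ n dvd (fps_X :: complex fps) ^ (2 * n ^ 2 + 2 * n + 1)" by (rule le_imp_power_dvd) simp
    then show ?thesis by (cases "k \<le> n") (simp_all only: g_def dvd_mult2 dvd_0_right if_True if_False simp_thms)
  qed
  have inner: "fsum (\<lambda>n. g n k) = inverse (E 2) * ((-1) ^ k * fps_X ^ (3 * k ^ 2 + 3 * k + 1) *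
      ((1 + fps_X ^ (2 * k + 1)) * inverse (1 - fps_X ^ (2 * k + 1))))" for k
  proof -
    have "fsum (\<lambda>n. g n k) = fsum (\<lambda>m. fps_X ^ (2 * (k + m) ^ 2 + 2 * (k + m) + 1) * h k * (ieprod 2 m * ieprod 2 (k + m + k + 1)))"
      unfolding g_def by (subst fsum_if_shift) simp
    also have "\<dots> = fsum (\<lambda>m. (h k * fps_X ^ (2 * k ^ 2 + 2 * k + 1)) * (fps_X ^ (2 * m * (m + (2 * k + 1))) * (ieprod 2 m * ieprod 2 (m + (2 * k + 1)))))"
    proof (rule arg_cong[of _ _ fsum], rule ext)
      fix m
      have "2 * (k + m) ^ 2 + 2 * (k + m) + 1 = (2 * k ^ 2 + 2 * k + 1) + 2 * m * (m + (2 * k + 1))"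
        by (simp add: power2_eq_square algebra_simps)
      moreover have "k + m + k + 1 = m + (2 * k + 1)" by simp
      ultimately show "fps_X ^ (2 * (k + m) ^ 2 + 2 * (k + m) + 1) * h k * (ieprod 2 m * ieprod 2 (k + m + k + 1)) =
        (h k * fps_X ^ (2 * k ^ 2 + 2 * k + 1)) * (fps_X ^ (2 * m * (m + (2 * k + 1))) * (ieprod 2 m * ieprod 2 (m + (2 * k + 1))))"
        by (simp only: power_add mult_ac)
    qed
    also have "\<dots> = (h k * fps_X ^ (2 * k ^ 2 + 2 * k + 1)) * inverse (E 2)"
    proof (subst fsum_mult)
      show "locally_finite (\<lambda>m. fps_X ^ (2 * m * (m + (2 * k + 1))) * (ieprod 2 m * ieprod 2 (m + (2 * k + 1))))"
        by (intro locally_finite_natI dvd_mult2 le_imp_power_dvd) (simp add: algebra_simps)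
    qed (simp only: durfee_rectangle)
    also have "h k * fps_X ^ (2 * k ^ 2 + 2 * k + 1) = (-1) ^ k * fps_X ^ (3 * k ^ 2 + 3 * k + 1) *
      ((1 + fps_X ^ (2 * k + 1)) * inverse (1 - fps_X ^ (2 * k + 1)))"
    proof -
      have "3 * k ^ 2 + 3 * k + 1 = k * (k + 1) + (2 * k ^ 2 + 2 * k + 1)" by (simp add: power2_eq_square algebra_simps)
      then show ?thesis by (simp only: h_def power_add mult_ac)
    qed
    finally show ?thesis by (simp only: mult.commute)
  qed
  have "fps_X ^ (2 * n ^ 2 + 2 * n + 1) * inverse (odd_prod 1 (Suc n)) ^ 2 = fsum (\<lambda>k. g n k)" for n
  proof -
    have "fsum (\<lambda>k. g n k) = (\<Sum>k\<le>n. g n k)"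
    proof (rule fps_ext)
      fix m
      show "fps_nth (fsum (\<lambda>k. g n k)) m = fps_nth (\<Sum>k\<le>n. g n k) m"
        unfolding fps_sum_nth by (rule fsum_nth_superset) (auto simp: g_def)
    qed
    then show ?thesis unfolding partial_fraction_odd_prod sum_distrib_left
      by (simp add: g_def h_def mult_ac)
  qed
  then have "omega_gf = fsum (\<lambda>n. fsum (\<lambda>k. g n k))" unfolding omega_gf_eq by simp
  also have "\<dots> = fsum (\<lambda>k. fsum (\<lambda>n. g n k))"
  proof (rule fsum_swap)
    fix m
    have "{(n, k). fps_nth (g n k) m \<noteq> 0} \<subseteq> {..m} \<times> {..m}"
    proof clarify
      fix n k assume nz: "fps_nth (g n k) m \<noteq> 0"
      have "n \<le> m" using dvd[of n k] nz unfolding X_power_dvd_iff by (meson not_le)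
      moreover have "k \<le> n" using nz by (auto simp: g_def split: if_splits)
      ultimately show "n \<in> {..m} \<and> k \<in> {..m}" by simp
    qed
    then show "finite {(n, k). fps_nth (g n k) m \<noteq> 0}" by (rule finite_subset) simp
  qed
  also have "\<dots> = fsum (\<lambda>k. inverse (E 2) * ((-1) ^ k * fps_X ^ (3 * k ^ 2 + 3 * k + 1) *
      ((1 + fps_X ^ (2 * k + 1)) * inverse (1 - fps_X ^ (2 * k + 1)))))"
    unfolding inner ..
  also have "fsum (\<lambda>k. inverse (E 2) * ((-1) ^ k * fps_X ^ (3 * k ^ 2 + 3 * k + 1) *
      ((1 + fps_X ^ (2 * k + 1)) * inverse (1 - fps_X ^ (2 * k + 1))))) = inverse (E 2) * fsum (\<lambda>k. (-1) ^ k * fps_X ^ (3 * k ^ 2 + 3 * k + 1) *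
      ((1 + fps_X ^ (2 * k + 1)) * inverse (1 - fps_X ^ (2 * k + 1))))" (is "_ = _ * ?R")
  proof (rule fsum_mult, rule locally_finite_natI)
    fix k
    have "fps_X ^ k dvd (fps_X :: complex fps) ^ (3 * k ^ 2 + 3 * k + 1)" by (rule le_imp_power_dvd) simp
    then show "fps_X ^ k dvd (-1) ^ k * (fps_X :: complex fps) ^ (3 * k ^ 2 + 3 * k + 1) *
      ((1 + fps_X ^ (2 * k + 1)) * inverse (1 - fps_X ^ (2 * k + 1)))" by (simp only: dvd_mult2 dvd_mult)
  qed
  finally have "omega_gf = inverse (E 2) * ?R" .
  then have "E 2 * omega_gf = (E 2 * inverse (E 2)) * ?R" by (simp only: mult.assoc)
  then show ?thesis by simp
qed

definition lerch :: "complex fps" where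
  "lerch = fsum (\<lambda>k. (-1) ^ k * fps_X ^ ((3 * k + 2) * (k + 1) div 2) * inverse (1 - fps_X ^ (2 * k + 1)))"

text \<open>With Y = q^(2k+1), write (1 + Y) / (1 - Y) as (1 + Y)^2 / (1 - Y^2), whose denominator
  is a series in q^2. The exponents of the prefactor and of Y are odd, so only the cross term 2Y of
  the numerator contributes to the even part.\<close>

lemma sect_2_omega_gf: "E 1 * sect 2 0 omega_gf = 2 * lerch"
proof -
  define t where "t k = (-1) ^ k * fps_X ^ (3 * k ^ 2 + 3 * k + 1) *
      ((1 + fps_X ^ (2 * k + 1)) * inverse (1 - fps_X ^ (2 * k + 1 :: nat) :: complex fps))" for k
  have sect_t: "sect 2 0 (t k) = 2 * ((-1) ^ k * fps_X ^ ((3 * k + 2) * (k + 1) div 2) * inverse (1 - fps_X ^ (2 * k + 1)))" for k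
  proof -
    define i where "i = inverse (1 - fps_X ^ (2 * k + 1) :: complex fps)"
    define Y where "Y = (fps_X :: complex fps) ^ (2 * k + 1)"
    have d: "dil 2 i = inverse (1 - fps_X ^ (2 * (2 * k + 1)))"
      unfolding i_def by (subst dil_inverse) (simp_all add: dil_diff dil_1 dil_X_power del: power_Suc)
    have Y2: "fps_X ^ (2 * (2 * k + 1)) = Y ^ 2" unfolding Y_def by (simp only: mult.commute flip: power_mult)
    have "dil 2 i * (1 - Y ^ 2) = 1" unfolding d Y2 by (rule inverse_mult_eq_1) (simp add: Y_def power2_eq_square)
    moreover have "i * (1 - Y) = 1" unfolding i_def Y_def by (rule inverse_mult_eq_1) simp
    ultimately have i: "(1 + Y) * i = (1 + Y) ^ 2 * dil 2 i" by algebra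
    have ev: "even (3 * k ^ 2 + 3 * k)" "even ((3 * k + 2) * (k + 1))" by auto
    define a b where "a = (3 * k ^ 2 + 3 * k) div 2" and "b = (3 * k + 2) * (k + 1) div 2"
    have e1: "3 * k ^ 2 + 3 * k + 1 = 2 * a + 1" using ev by (simp add: a_def)
    have e2: "2 * a + 1 + (2 * k + 1) = 2 * b"
    proof -
      have "2 * b = (3 * k + 2) * (k + 1)" using ev by (simp add: b_def)
      then show ?thesis unfolding e1[symmetric] by (simp add: power2_eq_square algebra_simps)
    qed
    have m1: "(-1) ^ k = dil 2 ((-1) ^ k :: complex fps)"
      by (cases "even k") (simp_all add: dil_1 dil_def fps_compose_uminus)
    have "t k = (-1) ^ k * fps_X ^ (2 * a + 1) * ((1 + Y) * i)"
      unfolding t_def e1 i_def Y_def ..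
    also note i
    also have "(1 + Y) ^ 2 = (1 + Y ^ 2) + 2 * Y" by (simp add: power2_eq_square algebra_simps)
    also have "(-1) ^ k * fps_X ^ (2 * a + 1) * ((1 + Y ^ 2 + 2 * Y) * dil 2 i) =
       fps_X ^ (2 * a + 1) * ((-1) ^ k * (1 + Y ^ 2) * dil 2 i) + (fps_X ^ (2 * a + 1) * Y) * ((-1) ^ k * 2 * dil 2 i)"
      by (simp only: ring_distribs mult_ac)
    also have "fps_X ^ (2 * a + 1) * Y = fps_X ^ (2 * b)" unfolding Y_def power_add[symmetric] e2 ..
    also have "Y ^ 2 = dil 2 (fps_X ^ (2 * k + 1))" 
      by (simp only: Y_def dil_X_power[OF zero_less_numeral] mult.commute[of 2 "2 * k + 1"] power_mult)
    finally have "t k = fps_X ^ (2 * a + 1) * dil 2 ((-1) ^ k * (1 + fps_X ^ (2 * k + 1)) * i) + fps_X ^ (2 * b) * dil 2 ((-1) ^ k * 2 * i)"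
      by (simp only: dil_mult[OF zero_less_numeral] dil_add[OF zero_less_numeral] dil_1[OF zero_less_numeral]
         dil_numeral[OF zero_less_numeral] m1[symmetric])
    note tk = this
    have "sect 2 0 (fps_X ^ (2 * a + 1) * dil 2 f) = 0" "sect 2 0 (fps_X ^ (2 * b) * dil 2 f) = fps_X ^ b * f"
      for f :: "complex fps"
      using sect_X_dil[of 2 0 "2 * a + 1" f] sect_X_dil[of 2 0 "2 * b" f] by simp_all
    then have "sect 2 0 (t k) = fps_X ^ b * ((-1) ^ k * 2 * i)"
      unfolding tk by (simp only: sect_add[OF zero_less_numeral] add_0)
    then show ?thesis unfolding b_def i_def by (simp only: mult_ac)
  qed
  have "sect 2 0 (E 2 * omega_gf) = sect 2 0 (omega_gf * dil 2 (E 1))" by (simp add: dil_E mult.commute)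
  also have "\<dots> = E 1 * sect 2 0 omega_gf" by (simp add: sect_mult_dil mult.commute)
  finally have "E 1 * sect 2 0 omega_gf = sect 2 0 (fsum t)" unfolding omega_gf_lerch t_def ..
  also have "\<dots> = fsum (\<lambda>k. sect 2 0 (t k))" by (rule sect_fsum)
  also have "\<dots> = fsum (\<lambda>k. 2 * ((-1) ^ k * fps_X ^ ((3 * k + 2) * (k + 1) div 2) * inverse (1 - fps_X ^ (2 * k + 1))))"
    unfolding sect_t ..
  also have "fsum (\<lambda>k. 2 * ((-1) ^ k * fps_X ^ ((3 * k + 2) * (k + 1) div 2) * inverse (1 - fps_X ^ (2 * k + 1)))) = 2 * lerch"
    unfolding lerch_def
  proof (rule fsum_mult, rule locally_finite_natI)
    fix k :: nat
    have "2 * k \<le> (3 * k + 2) * (k + 1)" by (simp add: algebra_simps)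
    then have "k \<le> (3 * k + 2) * (k + 1) div 2" by linarith
    then have "fps_X ^ k dvd (fps_X :: complex fps) ^ ((3 * k + 2) * (k + 1) div 2)" by (rule le_imp_power_dvd)
    then show "fps_X ^ k dvd (-1) ^ k * (fps_X :: complex fps) ^ ((3 * k + 2) * (k + 1) div 2) * inverse (1 - fps_X ^ (2 * k + 1))"
      by (simp only: dvd_mult2 dvd_mult)
  qed
  finally show ?thesis .
qed

section \<open>A partial fraction expansion\<close>

text \<open>The three-term relation replaces division by differences of poles. When a pole m is
  added, it splits \<open>c n i * c n m\<close>; the first halves extend the old residues, and the
  second halves add up, by the induction hypothesis at m, to the new one.\<close>

lemma partial_fractions:
  fixes c :: "'i \<Rightarrow> 'i \<Rightarrow> 'a::comm_ring_1"
  assumes rel: "\<And>i j n. i \<noteq> j \<Longrightarrow> i \<noteq> n \<Longrightarrow> j \<noteq> n \<Longrightarrow> c n i * c n j = c i j * c n i + c j i * c n j"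
    and "finite I" "I \<noteq> {}" "n \<notin> I"
  shows "(\<Prod>i\<in>I. c n i) = (\<Sum>i\<in>I. c n i * (\<Prod>j\<in>I - {i}. c i j))"
  using assms(2-)
proof (induction I arbitrary: n rule: finite_ne_induct)
  case (singleton x)
  then show ?case by simp
next
  case (insert m I)
  have IHn: "(\<Prod>i\<in>I. c n i) = (\<Sum>i\<in>I. c n i * (\<Prod>j\<in>I - {i}. c i j))"
    and IHm: "(\<Prod>i\<in>I. c m i) = (\<Sum>i\<in>I. c m i * (\<Prod>j\<in>I - {i}. c i j))"
    using insert by auto
  have "(\<Prod>i\<in>insert m I. c n i) = (\<Sum>i\<in>I. c n i * c n m * (\<Prod>j\<in>I - {i}. c i j))"
    using insert IHn by (simp add: sum_distrib_left mult_ac)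
  also have "\<dots> = (\<Sum>i\<in>I. (c i m * c n i + c m i * c n m) * (\<Prod>j\<in>I - {i}. c i j))"
  proof (intro sum.cong refl)
    fix i assume "i \<in> I"
    then have "c n i * c n m = c i m * c n i + c m i * c n m" using insert by (intro rel) auto
    then show "c n i * c n m * (\<Prod>j\<in>I - {i}. c i j) = (c i m * c n i + c m i * c n m) * (\<Prod>j\<in>I - {i}. c i j)"
      by simp
  qed
  also have "\<dots> = (\<Sum>i\<in>I. c n i * (c i m * (\<Prod>j\<in>I - {i}. c i j))) + c n m * (\<Prod>i\<in>I. c m i)"
    unfolding IHm by (simp add: sum.distrib sum_distrib_left algebra_simps)
  also have "(\<Sum>i\<in>I. c n i * (c i m * (\<Prod>j\<in>I - {i}. c i j))) = (\<Sum>i\<in>I. c n i * (\<Prod>j\<in>insert m I - {i}. c i j))"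
  proof (intro sum.cong refl arg_cong2[where f = "(*)"])
    fix i assume "i \<in> I"
    then have "insert m I - {i} = insert m (I - {i})" using insert by auto
    then show "c i m * (\<Prod>j\<in>I - {i}. c i j) = (\<Prod>j\<in>insert m I - {i}. c i j)" using insert by simp
  qed
  also have "\<dots> + c n m * (\<Prod>i\<in>I. c m i) = (\<Sum>i\<in>insert m I. c n i * (\<Prod>j\<in>insert m I - {i}. c i j))"
  proof -
    have "insert m I - {m} = I" using insert by auto
    then show ?thesis using insert by simp
  qed
  finally show ?case .
qed

text \<open>The pair \<open>(s, e)\<close> stands for the monomial \<open>x = \<plusminus> q ^ e\<close>, and \<open>pf_coeff\<close> for the coefficient
  \<open>x / ((x - y) (1 - x y))\<close> written as a power series.\<close>

definition sg :: "bool \<Rightarrow> complex fps" where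
  "sg s = (if s then 1 else -1)"

definition monomial :: "bool \<times> nat \<Rightarrow> complex fps" where
  "monomial p = sg (fst p) * fps_X ^ snd p"

definition pf_coeff :: "bool \<times> nat \<Rightarrow> bool \<times> nat \<Rightarrow> complex fps" where
  "pf_coeff p q = (if snd p \<le> snd q then 1 else - sg (fst p = fst q) * fps_X ^ (snd p - snd q)) *
     inverse ((1 - sg (fst p = fst q) * fps_X ^ ((snd p - snd q) + (snd q - snd p))) *
              (1 - sg (fst p = fst q) * fps_X ^ (snd p + snd q)))"

lemma sg_simps [simp]: "sg True = 1" "sg False = -1" "sg s * sg s = 1"
  by (simp_all add: sg_def)

lemma monomial_nonzero: "monomial p \<noteq> 0"
  by (simp add: monomial_def sg_def)

lemma coeff_monomial:
  assumes "p \<noteq> q"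
  shows "(monomial p - monomial q) * (1 - monomial p * monomial q) * pf_coeff p q = monomial p"
proof -
  obtain s e where p: "p = (s, e)" by (cases p)
  obtain t f where q: "q = (t, f)" by (cases q)
  define \<sigma> where "\<sigma> = sg (s = t)"
  have st: "sg t = \<sigma> * sg s" "sg s = \<sigma> * sg t" by (auto simp: \<sigma>_def sg_def)
  define D where "D = (1 - \<sigma> * fps_X ^ ((e - f) + (f - e))) * (1 - \<sigma> * fps_X ^ (e + f))"
  have "fps_nth (1 - \<sigma> * fps_X ^ ((e - f) + (f - e))) 0 \<noteq> 0" "fps_nth (1 - \<sigma> * fps_X ^ (e + f)) 0 \<noteq> 0"
    using assms by (auto simp: p q \<sigma>_def sg_def)
  then have D: "D * inverse D = 1" unfolding D_def by (intro inverse_mult_eq_1') simp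
  have x: "1 - monomial p * monomial q = 1 - \<sigma> * fps_X ^ (e + f)"
    by (simp add: monomial_def p q st(1) power_add mult_ac)
  show ?thesis
  proof (cases "e \<le> f")
    case True
    then have "(fps_X :: complex fps) ^ f = fps_X ^ e * fps_X ^ (f - e)" by (simp flip: power_add)
    then have "monomial p - monomial q = monomial p * (1 - \<sigma> * fps_X ^ ((e - f) + (f - e)))"
      using True by (simp add: monomial_def p q st(1) algebra_simps)
    then have "(monomial p - monomial q) * (1 - monomial p * monomial q) = monomial p * D" by (simp only: x D_def mult.assoc)
    moreover have "pf_coeff p q = inverse D" using True by (simp add: pf_coeff_def p q D_def \<sigma>_def)
    ultimately show ?thesis using D by (simp add: mult.assoc)
  next
    case False
    then have X: "(fps_X :: complex fps) ^ e = fps_X ^ f * fps_X ^ (e - f)" by (simp flip: power_add)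
    then have "monomial p - monomial q = - monomial q * (1 - \<sigma> * fps_X ^ ((e - f) + (f - e)))"
      using False by (simp add: monomial_def p q st(2) algebra_simps)
    then have "(monomial p - monomial q) * (1 - monomial p * monomial q) = - monomial q * D" by (simp only: x D_def mult.assoc)
    moreover have "pf_coeff p q = - \<sigma> * fps_X ^ (e - f) * inverse D" using False by (simp add: pf_coeff_def p q D_def \<sigma>_def)
    ultimately have "(monomial p - monomial q) * (1 - monomial p * monomial q) * pf_coeff p q = monomial q * \<sigma> * fps_X ^ (e - f) * (D * inverse D)"
      by (simp add: mult_ac)
    also have "\<dots> = monomial p" unfolding D by (simp add: monomial_def p q X st(2) mult_ac)
    finally show ?thesis .
  qed
qed

text \<open>Put t(x) = x + 1/x. Then x / ((x - y)(1 - x y)) is (1/y) / (t(y) - t(x)), so this is the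
  usual partial fraction relation in the variable t. Here it is checked after multiplying by the
  nonzero denominators.\<close>

lemma pf_coeff_relation:
  assumes "i \<noteq> j" "i \<noteq> n" "j \<noteq> n"
  shows "pf_coeff n i * pf_coeff n j = pf_coeff i j * pf_coeff n i + pf_coeff j i * pf_coeff n j"
proof -
  define x y z where "x = monomial i" and "y = monomial j" and "z = monomial n"
  have 1: "(z - x) * (1 - z * x) * pf_coeff n i = z" and 2: "(z - y) * (1 - z * y) * pf_coeff n j = z"
    and 3: "(x - y) * (1 - x * y) * pf_coeff i j = x" and 4: "(y - x) * (1 - y * x) * pf_coeff j i = y"
    using assms coeff_monomial by (auto simp: x_def y_def z_def)
  have nz: "(z - x) * (1 - z * x) \<noteq> 0" "(z - y) * (1 - z * y) \<noteq> 0" "(x - y) * (1 - x * y) \<noteq> 0"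
    using 1 2 3 monomial_nonzero by (metis mult_zero_left x_def z_def)+
  have "(pf_coeff n i * pf_coeff n j - (pf_coeff i j * pf_coeff n i + pf_coeff j i * pf_coeff n j)) *
     ((z - x) * (1 - z * x) * ((z - y) * (1 - z * y)) * ((x - y) * (1 - x * y))) = 0"
  proof -
    have "(pf_coeff n i * pf_coeff n j - (pf_coeff i j * pf_coeff n i + pf_coeff j i * pf_coeff n j)) *
       ((z - x) * (1 - z * x) * ((z - y) * (1 - z * y)) * ((x - y) * (1 - x * y))) =
       ((z - x) * (1 - z * x) * pf_coeff n i) * ((z - y) * (1 - z * y) * pf_coeff n j) * ((x - y) * (1 - x * y))
       - ((x - y) * (1 - x * y) * pf_coeff i j) * ((z - x) * (1 - z * x) * pf_coeff n i) * ((z - y) * (1 - z * y))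
       + ((y - x) * (1 - y * x) * pf_coeff j i) * ((z - y) * (1 - z * y) * pf_coeff n j) * ((z - x) * (1 - z * x))"
      by algebra
    also have "\<dots> = 0" unfolding 1 2 3 4 by algebra
    finally show ?thesis .
  qed
  then show ?thesis using nz by simp
qed

section \<open>The poles -q^(4i) and q^(2k+1)\<close>

abbreviation "pU i \<equiv> (False, 4 * i)"
abbreviation "pV k \<equiv> (True, 2 * k + 1)"

definition poles :: "nat \<Rightarrow> (bool \<times> nat) set" where
  "poles N = pU ` {..<N} \<union> pV ` {..<N}"

lemma prod_poles:
  "(\<Prod>p\<in>poles N. f p) = (\<Prod>i<N. f (pU i)) * (\<Prod>k<N. f (pV k))"
proof -
  have "inj_on pU {..<N}" "inj_on pV {..<N}" by (auto simp: inj_on_def)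
  then show ?thesis unfolding poles_def
    by (subst prod.union_disjoint) (auto simp: prod.reindex o_def)
qed

lemma sum_poles:
  "(\<Sum>p\<in>poles N. f p) = (\<Sum>i<N. f (pU i)) + (\<Sum>k<N. f (pV k))"
proof -
  have "inj_on pU {..<N}" "inj_on pV {..<N}" by (auto simp: inj_on_def)
  then show ?thesis unfolding poles_def
    by (subst sum.union_disjoint) (auto simp: sum.reindex o_def)
qed

lemma prod_poles_U:
  assumes "i < N"
  shows "(\<Prod>p\<in>poles N - {pU i}. f p) = (\<Prod>j\<in>{..<N} - {i}. f (pU j)) * (\<Prod>k<N. f (pV k))"
proof -
  have "poles N - {pU i} = pU ` ({..<N} - {i}) \<union> pV ` {..<N}" using assms by (auto simp: poles_def)
  moreover have "inj_on pU ({..<N} - {i})" "inj_on pV {..<N}" by (auto simp: inj_on_def)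
  ultimately show ?thesis
    by (subst \<open>poles N - {pU i} = _\<close>, subst prod.union_disjoint) (auto simp: prod.reindex o_def)
qed

lemma prod_poles_V:
  assumes "k < N"
  shows "(\<Prod>p\<in>poles N - {pV k}. f p) = (\<Prod>j<N. f (pU j)) * (\<Prod>j\<in>{..<N} - {k}. f (pV j))"
proof -
  have "poles N - {pV k} = pU ` {..<N} \<union> pV ` ({..<N} - {k})" using assms by (auto simp: poles_def)
  moreover have "inj_on pU {..<N}" "inj_on pV ({..<N} - {k})" by (auto simp: inj_on_def)
  ultimately show ?thesis
    by (subst \<open>poles N - {pV k} = _\<close>, subst prod.union_disjoint) (auto simp: prod.reindex o_def)
qed

text \<open>The base point \<open>(True, 0)\<close> is x = 1, where the coefficient towards y is 1 /
  (1 - y)^2. It is not a pole, since the only pole with exponent 0 is -1.\<close>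

lemma poles_partial_fractions:
  assumes "N > 0"
  shows "(\<Prod>i<N. pf_coeff (True, 0) (pU i)) * (\<Prod>k<N. pf_coeff (True, 0) (pV k)) =
    (\<Sum>i<N. pf_coeff (True, 0) (pU i) * (\<Prod>p\<in>poles N - {pU i}. pf_coeff (pU i) p)) +
    (\<Sum>k<N. pf_coeff (True, 0) (pV k) * (\<Prod>p\<in>poles N - {pV k}. pf_coeff (pV k) p))"
proof -
  have "(\<Prod>p\<in>poles N. pf_coeff (True, 0) p) = (\<Sum>p\<in>poles N. pf_coeff (True, 0) p * (\<Prod>q\<in>poles N - {p}. pf_coeff p q))"
    by (rule partial_fractions[OF pf_coeff_relation]) (use assms in \<open>auto simp: poles_def\<close>)
  then show ?thesis by (simp only: prod_poles sum_poles)
qed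

subsection \<open>Limits of the coefficients\<close>

text \<open>Both products are indexed by the distance from i, so that the factors on either side of
  a pole become standard q-products.\<close>

lemma prod_skip:
  fixes f :: "nat \<Rightarrow> 'a::comm_monoid_mult"
  shows "(\<Prod>j\<in>{..<Suc i + n} - {i}. f j) = (\<Prod>t<i. f (i - Suc t)) * (\<Prod>t<n. f (Suc i + t))"
proof -
  have eq: "{..<Suc i + n} - {i} = {..<i} \<union> (+) (Suc i) ` {..<n}"
  proof (intro equalityI subsetI)
    fix j assume j: "j \<in> {..<Suc i + n} - {i}"
    show "j \<in> {..<i} \<union> (+) (Suc i) ` {..<n}"
    proof (cases "j < i")
      case False
      then have "j = Suc i + (j - Suc i)" "j - Suc i < n" using j by auto
      then show ?thesis by blast
    qed simp
  qed auto
  have "{..<i} \<inter> (+) (Suc i) ` {..<n} = {}" by auto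
  then have "(\<Prod>j\<in>{..<Suc i + n} - {i}. f j) = (\<Prod>j<i. f j) * (\<Prod>j\<in>(+) (Suc i) ` {..<n}. f j)"
    unfolding eq by (intro prod.union_disjoint finite_lessThan finite_imageI)
  also have "(\<Prod>j\<in>(+) (Suc i) ` {..<n}. f j) = (\<Prod>t<n. f (Suc i + t))"
    by (subst prod.reindex) (simp_all add: inj_on_def)
  also have "(\<Prod>j<i. f j) = (\<Prod>t<i. f (i - Suc t))"
    by (rule prod.nat_diff_reindex[symmetric])
  finally show ?thesis .
qed

lemma prod_split:
  fixes f :: "nat \<Rightarrow> 'a::comm_monoid_mult"
  shows "(\<Prod>j<i + n. f j) = (\<Prod>t<i. f (i - Suc t)) * (\<Prod>t<n. f (i + t))"
proof -
  have "(\<Prod>j<i + n. f j) = (\<Prod>j<i. f j) * (\<Prod>t<n. f (i + t))"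
    by (induction n) (simp_all add: mult.assoc)
  then show ?thesis by (simp only: prod.nat_diff_reindex)
qed

lemma prod_inverse_fps: "(\<Prod>i\<in>A. inverse (f i)) = inverse (\<Prod>i\<in>A. f i :: complex fps)"
  by (induction A rule: infinite_finite_induct) (auto simp: fps_inverse_mult)

lemma prod_power_X: "(\<Prod>t<n. (fps_X :: complex fps) ^ f t) = fps_X ^ (\<Sum>t<n. f t)"
  by (simp add: power_sum)

lemma prod_neg_power_X: "(\<Prod>t<n. - ((fps_X :: complex fps) ^ f t)) = (-1) ^ n * fps_X ^ (\<Sum>t<n. f t)"
  by (induction n) (simp_all add: power_add mult_ac)

lemma prod_neg_X_inverse:
  "(\<Prod>t<n. - ((fps_X :: complex fps) ^ f t) * inverse (g t * h t)) =
     (-1) ^ n * fps_X ^ (\<Sum>t<n. f t) * inverse ((\<Prod>t<n. g t) * (\<Prod>t<n. h t))"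
  by (simp only: prod.distrib prod_inverse_fps prod_neg_power_X)

definition progr :: "nat \<Rightarrow> nat \<Rightarrow> complex fps" where
  "progr r n = (\<Prod>t<n. 1 + fps_X ^ (4 * t + r))"

lemma fps_prod_convergent:
  fixes f :: "nat \<Rightarrow> 'a::idom fps"
  assumes "\<And>n. fps_X ^ Suc n dvd f n - 1"
  shows "\<exists>L. (\<lambda>N. \<Prod>n<N. f n) \<longlonglongrightarrow> L"
proof -
  define P where "P N = (\<Prod>n<N. f n)" for N
  have step: "fps_nth (P (Suc N)) m = fps_nth (P N) m" if "m \<le> N" for m N
  proof -
    have "P (Suc N) - P N = (f N - 1) * P N" by (simp add: P_def algebra_simps)
    then have "fps_X ^ Suc N dvd P (Suc N) - P N" using assms[of N] by (simp only: dvd_mult2)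
    then show ?thesis using that unfolding X_power_dvd_iff by auto
  qed
  have stable: "fps_nth (P N) m = fps_nth (P m) m" if "m \<le> N" for m N
    using that by (induction N rule: dec_induct) (simp_all add: step)
  have "P \<longlonglongrightarrow> Abs_fps (\<lambda>m. fps_nth (P m) m)"
  proof (rule tendsto_fpsI)
    fix m
    show "eventually (\<lambda>N. fps_nth (P N) m = fps_nth (Abs_fps (\<lambda>m. fps_nth (P m) m)) m) sequentially"
      using eventually_ge_at_top[of m] by eventually_elim (unfold fps_nth_Abs_fps, rule stable)
  qed
  then show ?thesis unfolding P_def by blast
qed

lemma progr_convergent: "r > 0 \<Longrightarrow> \<exists>L. progr r \<longlonglongrightarrow> L"
  unfolding progr_def[abs_def]
  by (rule fps_prod_convergent) (simp only: add_diff_cancel_left', rule le_imp_power_dvd, simp)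

lemma progr_1_3: "progr 1 n * progr 3 n = odd_plus_prod 1 (2 * n)"
  by (induction n) (simp_all add: progr_def odd_plus_prod_def numeral_3_eq_3 mult_ac)

lemma odd_plus_prod_nth_0 [simp]: "c > 0 \<Longrightarrow> fps_nth (odd_plus_prod c n) 0 = 1"
  by (induction n) (simp_all add: odd_plus_prod_def)

lemma sum_4t: "(\<Sum>t<n. 4 * (t + 1)) = 2 * n * (n + 1)" "(\<Sum>t<n. 2 * (t + 1)) = n * (n + 1)"
    "(\<Sum>t<n. 2 * t + 1) = n ^ 2" for n :: nat
  by (induction n) (auto simp: power2_eq_square)

lemma sum_4t_1: "(\<Sum>t<n. 4 * t + 1) = n * (2 * n - 1)" "(\<Sum>t<n. 4 * t + 3) = n * (2 * n + 1)" for n :: nat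
proof -
  show "(\<Sum>t<n. 4 * t + 3) = n * (2 * n + 1)" by (induction n) auto
  have "(\<Sum>t<n. 4 * t + 1) + n = 2 * n * n" by (induction n) auto
  then show "(\<Sum>t<n. 4 * t + 1) = n * (2 * n - 1)" by (cases n) (auto simp: algebra_simps)
qed

text \<open>For i > 0 this is (1 - q^(8i)) / (1 - q^(4i)), which completes the product over exponent
  sums in \<open>prod_cc_UU\<close>. At i = 0 that product is empty, so the weight is 1 and not
  2.\<close>

definition weight_U :: "nat \<Rightarrow> complex fps" where
  "weight_U i = (if i = 0 then 1 else 1 + fps_X ^ (4 * i))"

section \<open>Finite products of coefficients at a single pole\<close>

lemma prod_cc_UU:
  "(\<Prod>j\<in>{..<Suc i + n} - {i}. pf_coeff (pU i) (pU j)) =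
     (-1) ^ i * fps_X ^ (2 * i * (i + 1)) * (weight_U i * (ieprod 4 n * ieprod 4 (2 * i + n)))"
proof -
  define W where "W = (\<Prod>t<i. 1 - fps_X ^ (4 * (2 * i - Suc t)) :: complex fps)"
  define Z where "Z = (\<Prod>t<n. 1 - fps_X ^ (4 * (2 * i + t + 1)) :: complex fps)"
  have c1: "pf_coeff (pU i) (pU (i - Suc t)) = - (fps_X ^ (4 * (t + 1))) * inverse ((1 - fps_X ^ (4 * (t + 1))) * (1 - fps_X ^ (4 * (2 * i - Suc t))))"
    if "t < i" for t
  proof -
    have "4 * i - 4 * (i - Suc t) = 4 * (t + 1)" "4 * (i - Suc t) - 4 * i = 0" "4 * i + 4 * (i - Suc t) = 4 * (2 * i - Suc t)"
      "\<not> 4 * i \<le> 4 * (i - Suc t)" using that by auto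
    then show ?thesis unfolding pf_coeff_def by (simp add: add_ac)
  qed
  have "(\<Prod>t<i. pf_coeff (pU i) (pU (i - Suc t))) =
      (\<Prod>t<i. - (fps_X ^ (4 * (t + 1))) * inverse ((1 - fps_X ^ (4 * (t + 1))) * (1 - fps_X ^ (4 * (2 * i - Suc t)))))"
    by (rule prod.cong[OF refl], rule c1) simp
  then have 1: "(\<Prod>t<i. pf_coeff (pU i) (pU (i - Suc t))) = ((-1) ^ i * fps_X ^ (2 * i * (i + 1))) * inverse (eprod 4 i * W)"
    unfolding prod_neg_X_inverse sum_4t eprod_def W_def .
  have "pf_coeff (pU i) (pU (Suc i + t)) = inverse ((1 - fps_X ^ (4 * (t + 1))) * (1 - fps_X ^ (4 * (2 * i + t + 1))))" for t
  proof -
    have "4 * (Suc i + t) - 4 * i = 4 * (t + 1)" "4 * i - 4 * (Suc i + t) = 0" "4 * i + 4 * (Suc i + t) = 4 * (2 * i + t + 1)"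
      "4 * i \<le> 4 * (Suc i + t)" by auto
    then show ?thesis unfolding pf_coeff_def by (simp add: add_ac)
  qed
  then have 2: "(\<Prod>t<n. pf_coeff (pU i) (pU (Suc i + t))) = inverse (eprod 4 n * Z)"
    by (simp add: prod.distrib prod_inverse_fps eprod_def Z_def)
  have Z: "eprod 4 (2 * i) * Z = eprod 4 (2 * i + n)"
    unfolding Z_def by (induction n) (simp_all add: eprod_Suc mult.assoc[symmetric])
  have W: "W * weight_U i * eprod 4 i = eprod 4 (2 * i)"
  proof (cases "i = 0")
    case False
    define Y where "Y = (\<Prod>s<i. 1 - fps_X ^ (4 * (i + s + 1)) :: complex fps)"
    have Y: "eprod 4 i * Y = eprod 4 (2 * i)"
    proof -
      have "eprod 4 i * (\<Prod>s<m. 1 - fps_X ^ (4 * (i + s + 1))) = eprod 4 (i + m)" for m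
        by (induction m) (simp_all add: eprod_Suc mult.assoc[symmetric])
      from this[of i] show ?thesis by (simp add: Y_def mult_2)
    qed
    have "W = (\<Prod>t<i. 1 - fps_X ^ (4 * (i + (i - Suc t))))" unfolding W_def by (intro prod.cong refl) auto
    then have "W = (\<Prod>s<i. 1 - fps_X ^ (4 * (i + s)))"
      using prod.nat_diff_reindex[of "\<lambda>s. 1 - fps_X ^ (4 * (i + s))" i] by simp
    then have "W * (1 - fps_X ^ (4 * (i + i))) = (\<Prod>s<Suc i. 1 - fps_X ^ (4 * (i + s)))" by simp
    also have "\<dots> = (1 - fps_X ^ (4 * i)) * Y" by (subst prod.lessThan_Suc_shift) (simp add: Y_def)
    finally have d1: "W * (1 - fps_X ^ (4 * (i + i))) = (1 - fps_X ^ (4 * i)) * Y" .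
    have d2: "1 - fps_X ^ (4 * (i + i)) = (1 - fps_X ^ (4 * i)) * (1 + fps_X ^ (4 * i) :: complex fps)"
    proof -
      have "4 * (i + i) = 4 * i + 4 * i" by simp
      then show ?thesis by (simp only: power_add) (simp add: algebra_simps)
    qed
    have "(1 - fps_X ^ (4 * i)) * (W * (1 + fps_X ^ (4 * i))) = (1 - fps_X ^ (4 * i)) * Y"
      using d1[unfolded d2] by (simp only: mult_ac)
    moreover have "fps_nth (1 - fps_X ^ (4 * i) :: complex fps) 0 = 1" using False by simp
    then have "1 - fps_X ^ (4 * i) \<noteq> (0 :: complex fps)" by force
    ultimately have "W * (1 + fps_X ^ (4 * i)) = Y" by simp
    then show ?thesis using Y False by (simp add: weight_U_def mult.commute)
  qed (simp add: W_def weight_U_def)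
  have "eprod 4 i * W * (eprod 4 n * Z) * weight_U i = eprod 4 n * eprod 4 (2 * i + n)"
    unfolding Z[symmetric] W[symmetric] by (simp only: mult_ac)
  then have "inverse (eprod 4 i * W) * inverse (eprod 4 n * Z) = weight_U i * (ieprod 4 n * ieprod 4 (2 * i + n))"
  proof -
    define D where "D = eprod 4 i * W * (eprod 4 n * Z)"
    have e: "D * weight_U i = eprod 4 n * eprod 4 (2 * i + n)" unfolding D_def by fact
    have "(eprod 4 n * eprod 4 (2 * i + n)) * (ieprod 4 n * ieprod 4 (2 * i + n)) =
      (eprod 4 n * ieprod 4 n) * (eprod 4 (2 * i + n) * ieprod 4 (2 * i + n))"
      by (simp only: mult_ac)
    then have "D * (weight_U i * (ieprod 4 n * ieprod 4 (2 * i + n))) = 1"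
      unfolding mult.assoc[symmetric] e by simp
    then have "inverse D = weight_U i * (ieprod 4 n * ieprod 4 (2 * i + n))"
      by (rule fps_inverse_unique)
    then show ?thesis unfolding D_def fps_inverse_mult .
  qed
  then show ?thesis unfolding prod_skip 1 2 by (simp only: mult.assoc)
qed

lemma prod_cc_UV:
  "(\<Prod>k<2 * i + n. pf_coeff (pU i) (pV k)) =
     fps_X ^ (4 * i ^ 2) * inverse (odd_plus_prod 1 n * odd_plus_prod 1 (2 * i + (2 * i + n)))"
proof -
  have d: "pf_coeff (pU i) (pV k) = (if 4 * i \<le> 2 * k + 1 then 1 else fps_X ^ (4 * i - (2 * k + 1))) *
     inverse (1 + fps_X ^ ((4 * i - (2 * k + 1)) + (2 * k + 1 - 4 * i))) * inverse (1 + fps_X ^ (4 * i + (2 * k + 1)))" for k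
    unfolding pf_coeff_def by (simp add: fps_inverse_mult mult.assoc del: power_Suc)
  have 1: "(\<Prod>k<2 * i + n. (if 4 * i \<le> 2 * k + 1 then 1 else (fps_X :: complex fps) ^ (4 * i - (2 * k + 1)))) = fps_X ^ (4 * i ^ 2)"
  proof -
    have "(if 4 * i \<le> 2 * (2 * i - Suc t) + 1 then 1 else (fps_X :: complex fps) ^ (4 * i - (2 * (2 * i - Suc t) + 1))) = fps_X ^ (2 * t + 1)"
      if "t < 2 * i" for t
    proof -
      have "4 * i - (2 * (2 * i - Suc t) + 1) = 2 * t + 1" "\<not> 4 * i \<le> 2 * (2 * i - Suc t) + 1" using that by auto
      then show ?thesis by simp
    qed
    then show ?thesis unfolding prod_split by (simp add: prod_power_X sum_4t(3)[simplified] power_mult_distrib del: power_Suc)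
  qed
  have 2: "(\<Prod>k<2 * i + n. 1 + (fps_X :: complex fps) ^ ((4 * i - (2 * k + 1)) + (2 * k + 1 - 4 * i))) = odd_plus_prod 1 (2 * i) * odd_plus_prod 1 n"
  proof -
    have "(4 * i - (2 * (2 * i - Suc t) + 1)) + (2 * (2 * i - Suc t) + 1 - 4 * i) = 2 * t + 1" if "t < 2 * i" for t
      using that by auto
    moreover have "(4 * i - (2 * (2 * i + t) + 1)) + (2 * (2 * i + t) + 1 - 4 * i) = 2 * t + 1" for t by auto
    ultimately show ?thesis unfolding prod_split by (simp add: odd_plus_prod_def del: power_Suc)
  qed
  have 3: "odd_plus_prod 1 (2 * i) * (\<Prod>k<m. 1 + fps_X ^ (4 * i + (2 * k + 1))) = odd_plus_prod 1 (2 * i + m)" for m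
    by (induction m) (simp_all add: odd_plus_prod_def mult.assoc[symmetric])
  have "(\<Prod>k<2 * i + n. pf_coeff (pU i) (pV k)) = fps_X ^ (4 * i ^ 2) * inverse (odd_plus_prod 1 (2 * i) * odd_plus_prod 1 n)
     * inverse (\<Prod>k<2 * i + n. 1 + fps_X ^ (4 * i + (2 * k + 1)))"
    unfolding d prod.distrib prod_inverse_fps 1 2 ..
  also have "\<dots> = fps_X ^ (4 * i ^ 2) * inverse (odd_plus_prod 1 n * (odd_plus_prod 1 (2 * i) * (\<Prod>k<2 * i + n. 1 + fps_X ^ (4 * i + (2 * k + 1)))))"
    by (simp only: fps_inverse_mult mult_ac)
  finally show ?thesis unfolding 3 .
qed

text \<open>The distances to the smaller poles and the exponent sums 2 (k + j + 1) together fill up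
  (q^2; q^2)_(2k+1+n), except for the sum at j = k itself; this is the factor with exponent 2 (2k +
  1).\<close>

lemma prod_cc_VV:
  "(\<Prod>j\<in>{..<Suc k + n} - {k}. pf_coeff (pV k) (pV j)) =
     (-1) ^ k * fps_X ^ (k * (k + 1)) * ((1 - fps_X ^ (2 * (2 * k + 1))) * (ieprod 2 n * ieprod 2 (2 * k + 1 + n)))"
proof -
  define W where "W = (\<Prod>t<k. 1 - fps_X ^ (2 * (2 * k - t)) :: complex fps)"
  define Z where "Z = (\<Prod>t<n. 1 - fps_X ^ (2 * (2 * k + 1 + t + 1)) :: complex fps)"
  have c1: "pf_coeff (pV k) (pV (k - Suc t)) = - (fps_X ^ (2 * (t + 1))) * inverse ((1 - fps_X ^ (2 * (t + 1))) * (1 - fps_X ^ (2 * (2 * k - t))))"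
    if "t < k" for t
  proof -
    have "2 * k + 1 - (2 * (k - Suc t) + 1) = 2 * (t + 1)" "2 * (k - Suc t) + 1 - (2 * k + 1) = 0"
      "2 * k + 1 + (2 * (k - Suc t) + 1) = 2 * (2 * k - t)" "\<not> 2 * k + 1 \<le> 2 * (k - Suc t) + 1" using that by auto
    then show ?thesis unfolding pf_coeff_def by (simp add: add_ac)
  qed
  have "(\<Prod>t<k. pf_coeff (pV k) (pV (k - Suc t))) =
      (\<Prod>t<k. - (fps_X ^ (2 * (t + 1))) * inverse ((1 - fps_X ^ (2 * (t + 1))) * (1 - fps_X ^ (2 * (2 * k - t)))))"
    by (rule prod.cong[OF refl], rule c1) simp
  then have 1: "(\<Prod>t<k. pf_coeff (pV k) (pV (k - Suc t))) = ((-1) ^ k * fps_X ^ (k * (k + 1))) * inverse (eprod 2 k * W)"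
    unfolding prod_neg_X_inverse sum_4t eprod_def W_def .
  have "pf_coeff (pV k) (pV (Suc k + t)) = inverse ((1 - fps_X ^ (2 * (t + 1))) * (1 - fps_X ^ (2 * (2 * k + 1 + t + 1))))" for t
  proof -
    have "2 * (Suc k + t) + 1 - (2 * k + 1) = 2 * (t + 1)" "2 * k + 1 - (2 * (Suc k + t) + 1) = 0"
      "2 * k + 1 + (2 * (Suc k + t) + 1) = 2 * (2 * k + 1 + t + 1)" "2 * k + 1 \<le> 2 * (Suc k + t) + 1" by auto
    then show ?thesis unfolding pf_coeff_def by (simp add: add_ac)
  qed
  then have 2: "(\<Prod>t<n. pf_coeff (pV k) (pV (Suc k + t))) = inverse (eprod 2 n * Z)"
    by (simp add: prod.distrib prod_inverse_fps eprod_def Z_def)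
  have Z: "eprod 2 (2 * k + 1) * Z = eprod 2 (2 * k + 1 + n)"
    unfolding Z_def by (induction n) (simp_all add: eprod_Suc mult.assoc[symmetric])
  have W: "eprod 2 k * W = eprod 2 (2 * k)"
  proof -
    have "eprod 2 k * (\<Prod>s<m. 1 - fps_X ^ (2 * (k + s + 1))) = eprod 2 (k + m)" for m
      by (induction m) (simp_all add: eprod_Suc mult.assoc[symmetric])
    from this[of k] have "eprod 2 k * (\<Prod>s<k. 1 - fps_X ^ (2 * (k + s + 1))) = eprod 2 (2 * k)" by (simp add: mult_2)
    moreover have "W = (\<Prod>s<k. 1 - fps_X ^ (2 * (k + (k - Suc s) + 1)))"
      unfolding W_def
    proof (rule prod.cong[OF refl])
      fix t assume "t \<in> {..<k}"
      then have "k + (k - Suc t) + 1 = 2 * k - t" by auto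
      then show "1 - fps_X ^ (2 * (2 * k - t)) = (1 - fps_X ^ (2 * (k + (k - Suc t) + 1)) :: complex fps)" by (simp only:)
    qed
    then have "W = (\<Prod>s<k. 1 - fps_X ^ (2 * (k + s + 1)))"
      using prod.nat_diff_reindex[of "\<lambda>s. 1 - fps_X ^ (2 * (k + s + 1))" k] by simp
    ultimately show ?thesis by simp
  qed
  have "eprod 2 (2 * k + 1 + n) = (1 - fps_X ^ (2 * (2 * k + 1))) * (eprod 2 (2 * k) * Z)"
    unfolding Z[symmetric] using eprod_Suc[of 2 "2 * k"] by (simp add: mult_ac)
  then have "ieprod 2 (2 * k + 1 + n) = inverse (1 - fps_X ^ (2 * (2 * k + 1))) * inverse (eprod 2 (2 * k) * Z)"
    by (simp only: ieprod_def fps_inverse_mult)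
  then have "(1 - fps_X ^ (2 * (2 * k + 1))) * ieprod 2 (2 * k + 1 + n) = inverse (eprod 2 (2 * k) * Z)"
    by (simp add: inverse_mult_eq_1' flip: mult.assoc)
  then have "inverse (eprod 2 k * W) * inverse (eprod 2 n * Z) = (1 - fps_X ^ (2 * (2 * k + 1))) * (ieprod 2 n * ieprod 2 (2 * k + 1 + n))"
    unfolding W by (simp add: fps_inverse_mult ieprod_def mult_ac)
  then show ?thesis unfolding prod_skip 1 2 by (simp only: mult.assoc)
qed

text \<open>The distances from 2k + 1 to the multiples of 4 are congruent to \<open>r\<close>
  downwards and to \<open>r'\<close> = 4 - \<open>r\<close> upwards, so two progressions modulo 4
  appear. The factor 1 + q^(2k+1) stands apart because at j = 0 the distance and the exponent sum
  coincide.\<close>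

lemma prod_cc_VU:
  assumes "r = 1 \<and> r' = 3 \<or> r = 3 \<and> r' = 1" "2 * k + 1 = 4 * l + r"
  shows "(\<Prod>j<Suc l + n. pf_coeff (pV k) (pU j)) =
     fps_X ^ (\<Sum>t<Suc l. 4 * t + r) * inverse ((1 + fps_X ^ (2 * k + 1)) * (progr r' n * progr r (l + (Suc l + n))))"
proof -
  have r: "r > 0" "r < 4" "r + r' = 4" using assms by auto
  have d: "pf_coeff (pV k) (pU j) = (if 4 * l + r \<le> 4 * j then 1 else fps_X ^ (4 * l + r - 4 * j)) *
     inverse (1 + fps_X ^ ((4 * l + r - 4 * j) + (4 * j - (4 * l + r)))) * inverse (1 + fps_X ^ (4 * l + r + 4 * j))" for j
    unfolding pf_coeff_def assms(2) by (simp add: fps_inverse_mult mult.assoc del: power_Suc)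
  have 1: "(\<Prod>j<Suc l + n. (if 4 * l + r \<le> 4 * j then 1 else (fps_X :: complex fps) ^ (4 * l + r - 4 * j))) = fps_X ^ (\<Sum>t<Suc l. 4 * t + r)"
  proof -
    have "(if 4 * l + r \<le> 4 * (Suc l - Suc t) then 1 else (fps_X :: complex fps) ^ (4 * l + r - 4 * (Suc l - Suc t))) = fps_X ^ (4 * t + r)"
      if "t < Suc l" for t
    proof -
      have "4 * l + r - 4 * (Suc l - Suc t) = 4 * t + r" "\<not> 4 * l + r \<le> 4 * (Suc l - Suc t)" using that r by auto
      then show ?thesis by simp
    qed
    moreover have "4 * l + r \<le> 4 * (Suc l + t)" for t using r by auto
    ultimately show ?thesis unfolding prod_split by (simp add: prod_power_X del: power_Suc prod.lessThan_Suc sum.lessThan_Suc)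
  qed
  have 2: "(\<Prod>j<Suc l + n. 1 + (fps_X :: complex fps) ^ ((4 * l + r - 4 * j) + (4 * j - (4 * l + r)))) = progr r (Suc l) * progr r' n"
  proof -
    have e1: "(4 * l + r - 4 * (Suc l - Suc t)) + (4 * (Suc l - Suc t) - (4 * l + r)) = 4 * t + r" if "t < Suc l" for t
      using that by auto
    have e2: "(4 * l + r - 4 * (Suc l + t)) + (4 * (Suc l + t) - (4 * l + r)) = 4 * t + r'" for t using r by auto
    show ?thesis
      unfolding prod_split progr_def e2
      by (intro arg_cong2[where f = "(*)"] prod.cong refl) (simp only: lessThan_iff e1)
  qed
  have 3: "progr r l * (\<Prod>j<m. 1 + fps_X ^ (4 * l + r + 4 * j)) = progr r (l + m)" for m
    by (induction m) (simp_all add: progr_def algebra_simps)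
  have 4: "progr r (Suc l) = (1 + fps_X ^ (2 * k + 1)) * progr r l"
    unfolding progr_def prod.lessThan_Suc assms(2) by (rule mult.commute)
  have "(\<Prod>j<Suc l + n. pf_coeff (pV k) (pU j)) = fps_X ^ (\<Sum>t<Suc l. 4 * t + r) * inverse (progr r (Suc l) * progr r' n)
     * inverse (\<Prod>j<Suc l + n. 1 + fps_X ^ (4 * l + r + 4 * j))"
    unfolding d prod.distrib prod_inverse_fps 1 2 ..
  also have "\<dots> = fps_X ^ (\<Sum>t<Suc l. 4 * t + r) * inverse ((1 + fps_X ^ (2 * k + 1)) * (progr r' n *
      (progr r l * (\<Prod>j<Suc l + n. 1 + fps_X ^ (4 * l + r + 4 * j)))))"
    unfolding 4 by (simp only: fps_inverse_mult mult_ac)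
  finally show ?thesis unfolding 3 .
qed

lemma filterlim_nat_at_top:
  fixes g :: "nat \<Rightarrow> nat"
  assumes "\<And>N. N \<le> g N + d"
  shows "filterlim g at_top sequentially"
  unfolding filterlim_at_top
proof
  fix Z
  show "eventually (\<lambda>N. Z \<le> g N) sequentially"
    using eventually_ge_at_top[of "Z + d"]
  proof eventually_elim
    case (elim N)
    then show ?case using assms[of N] by linarith
  qed
qed

definition odd_plus_lim :: "complex fps" where
  "odd_plus_lim = E 2 * inverse (E 4) * inverse (E 1 * inverse (E 2))"

lemma odd_plus_prod_tendsto_lim: "odd_plus_prod 1 \<longlonglongrightarrow> odd_plus_lim"
  using odd_plus_prod_tendsto[of 1] by (simp add: odd_plus_lim_def)

lemma odd_plus_lim_E: "odd_plus_lim * (E 1 * E 4) = E 2 ^ 2"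
  using odd_plus_limit[of 1] by (simp add: odd_plus_lim_def)

lemma odd_plus_lim_nth_0 [simp]: "fps_nth odd_plus_lim 0 = 1"
  by (rule fps_nth_0_tendsto[OF odd_plus_prod_tendsto_lim]) simp

section \<open>Passage to infinitely many poles\<close>

definition coeff_U :: "nat \<Rightarrow> complex fps" where
  "coeff_U i = (-1) ^ i * fps_X ^ (6 * i ^ 2 + 2 * i) * weight_U i *
     (inverse (E 4) ^ 2 * inverse odd_plus_lim ^ 2)"

definition coeff_V :: "nat \<Rightarrow> complex fps" where
  "coeff_V k = (-1) ^ k * fps_X ^ ((3 * k + 2) * (k + 1) div 2) * (1 - fps_X ^ (2 * k + 1)) *
     (inverse (E 2) ^ 2 * inverse odd_plus_lim)"

lemma prod_poles_U_tendsto: "(\<lambda>N. \<Prod>p\<in>poles (Suc N) - {pU i}. pf_coeff (pU i) p) \<longlonglongrightarrow> coeff_U i"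
proof (rule Lim_transform_eventually)
  define f where "f N = ((-1) ^ i * fps_X ^ (2 * i * (i + 1)) * (weight_U i * (ieprod 4 (N - i) * ieprod 4 (2 * i + (N - i))))) *
     (fps_X ^ (4 * i ^ 2) * inverse (odd_plus_prod 1 (Suc N - 2 * i) * odd_plus_prod 1 (2 * i + (2 * i + (Suc N - 2 * i)))))" for N
  show "eventually (\<lambda>N. f N = (\<Prod>p\<in>poles (Suc N) - {pU i}. pf_coeff (pU i) p)) sequentially"
    using eventually_ge_at_top[of "2 * i"]
  proof eventually_elim
    case (elim N)
    have 1: "(\<Prod>j\<in>{..<Suc N} - {i}. pf_coeff (pU i) (pU j)) = (-1) ^ i * fps_X ^ (2 * i * (i + 1)) *
       (weight_U i * (ieprod 4 (N - i) * ieprod 4 (2 * i + (N - i))))"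
      using prod_cc_UU[of i "N - i"] elim by simp
    have "2 * i + (Suc N - 2 * i) = Suc N" using elim by simp
    then have 2: "(\<Prod>k<Suc N. pf_coeff (pU i) (pV k)) = fps_X ^ (4 * i ^ 2) *
       inverse (odd_plus_prod 1 (Suc N - 2 * i) * odd_plus_prod 1 (2 * i + (2 * i + (Suc N - 2 * i))))"
      using prod_cc_UV[of i "Suc N - 2 * i"] by (simp only:)
    have "i < Suc N" using elim by simp
    then show ?case unfolding f_def by (simp only: prod_poles_U 1 2)
  qed
  have "f \<longlonglongrightarrow> ((-1) ^ i * fps_X ^ (2 * i * (i + 1)) * (weight_U i * (inverse (E 4) * inverse (E 4)))) *
     (fps_X ^ (4 * i ^ 2) * inverse (odd_plus_lim * odd_plus_lim))"
    unfolding f_def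
  proof (intro fps_tendsto_mult tendsto_const fps_tendsto_inverse)
    show "(\<lambda>N. ieprod 4 (N - i)) \<longlonglongrightarrow> inverse (E 4)"
      by (rule filterlim_compose[OF ieprod_tendsto filterlim_nat_at_top[where d = i]]) auto
    show "(\<lambda>N. ieprod 4 (2 * i + (N - i))) \<longlonglongrightarrow> inverse (E 4)"
      by (rule filterlim_compose[OF ieprod_tendsto filterlim_nat_at_top[where d = i]]) auto
    show "(\<lambda>N. odd_plus_prod 1 (Suc N - 2 * i)) \<longlonglongrightarrow> odd_plus_lim"
      by (rule filterlim_compose[OF odd_plus_prod_tendsto_lim filterlim_nat_at_top[where d = "2 * i"]]) auto
    show "(\<lambda>N. odd_plus_prod 1 (2 * i + (2 * i + (Suc N - 2 * i)))) \<longlonglongrightarrow> odd_plus_lim"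
      by (rule filterlim_compose[OF odd_plus_prod_tendsto_lim filterlim_nat_at_top[where d = "2 * i"]]) auto
  qed simp
  also have "((-1) ^ i * fps_X ^ (2 * i * (i + 1)) * (weight_U i * (inverse (E 4) * inverse (E 4)))) *
     (fps_X ^ (4 * i ^ 2) * inverse (odd_plus_lim * odd_plus_lim)) = coeff_U i"
  proof -
    have "6 * i ^ 2 + 2 * i = 2 * i * (i + 1) + 4 * i ^ 2" by (simp add: power2_eq_square algebra_simps)
    then show ?thesis by (simp only: coeff_U_def power_add fps_inverse_mult power2_eq_square[of "inverse _"] mult_ac)
  qed
  finally show "f \<longlonglongrightarrow> coeff_U i" .
qed

lemma prod_poles_V_tendsto: "(\<lambda>N. \<Prod>p\<in>poles (Suc N) - {pV k}. pf_coeff (pV k) p) \<longlonglongrightarrow> coeff_V k"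
proof (rule Lim_transform_eventually)
  define l where "l = k div 2"
  define r r' :: nat where "r = (if even k then 1 else 3)" and "r' = (if even k then 3 else 1)"
  have r: "r = 1 \<and> r' = 3 \<or> r = 3 \<and> r' = 1" by (auto simp: r_def r'_def)
  have k: "2 * k + 1 = 4 * l + r"
    by (cases "even k") (auto simp: l_def r_def elim!: evenE oddE)
  have sum: "(\<Sum>t<Suc l. 4 * t + r) + k * (k + 1) = (3 * k + 2) * (k + 1) div 2"
  proof (cases "even k")
    case True
    then have "k = 2 * l" by (simp add: l_def)
    moreover have "r = 1" using True by (simp add: r_def)
    ultimately show ?thesis unfolding \<open>r = 1\<close> sum_4t_1 by (simp add: algebra_simps)
  next
    case False
    then have "k = 2 * l + 1" by (simp add: l_def)
    moreover have "r = 3" using False by (simp add: r_def)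
    ultimately show ?thesis unfolding \<open>r = 3\<close> sum_4t_1 by (simp add: algebra_simps)
  qed
  \<comment> \<open>Only the product of the two limits enters. It is the full product over odd
    exponents, whichever of 1 and 3 is \<open>r\<close>.\<close>
  obtain L L' where L: "progr r \<longlonglongrightarrow> L" "progr r' \<longlonglongrightarrow> L'"
    using progr_convergent[of r] progr_convergent[of r'] r by auto
  have LL: "L' * L = odd_plus_lim"
  proof -
    have "(\<lambda>n. progr r' n * progr r n) \<longlonglongrightarrow> L' * L" by (intro fps_tendsto_mult L)
    moreover have "progr r' n * progr r n = odd_plus_prod 1 (2 * n)" for n
      using r progr_1_3[of n] by (auto simp: mult.commute)
    moreover have "(\<lambda>n. odd_plus_prod 1 (2 * n)) \<longlonglongrightarrow> odd_plus_lim"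
      by (rule filterlim_compose[OF odd_plus_prod_tendsto_lim mult_at_top]) simp
    ultimately show ?thesis using LIMSEQ_unique by fastforce
  qed
  define f where "f N = (fps_X ^ (\<Sum>t<Suc l. 4 * t + r) * inverse ((1 + fps_X ^ (2 * k + 1)) * (progr r' (N - l) * progr r (l + (Suc l + (N - l)))))) *
     ((-1) ^ k * fps_X ^ (k * (k + 1)) * ((1 - fps_X ^ (2 * (2 * k + 1))) * (ieprod 2 (N - k) * ieprod 2 (2 * k + 1 + (N - k)))))" for N
  show "eventually (\<lambda>N. f N = (\<Prod>p\<in>poles (Suc N) - {pV k}. pf_coeff (pV k) p)) sequentially"
    using eventually_ge_at_top[of k]
  proof eventually_elim
    case (elim N)
    have lk: "l \<le> k" by (simp add: l_def)
    then have "Suc l + (N - l) = Suc N" using elim by simp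
    then have 1: "(\<Prod>j<Suc N. pf_coeff (pV k) (pU j)) =
      fps_X ^ (\<Sum>t<Suc l. 4 * t + r) * inverse ((1 + fps_X ^ (2 * k + 1)) * (progr r' (N - l) * progr r (l + (Suc l + (N - l)))))"
      using prod_cc_VU[OF r k, of "N - l"] by (simp only:)
    have 2: "(\<Prod>j\<in>{..<Suc N} - {k}. pf_coeff (pV k) (pV j)) =
      (-1) ^ k * fps_X ^ (k * (k + 1)) * ((1 - fps_X ^ (2 * (2 * k + 1))) * (ieprod 2 (N - k) * ieprod 2 (2 * k + 1 + (N - k))))"
    proof -
      have "Suc k + (N - k) = Suc N" using elim by simp
      then show ?thesis using prod_cc_VV[of k "N - k"] by (simp only:)
    qed
    have "k < Suc N" using elim by simp
    then show ?case unfolding f_def by (simp only: prod_poles_V 1 2)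
  qed
  have "f \<longlonglongrightarrow> (fps_X ^ (\<Sum>t<Suc l. 4 * t + r) * inverse ((1 + fps_X ^ (2 * k + 1)) * (L' * L))) *
     ((-1) ^ k * fps_X ^ (k * (k + 1)) * ((1 - fps_X ^ (2 * (2 * k + 1))) * (inverse (E 2) * inverse (E 2))))"
    unfolding f_def
  proof (intro fps_tendsto_mult tendsto_const fps_tendsto_inverse)
    show "(\<lambda>N. progr r' (N - l)) \<longlonglongrightarrow> L'"
      by (rule filterlim_compose[OF L(2) filterlim_nat_at_top[where d = l]]) auto
    show "(\<lambda>N. progr r (l + (Suc l + (N - l)))) \<longlonglongrightarrow> L"
      by (rule filterlim_compose[OF L(1) filterlim_nat_at_top[where d = l]]) auto
    show "(\<lambda>N. ieprod 2 (N - k)) \<longlonglongrightarrow> inverse (E 2)"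
      by (rule filterlim_compose[OF ieprod_tendsto filterlim_nat_at_top[where d = k]]) auto
    show "(\<lambda>N. ieprod 2 (2 * k + 1 + (N - k))) \<longlonglongrightarrow> inverse (E 2)"
      by (rule filterlim_compose[OF ieprod_tendsto filterlim_nat_at_top[where d = k]]) auto
    show "fps_nth ((1 + fps_X ^ (2 * k + 1)) * (L' * L)) 0 \<noteq> 0" unfolding LL by simp
  qed
  also have "(fps_X ^ (\<Sum>t<Suc l. 4 * t + r) * inverse ((1 + fps_X ^ (2 * k + 1)) * (L' * L))) *
     ((-1) ^ k * fps_X ^ (k * (k + 1)) * ((1 - fps_X ^ (2 * (2 * k + 1))) * (inverse (E 2) * inverse (E 2)))) = coeff_V k"
  proof -
    \<comment> \<open>(1 - y^2) / (1 + y) leaves 1 - y. This later cancels half of the double pole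
      in \<open>pf_coeff_base\<close> and leaves the simple denominators of
      \<open>lerch\<close>.\<close>
    define y where "y = (fps_X :: complex fps) ^ (2 * k + 1)"
    have y: "1 - fps_X ^ (2 * (2 * k + 1)) = (1 + y) * (1 - y)"
      unfolding y_def one_plus_times_one_minus ..
    have i: "inverse (1 + y) * (1 + y) = 1" by (rule inverse_mult_eq_1) (simp add: y_def)
    have "inverse ((1 + y) * odd_plus_lim) * (1 + y) = (inverse (1 + y) * (1 + y)) * inverse odd_plus_lim"
      by (simp only: fps_inverse_mult mult_ac)
    then have i2: "inverse ((1 + y) * odd_plus_lim) * (1 + y) = inverse odd_plus_lim" unfolding i by simp
    have "(fps_X ^ (\<Sum>t<Suc l. 4 * t + r) * inverse ((1 + y) * odd_plus_lim)) *
       ((-1) ^ k * fps_X ^ (k * (k + 1)) * ((1 + y) * (1 - y) * (inverse (E 2) * inverse (E 2)))) =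
       (-1) ^ k * (fps_X ^ (\<Sum>t<Suc l. 4 * t + r) * fps_X ^ (k * (k + 1))) * (1 - y) *
       (inverse (E 2) * inverse (E 2) * (inverse ((1 + y) * odd_plus_lim) * (1 + y)))"
      by (simp only: mult_ac)
    then show ?thesis
      unfolding LL y y_def[symmetric] i2 power_add[symmetric] sum by (simp add: coeff_V_def y_def power2_eq_square)
  qed
  finally show "f \<longlonglongrightarrow> coeff_V k" .
qed

text \<open>The single coefficient towards the pole -1 already has this divisor. It is the bound,
  uniform in \<open>N\<close>, that \<open>tendsto_fsum\<close> requires.\<close>

lemma poles_0_dvd:
  assumes "p \<noteq> pU 0" "snd p \<noteq> 0"
  shows "fps_X ^ snd p dvd (\<Prod>q\<in>poles (Suc N) - {p}. pf_coeff p q)"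
proof -
  have "pU 0 \<in> poles (Suc N) - {p}" using assms by (auto simp: poles_def)
  moreover have "finite (poles (Suc N) - {p})" by (simp add: poles_def)
  ultimately have "pf_coeff p (pU 0) dvd (\<Prod>q\<in>poles (Suc N) - {p}. pf_coeff p q)" by (intro dvd_prodI)
  moreover have "fps_X ^ snd p dvd pf_coeff p (pU 0)"
    using assms(2) by (simp add: pf_coeff_def del: minus_mult_left)
  ultimately show ?thesis by (rule dvd_trans[rotated])
qed

lemma pf_coeff_base: "pf_coeff (True, 0) (pU i) = inverse ((1 + fps_X ^ (4 * i)) * (1 + fps_X ^ (4 * i)))"
    "pf_coeff (True, 0) (pV k) = inverse ((1 - fps_X ^ (2 * k + 1)) * (1 - fps_X ^ (2 * k + 1)))"
  by (simp_all add: pf_coeff_def)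

definition phi_sum :: "complex fps" where
  "phi_sum = fsum (\<lambda>i. (-1) ^ i * fps_X ^ (6 * i ^ 2 + 2 * i) * weight_U i *
     inverse ((1 + fps_X ^ (4 * i)) * (1 + fps_X ^ (4 * i))))"

lemma partial_fraction_identity:
  "inverse ((2 * (E 8 * inverse (E 4))) ^ 2) * inverse ((E 1 * inverse (E 2)) ^ 2) =
     phi_sum * (inverse (E 4) ^ 2 * inverse odd_plus_lim ^ 2) + lerch * (inverse (E 2) ^ 2 * inverse odd_plus_lim)"
proof -
  let ?b = "(True, 0) :: bool \<times> nat"
  define LHS where "LHS N = (\<Prod>i<N. pf_coeff ?b (pU i)) * (\<Prod>k<N. pf_coeff ?b (pV k))" for N
  have "(\<Prod>i<Suc N. pf_coeff ?b (pU i)) = inverse ((2 * plus_prod 4 N) ^ 2)" for N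
  proof -
    have "(\<Prod>i<Suc N. 1 + fps_X ^ (4 * i)) = 2 * plus_prod 4 N"
      by (subst prod.lessThan_Suc_shift) (simp add: plus_prod_def)
    then show ?thesis unfolding pf_coeff_base prod_inverse_fps prod.distrib by (simp only: power2_eq_square)
  qed
  moreover have "(\<Prod>k<N. pf_coeff ?b (pV k)) = inverse (odd_prod 1 N ^ 2)" for N
    unfolding pf_coeff_base prod_inverse_fps prod.distrib by (simp add: odd_prod_def power2_eq_square)
  ultimately have "LHS (Suc N) = inverse ((2 * plus_prod 4 N) ^ 2) * inverse (odd_prod 1 (Suc N) ^ 2)" for N
    by (simp only: LHS_def)
  moreover have "(\<lambda>N. inverse ((2 * plus_prod 4 N) ^ 2) * inverse (odd_prod 1 (Suc N) ^ 2)) \<longlonglongrightarrow>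
      inverse ((2 * (E 8 * inverse (E 4))) ^ 2) * inverse ((E 1 * inverse (E 2)) ^ 2)"
  proof (intro fps_tendsto_mult fps_tendsto_inverse fps_tendsto_power tendsto_const)
    show "plus_prod 4 \<longlonglongrightarrow> E 8 * inverse (E 4)" using plus_prod_tendsto[of 4] by simp
    show "(\<lambda>N. odd_prod 1 (Suc N)) \<longlonglongrightarrow> E 1 * inverse (E 2)"
      using LIMSEQ_Suc[OF odd_prod_tendsto[of 1]] by simp
  qed (simp_all add: power2_eq_square)
  ultimately have L: "(\<lambda>N. LHS (Suc N)) \<longlonglongrightarrow> inverse ((2 * (E 8 * inverse (E 4))) ^ 2) * inverse ((E 1 * inverse (E 2)) ^ 2)"
    by simp
  have U: "(\<lambda>N. \<Sum>i<Suc N. pf_coeff ?b (pU i) * (\<Prod>p\<in>poles (Suc N) - {pU i}. pf_coeff (pU i) p)) \<longlonglongrightarrow> fsum (\<lambda>i. pf_coeff ?b (pU i) * coeff_U i)"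
  proof (rule tendsto_fsum[where e = "\<lambda>i. i"])
    show "(\<lambda>N. pf_coeff ?b (pU i) * (\<Prod>p\<in>poles (Suc N) - {pU i}. pf_coeff (pU i) p)) \<longlonglongrightarrow> pf_coeff ?b (pU i) * coeff_U i" for i
      by (intro fps_tendsto_mult tendsto_const prod_poles_U_tendsto)
    show "fps_X ^ i dvd pf_coeff ?b (pU i) * (\<Prod>p\<in>poles (Suc N) - {pU i}. pf_coeff (pU i) p)" for N i
    proof (cases "i = 0")
      case False
      then have "fps_X ^ (4 * i) dvd (\<Prod>p\<in>poles (Suc N) - {pU i}. pf_coeff (pU i) p)"
        using poles_0_dvd[of "pU i" N] by simp
      then have "fps_X ^ i dvd (\<Prod>p\<in>poles (Suc N) - {pU i}. pf_coeff (pU i) p)" by (rule X_power_dvdI) simp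
      then show ?thesis by (rule dvd_mult)
    qed simp
    show "eventually (\<lambda>N. i \<in> {..<Suc N}) sequentially" for i
      using eventually_ge_at_top[of i] by eventually_elim simp
  qed auto
  have V: "(\<lambda>N. \<Sum>k<Suc N. pf_coeff ?b (pV k) * (\<Prod>p\<in>poles (Suc N) - {pV k}. pf_coeff (pV k) p)) \<longlonglongrightarrow> fsum (\<lambda>k. pf_coeff ?b (pV k) * coeff_V k)"
  proof (rule tendsto_fsum[where e = "\<lambda>i. i"])
    show "(\<lambda>N. pf_coeff ?b (pV i) * (\<Prod>p\<in>poles (Suc N) - {pV i}. pf_coeff (pV i) p)) \<longlonglongrightarrow> pf_coeff ?b (pV i) * coeff_V i" for i
      by (intro fps_tendsto_mult tendsto_const prod_poles_V_tendsto)
    show "fps_X ^ i dvd pf_coeff ?b (pV i) * (\<Prod>p\<in>poles (Suc N) - {pV i}. pf_coeff (pV i) p)" for N i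
    proof -
      have "fps_X ^ (2 * i + 1) dvd (\<Prod>p\<in>poles (Suc N) - {pV i}. pf_coeff (pV i) p)"
        using poles_0_dvd[of "pV i" N] by simp
      then have "fps_X ^ i dvd (\<Prod>p\<in>poles (Suc N) - {pV i}. pf_coeff (pV i) p)" by (rule X_power_dvdI) simp
      then show ?thesis by (rule dvd_mult)
    qed
    show "eventually (\<lambda>N. i \<in> {..<Suc N}) sequentially" for i
      using eventually_ge_at_top[of i] by eventually_elim simp
  qed auto
  have "LHS (Suc N) = (\<Sum>i<Suc N. pf_coeff ?b (pU i) * (\<Prod>p\<in>poles (Suc N) - {pU i}. pf_coeff (pU i) p)) +
      (\<Sum>k<Suc N. pf_coeff ?b (pV k) * (\<Prod>p\<in>poles (Suc N) - {pV k}. pf_coeff (pV k) p))" for N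
    unfolding LHS_def by (rule poles_partial_fractions) simp
  with fps_tendsto_add[OF U V] have "(\<lambda>N. LHS (Suc N)) \<longlonglongrightarrow> fsum (\<lambda>i. pf_coeff ?b (pU i) * coeff_U i) + fsum (\<lambda>k. pf_coeff ?b (pV k) * coeff_V k)"
    by (simp only:)
  from LIMSEQ_unique[OF L this]
  have "inverse ((2 * (E 8 * inverse (E 4))) ^ 2) * inverse ((E 1 * inverse (E 2)) ^ 2) =
     fsum (\<lambda>i. pf_coeff ?b (pU i) * coeff_U i) + fsum (\<lambda>k. pf_coeff ?b (pV k) * coeff_V k)" .
  also have "fsum (\<lambda>i. pf_coeff ?b (pU i) * coeff_U i) = (inverse (E 4) ^ 2 * inverse odd_plus_lim ^ 2) * phi_sum"
    unfolding phi_sum_def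
  proof (subst fsum_mult[symmetric])
    show "locally_finite (\<lambda>i. (-1) ^ i * fps_X ^ (6 * i ^ 2 + 2 * i) * weight_U i *
     inverse ((1 + fps_X ^ (4 * i)) * (1 + fps_X ^ (4 * i))))"
    proof (rule locally_finite_natI)
      fix i :: nat
      have "fps_X ^ i dvd (fps_X :: complex fps) ^ (6 * i ^ 2 + 2 * i)" by (rule le_imp_power_dvd) simp
      then show "fps_X ^ i dvd (-1) ^ i * (fps_X :: complex fps) ^ (6 * i ^ 2 + 2 * i) * weight_U i *
         inverse ((1 + fps_X ^ (4 * i)) * (1 + fps_X ^ (4 * i)))" by (simp only: dvd_mult2 dvd_mult)
    qed
    show "fsum (\<lambda>i. pf_coeff ?b (pU i) * coeff_U i) = fsum (\<lambda>i. inverse (E 4) ^ 2 * inverse odd_plus_lim ^ 2 *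
       ((-1) ^ i * fps_X ^ (6 * i ^ 2 + 2 * i) * weight_U i * inverse ((1 + fps_X ^ (4 * i)) * (1 + fps_X ^ (4 * i)))))"
      unfolding pf_coeff_base coeff_U_def by (simp only: mult_ac)
  qed
  also have "fsum (\<lambda>k. pf_coeff ?b (pV k) * coeff_V k) = (inverse (E 2) ^ 2 * inverse odd_plus_lim) * lerch"
    unfolding lerch_def
  proof (subst fsum_mult[symmetric])
    show "locally_finite (\<lambda>k. (-1) ^ k * fps_X ^ ((3 * k + 2) * (k + 1) div 2) * inverse (1 - fps_X ^ (2 * k + 1) :: complex fps))"
    proof (rule locally_finite_natI)
      fix k :: nat
      have "2 * k \<le> (3 * k + 2) * (k + 1)" by (simp add: algebra_simps)
      then have "k \<le> (3 * k + 2) * (k + 1) div 2" by linarith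
      then have "fps_X ^ k dvd (fps_X :: complex fps) ^ ((3 * k + 2) * (k + 1) div 2)" by (rule le_imp_power_dvd)
      then show "fps_X ^ k dvd (-1) ^ k * (fps_X :: complex fps) ^ ((3 * k + 2) * (k + 1) div 2) * inverse (1 - fps_X ^ (2 * k + 1))"
        by (simp only: dvd_mult2 dvd_mult)
    qed
    have "pf_coeff ?b (pV k) * coeff_V k = inverse (E 2) ^ 2 * inverse odd_plus_lim *
       ((-1) ^ k * fps_X ^ ((3 * k + 2) * (k + 1) div 2) * inverse (1 - fps_X ^ (2 * k + 1)))" for k
    proof -
      define y where "y = (1 - fps_X ^ (2 * k + 1) :: complex fps)"
      have "inverse y * y = 1" by (rule inverse_mult_eq_1) (simp add: y_def)
      then have "inverse (y * y) * y = inverse y" by (simp add: fps_inverse_mult mult.assoc)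
      moreover have "inverse (y * y) * ((-1) ^ k * fps_X ^ ((3 * k + 2) * (k + 1) div 2) * y * (inverse (E 2) ^ 2 * inverse odd_plus_lim)) =
        inverse (E 2) ^ 2 * inverse odd_plus_lim * ((-1) ^ k * fps_X ^ ((3 * k + 2) * (k + 1) div 2) * (inverse (y * y) * y))"
        by (simp only: mult_ac)
      ultimately show ?thesis unfolding pf_coeff_base coeff_V_def y_def by simp
    qed
    then show "fsum (\<lambda>k. pf_coeff ?b (pV k) * coeff_V k) = fsum (\<lambda>k. inverse (E 2) ^ 2 * inverse odd_plus_lim *
       ((-1) ^ k * fps_X ^ ((3 * k + 2) * (k + 1) div 2) * inverse (1 - fps_X ^ (2 * k + 1))))" by simp
  qed
  finally show ?thesis by (simp only: mult.commute)
qed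

section \<open>The sections of the generating function\<close>

text \<open>The exponents 6 i^2 + 2i and 4i are all multiples of 4. The series is never evaluated;
  this property is enough to remove it by taking sections.\<close>

lemma phi_sum_dil: "\<exists>f. phi_sum = dil 4 f"
proof -
  have "(-1) ^ i * fps_X ^ (6 * i ^ 2 + 2 * i) * weight_U i * inverse ((1 + fps_X ^ (4 * i)) * (1 + fps_X ^ (4 * i))) =
    dil 4 ((-1) ^ i * fps_X ^ (i * (3 * i + 1) div 2) * (if i = 0 then 1 else 1 + fps_X ^ i) *
      inverse ((1 + fps_X ^ i) * (1 + fps_X ^ i) :: complex fps))" for i
  proof -
    have exp: "4 * (i * (3 * i + 1) div 2) = 6 * i ^ 2 + 2 * i"
    proof -
      have "even (i * (3 * i + 1))" by auto
      then have "4 * (i * (3 * i + 1) div 2) = 2 * (i * (3 * i + 1))" by (elim evenE) simp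
      then show ?thesis by (simp only: power2_eq_square algebra_simps)
    qed
    have "dil 4 (-1 :: complex fps) = -1" using dil_diff[of 4 0 1] by (simp add: dil_def)
    then have "dil 4 ((-1) ^ i :: complex fps) = (-1) ^ i" by (simp add: dil_power)
    moreover have "dil 4 (if i = 0 then 1 else 1 + fps_X ^ i) = weight_U i"
      by (simp add: weight_U_def dil_add dil_1 dil_X_power)
    moreover have "dil 4 (inverse ((1 + fps_X ^ i) * (1 + fps_X ^ i) :: complex fps)) =
        inverse ((1 + fps_X ^ (4 * i)) * (1 + fps_X ^ (4 * i)))"
      by (subst dil_inverse) (simp_all add: dil_mult dil_add dil_1 dil_X_power)
    ultimately show ?thesis by (simp only: dil_mult[OF zero_less_numeral] dil_X_power[OF zero_less_numeral] exp)
  qed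
  then show ?thesis unfolding phi_sum_def by (auto simp: dil_fsum[symmetric])
qed

text \<open>Substitute E_2^2 / (E_1 E_4) for \<open>odd_plus_lim\<close> and half of E_1 times the
  even section for the Lerch sum, then clear denominators.\<close>

lemma section_identity_4:
  "E 8 ^ 2 * E 1 ^ 4 * (4 * (phi_sum * inverse (E 4)) + 2 * sect 2 0 omega_gf) = E 4 * E 2 ^ 6"
proof -
  define S where "S = sect 2 0 omega_gf"
  define i2 i4 w u v where "i2 = inverse (E 2)" and "i4 = inverse (E 4)" and "w = inverse odd_plus_lim"
    and "u = inverse ((2 * (E 8 * i4)) ^ 2)" and "v = inverse ((E 1 * i2) ^ 2)"
  have u: "u * (2 * (E 8 * i4)) ^ 2 = 1" and v: "v * (E 1 * i2) ^ 2 = 1"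
    unfolding u_def v_def by (rule inverse_mult_eq_1; simp add: i2_def i4_def fps_nth_power_0)+
  have i: "i2 * E 2 = 1" "i4 * E 4 = 1" by (simp_all add: i2_def i4_def)
  have "w * odd_plus_lim = 1" unfolding w_def by (rule inverse_mult_eq_1) simp
  then have w: "w = E 1 * E 4 * i2 ^ 2" using odd_plus_lim_E i by algebra
  have L: "2 * lerch = E 1 * S" unfolding S_def by (rule sect_2_omega_gf[symmetric])
  have "u * v = phi_sum * (i4 ^ 2 * w ^ 2) + lerch * (i2 ^ 2 * w)"
    unfolding u_def v_def i2_def i4_def w_def by (rule partial_fraction_identity)
  then have "(2 * (E 8 * i4)) ^ 2 * (E 1 * i2) ^ 2 * (phi_sum * (i4 ^ 2 * w ^ 2) + lerch * (i2 ^ 2 * w)) = 1"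
    using u v by algebra
  then show ?thesis unfolding S_def[symmetric] i4_def[symmetric] using i w L by algebra
qed

definition omega_8_4 :: "complex fps" where
  "omega_8_4 = sect 2 1 (sect 2 0 (sect 2 0 omega_gf))"

text \<open>Each section is prepared by a factor that makes everything but a power of phi(q)^2 a
  series in q^2; then \<open>phi_squared\<close> supplies the two halves.\<close>

lemma omega_8_4_eq: "omega_8_4 = 4 * (E 2 ^ 10 * inverse (E 1) ^ 9)"
proof -
  let ?phi = "theta 1 1 1" and ?psi = "theta 1 1 3" and ?phim = "theta (-1) 1 1"
  define S S2 where "S = sect 2 0 omega_gf" and "S2 = sect 2 0 S"
  obtain f where f: "phi_sum = dil 4 f" using phi_sum_dil by blast
  define \<Psi> where "\<Psi> = f * inverse (E 1)"
  have \<Psi>: "phi_sum * inverse (E 4) = dil 2 (dil 2 \<Psi>)"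
    by (simp add: \<Psi>_def f dil_mult dil_inverse dil_E dil_dil)
  have phi1: "?phi * (E 1 ^ 2 * E 4 ^ 2) = E 2 ^ 5" by (rule theta_phi)
  have phi2: "dil 2 ?phi * (E 2 ^ 2 * E 8 ^ 2) = E 4 ^ 5"
    using arg_cong[OF theta_phi, of "dil 2"] by (simp add: dil_mult dil_power dil_E)
  have cancel: "g = h" if "g * k = h * k" "k \<noteq> 0" for g h k :: "complex fps" using that by simp
  have phi_sq: "?phi ^ 2 = dil 2 (?phi ^ 2) + fps_X * dil 2 (4 * dil 2 ?psi ^ 2)"
  proof -
    have "dil 2 (4 * dil 2 ?psi ^ 2) = 4 * dil 4 ?psi ^ 2" by (simp add: dil_mult dil_power dil_dil dil_numeral)
    moreover have "dil 2 (?phi ^ 2) = dil 2 ?phi ^ 2" by (rule dil_power) simp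
    ultimately show ?thesis using phi_squared by (simp only: mult_ac)
  qed
  have sect_odd: "sect 2 0 (dil 2 g + fps_X * dil 2 h) = g" "sect 2 1 (dil 2 g + fps_X * dil 2 h) = h" for g h :: "complex fps"
    using sect_dil_sum[of 0 2 "\<lambda>i. if i = 0 then g else h"] sect_dil_sum[of 1 2 "\<lambda>i. if i = 0 then g else h"]
    by (simp_all add: numeral_2_eq_2)
  \<comment> \<open>The eta quotient E_4 E_2^8 / (E_8^2 E_1^4) is phi(q)^2 phi(q^2), in which
    phi(q^2) passes through the even section.\<close>
  have "(4 * dil 2 (dil 2 \<Psi>) + 2 * S) * dil 2 (E 1 ^ 2) = ?phi ^ 2 * dil 2 ?phi"
  proof (rule cancel)
    show "(4 * dil 2 (dil 2 \<Psi>) + 2 * S) * dil 2 (E 1 ^ 2) * (E 1 ^ 4 * E 8 ^ 2 * E 2 ^ 2 * E 4 ^ 4)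
       = ?phi ^ 2 * dil 2 ?phi * (E 1 ^ 4 * E 8 ^ 2 * E 2 ^ 2 * E 4 ^ 4)"
    proof -
      have d: "dil 2 (E 1 ^ 2) = E 2 ^ 2" by (simp add: dil_power dil_E)
      have "(4 * dil 2 (dil 2 \<Psi>) + 2 * S) * (E 8 ^ 2 * E 1 ^ 4) = E 4 * E 2 ^ 6"
        using section_identity_4 unfolding \<Psi> S_def by (simp only: mult_ac)
      then show ?thesis unfolding d using phi1 phi2 by algebra
    qed
  qed simp
  moreover have "sect 2 0 ((4 * dil 2 (dil 2 \<Psi>) + 2 * S) * dil 2 (E 1 ^ 2)) = (4 * dil 2 \<Psi> + 2 * S2) * E 1 ^ 2"
  proof -
    have "sect 2 0 (4 * dil 2 (dil 2 \<Psi>) + 2 * S) = 4 * dil 2 \<Psi> + 2 * S2"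
      unfolding S2_def by (rule fps_ext) (simp add: sect_def dil_nth numeral_fps_const)
    then show ?thesis by (simp add: sect_mult_dil)
  qed
  moreover have "sect 2 0 (?phi ^ 2 * dil 2 ?phi) = ?phi ^ 2 * ?phi"
    using arg_cong[OF phi_sq, of "sect 2 0"] unfolding sect_odd by (subst sect_mult_dil) simp_all
  ultimately have 2: "(4 * dil 2 \<Psi> + 2 * S2) * E 1 ^ 2 = ?phi ^ 3" by (simp add: power3_eq_cube power2_eq_square)
  have phim1: "?phim * E 2 = E 1 ^ 2" by (rule theta_phi_minus)
  \<comment> \<open>E_1^2 is phi(-q) E_2, and multiplying by phi(q) turns phi(q) phi(-q) into
    phi(-q^2)^2. The cofactor is thereby a series in q^2, and the right side becomes a fourth
    power.\<close>
  have "(4 * dil 2 \<Psi> + 2 * S2) * dil 2 (?phim ^ 2 * E 1) = (?phi ^ 2) ^ 2"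
  proof -
    have "dil 2 (?phim ^ 2 * E 1) = dil 2 ?phim ^ 2 * E 2" by (simp add: dil_mult dil_power dil_E)
    then show ?thesis using 2 phim1 phi_phi_minus by algebra
  qed
  also have "\<dots> = dil 2 (?phi ^ 4 + fps_X * (4 * dil 2 ?psi ^ 2) ^ 2) + fps_X * dil 2 (2 * ?phi ^ 2 * (4 * dil 2 ?psi ^ 2))"
  proof -
    have "dil 2 (?phi ^ 4 + fps_X * (4 * dil 2 ?psi ^ 2) ^ 2) = dil 2 (?phi ^ 2) ^ 2 + fps_X ^ 2 * dil 2 (4 * dil 2 ?psi ^ 2) ^ 2"
      by (simp only: dil_add dil_mult[OF zero_less_numeral] dil_power[OF zero_less_numeral] dil_X[OF zero_less_numeral]
        flip: power_mult) simp
    moreover have "dil 2 (2 * ?phi ^ 2 * (4 * dil 2 ?psi ^ 2)) = 2 * dil 2 (?phi ^ 2) * dil 2 (4 * dil 2 ?psi ^ 2)"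
      by (simp only: dil_mult[OF zero_less_numeral] dil_numeral[OF zero_less_numeral])
    ultimately show ?thesis using phi_sq by algebra
  qed
  finally have "sect 2 1 ((4 * dil 2 \<Psi> + 2 * S2) * dil 2 (?phim ^ 2 * E 1)) = 2 * ?phi ^ 2 * (4 * dil 2 ?psi ^ 2)"
    by (simp only: sect_odd)
  moreover have "sect 2 1 ((4 * dil 2 \<Psi> + 2 * S2) * dil 2 (?phim ^ 2 * E 1)) = 2 * omega_8_4 * (?phim ^ 2 * E 1)"
  proof -
    \<comment> \<open>The odd section removes the unknown series, which by now has only even
      powers.\<close>
    have "sect 2 1 (4 * dil 2 \<Psi> + 2 * S2) = 2 * omega_8_4"
      unfolding S2_def S_def omega_8_4_def by (rule fps_ext) (simp add: sect_def dil_nth numeral_fps_const)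
    then show ?thesis by (simp add: sect_mult_dil)
  qed
  ultimately have "2 * (omega_8_4 * (?phim ^ 2 * E 1)) = 2 * (4 * ?psi ^ 4)" using phi_psi_mult by algebra
  then have 3: "omega_8_4 * (?phim ^ 2 * E 1) = 4 * ?psi ^ 4"
    by (simp only: mult_cancel_left) simp
  have "?psi * E 1 = E 2 ^ 2" by (rule theta_psi)
  with 3 phim1 have "omega_8_4 * E 1 ^ 9 = 4 * E 2 ^ 10" by algebra
  moreover have "inverse (E 1) * E 1 = 1" by simp
  ultimately show ?thesis by algebra
qed

text \<open>8 (5n + 1) + 4 = 40n + 12.\<close>

lemma sect_omega_8_4: "sect 5 1 omega_8_4 = Abs_fps (\<lambda>n. of_nat (p_omega (40 * n + 12)))"
  by (rule fps_ext) (simp add: omega_8_4_def sect_def omega_gf_def algebra_simps)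

section \<open>The 5-section of \<open>E 2 ^ 10 / E 1 ^ 9\<close>\<close>

text \<open>\<open>num_coeff0\<close> to \<open>num_coeff4\<close> sort the expansion in
  \<open>num_expand\<close> by the exponent of u modulo 5, with V = u^5. The trinomial there is the
  5-dissection of psi, rescaled, with d = 1 - k and c = 1 + k.\<close>

definition num_coeff0 :: "'a::idom \<Rightarrow> 'a \<Rightarrow> 'a \<Rightarrow> 'a" where
  "num_coeff0 d c V = (d ^ 10) + V * (d ^ 5 * c ^ 5 + 30 * d ^ 6 * c ^ 3) + V ^ 2 * (20 * d ^ 3 * c ^ 4) + V ^ 3 * (c ^ 5)"

definition num_coeff1 :: "'a::idom \<Rightarrow> 'a \<Rightarrow> 'a \<Rightarrow> 'a" where
  "num_coeff1 d c V = (5 * d ^ 9 * c) + V * (20 * d ^ 5 * c ^ 4 + 10 * d ^ 6 * c ^ 2) + V ^ 2 * (10 * d ^ 2 * c ^ 5)"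

definition num_coeff2 :: "'a::idom \<Rightarrow> 'a \<Rightarrow> 'a \<Rightarrow> 'a" where
  "num_coeff2 d c V = (10 * d ^ 8 * c ^ 2) + V * (5 * d ^ 4 * c ^ 5 + 30 * d ^ 5 * c ^ 3) + V ^ 2 * (5 * d ^ 2 * c ^ 4)"

definition num_coeff3 :: "'a::idom \<Rightarrow> 'a \<Rightarrow> 'a \<Rightarrow> 'a" where
  "num_coeff3 d c V = (10 * d ^ 7 * c ^ 3 + 5 * d ^ 8 * c) + V * (30 * d ^ 4 * c ^ 4) + V ^ 2 * (5 * d * c ^ 5)"

definition num_coeff4 :: "'a::idom \<Rightarrow> 'a \<Rightarrow> 'a \<Rightarrow> 'a" where
  "num_coeff4 d c V = (5 * d ^ 6 * c ^ 4 + 20 * d ^ 7 * c ^ 2) + V * (10 * d ^ 3 * c ^ 5 + 10 * d ^ 4 * c ^ 3)"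

text \<open>The same sorting for the fourth power of the cofactor that turns 1 - u - u^2 into its
  norm; see \<open>den_expand\<close> and \<open>den_factor\<close>.\<close>

definition den_coeff0 :: "'a::idom \<Rightarrow> 'a" where
  "den_coeff0 V = 1 + 212 * V + 1860 * V ^ 2 + 60 * V ^ 3 + 1815 * V ^ 4 - 708 * V ^ 5 + 14 * V ^ 6"

definition den_coeff1 :: "'a::idom \<Rightarrow> 'a" where
  "den_coeff1 V = 4 + 418 * V + 1840 * V ^ 2 + 1015 * V ^ 3 - 1840 * V ^ 4 + 418 * V ^ 5 - 4 * V ^ 6"

definition den_coeff2 :: "'a::idom \<Rightarrow> 'a" where
  "den_coeff2 V = 14 + 708 * V + 1815 * V ^ 2 - 60 * V ^ 3 + 1860 * V ^ 4 - 212 * V ^ 5 + 1 * V ^ 6"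

definition den_coeff3 :: "'a::idom \<Rightarrow> 'a" where
  "den_coeff3 V = 40 + 1100 * V + 1200 * V ^ 2 + 1500 * V ^ 3 - 1400 * V ^ 4 + 105 * V ^ 5"

definition den_coeff4 :: "'a::idom \<Rightarrow> 'a" where
  "den_coeff4 V = 105 + 1400 * V + 1500 * V ^ 2 - 1200 * V ^ 3 + 1100 * V ^ 4 - 40 * V ^ 5"

lemma num_expand:
  fixes d c u :: "'a::idom"
  shows "(d ^ 2 + u * d * c + u ^ 3 * c) ^ 5 = num_coeff0 d c (u ^ 5) + u * num_coeff1 d c (u ^ 5)
    + u ^ 2 * num_coeff2 d c (u ^ 5) + u ^ 3 * num_coeff3 d c (u ^ 5) + u ^ 4 * num_coeff4 d c (u ^ 5)"
  unfolding num_coeff0_def num_coeff1_def num_coeff2_def num_coeff3_def num_coeff4_def by algebra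

lemma den_expand:
  fixes u :: "'a::idom"
  shows "(1 + u + 2 * u ^ 2 + 3 * u ^ 3 + 5 * u ^ 4 - 3 * u ^ 5 + 2 * u ^ 6 - u ^ 7 + u ^ 8) ^ 4 =
    den_coeff0 (u ^ 5) + u * den_coeff1 (u ^ 5) + u ^ 2 * den_coeff2 (u ^ 5) + u ^ 3 * den_coeff3 (u ^ 5)
    + u ^ 4 * den_coeff4 (u ^ 5)"
  unfolding den_coeff0_def den_coeff1_def den_coeff2_def den_coeff3_def den_coeff4_def by algebra

text \<open>The part of the product of both expansions with exponent 1 modulo 5: index sums 1, and
  index sums 6 with the carry V = u^5.\<close>

definition main_coeff :: "'a::idom \<Rightarrow> 'a \<Rightarrow> 'a \<Rightarrow> 'a" where
  "main_coeff d c V = num_coeff0 d c V * den_coeff1 V + num_coeff1 d c V * den_coeff0 V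
     + V * (num_coeff2 d c V * den_coeff4 V + num_coeff3 d c V * den_coeff3 V + num_coeff4 d c V * den_coeff2 V)"

text \<open>The long factor is the product of 1 - z u - z^2 u^2 over the fifth roots of unity z
  other than 1.\<close>

lemma den_factor:
  fixes u :: "'a::idom"
  shows "(1 - u - u ^ 2) * (1 + u + 2 * u ^ 2 + 3 * u ^ 3 + 5 * u ^ 4 - 3 * u ^ 5 + 2 * u ^ 6 - u ^ 7 + u ^ 8)
     = 1 - 11 * u ^ 5 - u ^ 10"
  by algebra

text \<open>The nine coefficients of the theorem, homogenised. For l = 1 - 4k - k^2 the ratio k / l
  is the eta quotient by which consecutive terms of the theorem differ.\<close>

definition target_poly :: "'a::idom \<Rightarrow> 'a \<Rightarrow> 'a" where
  "target_poly k l = 9 * l ^ 8 + 3975 * k * l ^ 7 + 207425 * k ^ 2 * l ^ 6 + 4229000 * k ^ 3 * l ^ 5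
    + 44850000 * k ^ 4 * l ^ 4 + 274000000 * k ^ 5 * l ^ 3 + 
    980000000 * k ^ 6 * l ^ 2 + 1920000000 * k ^ 7 * l + 1600000000 * k ^ 8"

text \<open>The hypothesis makes V rational in k, so this is a polynomial identity in k once the
  powers of 1 + k are cleared.\<close>

lemma main_identity:
  fixes k V :: "'a::idom"
  assumes V: "V * (1 + k) ^ 2 = k * (1 - k) ^ 2"
  shows "(1 + k) ^ 18 * main_coeff (1 - k) (1 + k) V =
    (1 + k) ^ 5 * (1 - k) ^ 6 * (1 + k - k ^ 2) ^ 4 * target_poly k (1 - 4 * k - k ^ 2)"
proof -
  define c d where "c = 1 + k" and "d = 1 - k"
  \<comment> \<open>Working with W = V c^2 keeps every expression polynomial in k. The powers of c
    in \<open>num\<close> and \<open>den\<close> are twice the respective degrees in V.\<close>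
  define W where "W = k * d ^ 2"
  have W: "W = V * c ^ 2" using V by (simp add: W_def c_def d_def)
  have num: "c ^ 6 * num_coeff0 d c V =
      c ^ 6 * (d ^ 10) + c ^ 4 * W * (d ^ 5 * c ^ 5 + 30 * d ^ 6 * c ^ 3) + c ^ 2 * W ^ 2 * (20 * d ^ 3 * c ^ 4) + W ^ 3 * (c ^ 5)"
    "c ^ 4 * num_coeff1 d c V =
      c ^ 4 * (5 * d ^ 9 * c) + c ^ 2 * W * (20 * d ^ 5 * c ^ 4 + 10 * d ^ 6 * c ^ 2) + W ^ 2 * (10 * d ^ 2 * c ^ 5)"
    "c ^ 4 * num_coeff2 d c V =
      c ^ 4 * (10 * d ^ 8 * c ^ 2) + c ^ 2 * W * (5 * d ^ 4 * c ^ 5 + 30 * d ^ 5 * c ^ 3) + W ^ 2 * (5 * d ^ 2 * c ^ 4)"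
    "c ^ 4 * num_coeff3 d c V =
      c ^ 4 * (10 * d ^ 7 * c ^ 3 + 5 * d ^ 8 * c) + c ^ 2 * W * (30 * d ^ 4 * c ^ 4) + W ^ 2 * (5 * d * c ^ 5)"
    "c ^ 2 * num_coeff4 d c V =
      c ^ 2 * (5 * d ^ 6 * c ^ 4 + 20 * d ^ 7 * c ^ 2) + W * (10 * d ^ 3 * c ^ 5 + 10 * d ^ 4 * c ^ 3)"
    unfolding num_coeff0_def num_coeff1_def num_coeff2_def num_coeff3_def num_coeff4_def W by algebra+
  have den: "c ^ 12 * den_coeff0 V =
      c ^ 12 + 212 * c ^ 10 * W + 1860 * c ^ 8 * W ^ 2 + 60 * c ^ 6 * W ^ 3 + 1815 * c ^ 4 * W ^ 4 - 708 * c ^ 2 * W ^ 5 + 14 * W ^ 6"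
    "c ^ 12 * den_coeff1 V =
      4 * c ^ 12 + 418 * c ^ 10 * W + 1840 * c ^ 8 * W ^ 2 + 1015 * c ^ 6 * W ^ 3 - 1840 * c ^ 4 * W ^ 4 + 418 * c ^ 2 * W ^ 5 - 4 * W ^ 6"
    "c ^ 12 * den_coeff2 V =
      14 * c ^ 12 + 708 * c ^ 10 * W + 1815 * c ^ 8 * W ^ 2 - 60 * c ^ 6 * W ^ 3 + 1860 * c ^ 4 * W ^ 4 - 212 * c ^ 2 * W ^ 5 + W ^ 6"
    "c ^ 10 * den_coeff3 V =
      40 * c ^ 10 + 1100 * c ^ 8 * W + 1200 * c ^ 6 * W ^ 2 + 1500 * c ^ 4 * W ^ 3 - 1400 * c ^ 2 * W ^ 4 + 105 * W ^ 5"
    "c ^ 10 * den_coeff4 V =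
      105 * c ^ 10 + 1400 * c ^ 8 * W + 1500 * c ^ 6 * W ^ 2 - 1200 * c ^ 4 * W ^ 3 + 1100 * c ^ 2 * W ^ 4 - 40 * W ^ 5"
    unfolding den_coeff0_def den_coeff1_def den_coeff2_def den_coeff3_def den_coeff4_def W by algebra+
  have "c ^ 18 * main_coeff d c V =
      (c ^ 6 * num_coeff0 d c V) * (c ^ 12 * den_coeff1 V) + c ^ 2 * ((c ^ 4 * num_coeff1 d c V) * (c ^ 12 * den_coeff0 V))
      + W * c ^ 2 * ((c ^ 4 * num_coeff2 d c V) * (c ^ 10 * den_coeff4 V)
        + (c ^ 4 * num_coeff3 d c V) * (c ^ 10 * den_coeff3 V) + (c ^ 2 * num_coeff4 d c V) * (c ^ 12 * den_coeff2 V))"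
    unfolding main_coeff_def W by algebra
  also have "\<dots> = c ^ 5 * d ^ 6 * (1 + k - k ^ 2) ^ 4 * target_poly k (1 - 4 * k - k ^ 2)"
    unfolding num den
    unfolding W_def c_def d_def target_poly_def by algebra
  finally show ?thesis unfolding c_def d_def .
qed

subsection \<open>Level 10 relations\<close>

lemma dil_uminus: "dil k (- f) = - dil k f"
  by (simp add: dil_def fps_compose_uminus)

lemma lessThan_5: "{..<5::nat} = {0, 1, 2, 3, 4}"
  by auto

definition alpha :: "complex fps" where "alpha = sect 5 0 (E 1)"
definition beta :: "complex fps" where "beta = - sect 5 2 (E 1)"
definition psi :: "complex fps" where "psi = theta 1 1 3"
definition psi0 :: "complex fps" where "psi0 = theta 1 2 3"
definition psi1 :: "complex fps" where "psi1 = theta 1 1 4"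

lemma E_1_dissection: "E 1 = dil 5 alpha - fps_X * E 25 - fps_X ^ 2 * dil 5 beta"
  using sect_dissection[of 5 "E 1"] sect_5_E
  by (simp add: lessThan_5 alpha_def beta_def dil_uminus dil_E dil_def[of _ 0] algebra_simps)

lemma psi_dissection: "psi = dil 5 psi0 + fps_X * dil 5 psi1 + fps_X ^ 3 * dil 25 psi"
  unfolding psi_def psi0_def psi1_def
  using sect_dissection[of 5 "theta 1 1 3"] sect_5_psi
  by (simp add: lessThan_5 dil_dil dil_def[of _ 0] add.assoc)

lemma psi_E: "psi * E 1 = E 2 ^ 2"
  unfolding psi_def by (rule theta_psi)

lemma dil_psi_E: "dil 5 psi * E 5 = E 10 ^ 2"
  using arg_cong[OF psi_E, of "dil 5"] by (simp add: dil_mult dil_power dil_E)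

lemma sect_5_components:
  assumes "r < 5"
  shows "sect 5 r (dil 5 f0 + fps_X * dil 5 f1 + fps_X ^ 2 * dil 5 f2 + fps_X ^ 3 * dil 5 f3 + fps_X ^ 4 * dil 5 f4)
     = [f0, f1, f2, f3, f4] ! r"
proof -
  have *: "sect 5 r (dil 5 f) = (if r = 0 then f else 0)" "sect 5 r (fps_X * dil 5 f) = (if r = 1 then f else 0)"
    for f :: "'a fps"
    using sect_X_dil[of 5 r 0 f] sect_X_dil[of 5 r 1 f] assms by auto
  have "r = 0 \<or> r = 1 \<or> r = 2 \<or> r = 3 \<or> r = 4" using assms by auto
  then show ?thesis
    by (auto simp: sect_add * sect_X_dil)
qed

text \<open>Compare the 5-dissections of the two sides of E_2^2 = psi E_1; the residues 4, 3, 2 and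
  1 give the four relations, from which the level 10 relations start.\<close>

lemma psi_E_components:
  shows "E 10 ^ 2 - 2 * (dil 2 alpha * dil 2 beta) = - E 5 * dil 5 psi" (is ?A)
    and "fps_X * dil 2 beta ^ 2 = alpha * dil 5 psi - beta * psi1" (is ?B)
    and "2 * (dil 2 alpha * E 10) = E 5 * psi1 + beta * psi0" (is ?C)
    and "2 * fps_X * (E 10 * dil 2 beta) = alpha * psi1 - E 5 * psi0" (is ?D)
proof -
  let ?a = "dil 2 alpha" and ?b = "dil 2 beta" and ?P = "dil 5 psi"
  have X5: "fps_X ^ 5 = dil 5 (fps_X :: complex fps)" by (simp add: dil_X)
  have "E 2 = dil 5 ?a - fps_X ^ 2 * dil 5 (E 10) - fps_X ^ 4 * dil 5 ?b"
    using arg_cong[OF E_1_dissection, of "dil 2"]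
    by (simp add: dil_diff dil_mult dil_power dil_X dil_E dil_dil)
  then have L: "E 2 ^ 2 = dil 5 (?a ^ 2) + fps_X * dil 5 (2 * fps_X * (E 10 * ?b)) + fps_X ^ 2 * dil 5 (- (2 * (?a * E 10)))
      + fps_X ^ 3 * dil 5 (fps_X * ?b ^ 2) + fps_X ^ 4 * dil 5 (E 10 ^ 2 - 2 * (?a * ?b))"
    unfolding dil_mult[OF zero_less_numeral] dil_power[OF zero_less_numeral] dil_diff[OF zero_less_numeral]
      dil_uminus dil_X[OF zero_less_numeral] dil_numeral[OF zero_less_numeral]
    by algebra
  have "E 1 = dil 5 alpha - fps_X * dil 5 (E 5) - fps_X ^ 2 * dil 5 beta"
    "psi = dil 5 psi0 + fps_X * dil 5 psi1 + fps_X ^ 3 * dil 5 ?P"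
    using E_1_dissection psi_dissection by (simp_all add: dil_E dil_dil)
  then have R: "psi * E 1 = dil 5 (alpha * psi0 - fps_X * (beta * ?P)) + fps_X * dil 5 (alpha * psi1 - E 5 * psi0)
      + fps_X ^ 2 * dil 5 (- (E 5 * psi1 + beta * psi0)) + fps_X ^ 3 * dil 5 (alpha * ?P - beta * psi1)
      + fps_X ^ 4 * dil 5 (- E 5 * ?P)"
    unfolding dil_mult[OF zero_less_numeral] dil_power[OF zero_less_numeral] dil_diff[OF zero_less_numeral]
      dil_uminus dil_X[OF zero_less_numeral] dil_add[OF zero_less_numeral]
    by algebra
  have "sect 5 r (E 2 ^ 2) = sect 5 r (psi * E 1)" for r by (simp only: psi_E)
  note * = this[unfolded L R]
  show ?A using *[of 4] by (simp add: sect_5_components)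
  show ?B using *[of 3] by (simp add: sect_5_components)
  have "- (2 * (?a * E 10)) = - (E 5 * psi1 + beta * psi0)" using *[of 2] by (simp add: sect_5_components)
  then show ?C by (simp only: neg_equal_iff_equal)
  show ?D using *[of 1] by (simp add: sect_5_components)
qed

text \<open>The residue 4 relation and \<open>dil_psi_E\<close> give the claim with q^2 in place of
  q; injectivity of the dilation removes the square.\<close>

lemma alpha_beta: "alpha * beta = E 5 ^ 2"
proof -
  have "E 10 ^ 2 - 2 * (dil 2 alpha * dil 2 beta) = - (E 10 ^ 2)"
    using psi_E_components(1) dil_psi_E by (simp add: mult.commute)
  then have "2 * (dil 2 alpha * dil 2 beta) = 2 * E 10 ^ 2" by algebra
  then have "dil 2 alpha * dil 2 beta = E 10 ^ 2" by simp
  then have "dil 2 (alpha * beta) = dil 2 (E 5 ^ 2)" by (simp add: dil_mult dil_power dil_E)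
  then show ?thesis by (simp add: dil_inject)
qed

lemma alpha_nth_0: "fps_nth alpha 0 = 1"
  by (simp add: alpha_def sect_def)

lemma beta_nth_0: "fps_nth beta 0 = 1"
proof -
  have "fps_nth (alpha * beta) 0 = fps_nth (E 5 ^ 2) 0" by (simp only: alpha_beta)
  then show ?thesis by (simp add: alpha_nth_0 power2_eq_square)
qed

text \<open>Up to the factor \<open>q powr (1 / 5)\<close>, \<open>rr\<close> is the Rogers--Ramanujan continued fraction, and
  \<open>kk\<close> is Ramanujan's parameter \<open>k\<close> of level 10.\<close>

definition rr :: "complex fps" where "rr = beta * inverse (E 5)"
definition rr2 :: "complex fps" where "rr2 = dil 2 rr"
definition kk :: "complex fps" where "kk = fps_X * rr * rr2 ^ 2"
abbreviation (input) "kc \<equiv> 1 + kk"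
abbreviation (input) "kd \<equiv> 1 - kk"
definition kappa :: "complex fps" where "kappa = 1 - 4 * kk - kk ^ 2"
definition lambda :: "complex fps" where "lambda = 1 + kk - kk ^ 2"

lemma rr_nth_0 [simp]: "fps_nth rr 0 = 1"
  by (simp add: rr_def beta_nth_0)

lemma rr2_nth_0 [simp]: "fps_nth rr2 0 = 1"
  by (simp add: rr2_def dil_nth_0)

lemma kk_nth_0 [simp]: "fps_nth kk 0 = 0"
  by (simp add: kk_def)

lemma nonzero_if_nth_0: "fps_nth f 0 = 1 \<Longrightarrow> f \<noteq> (0 :: complex fps)"
  by auto

lemma kappa_nth_0 [simp]: "fps_nth kappa 0 = 1" and lambda_nth_0 [simp]: "fps_nth lambda 0 = 1"
  by (simp_all add: kappa_def lambda_def power2_eq_square)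

lemma fps_nth_0_power [simp]: "fps_nth (f ^ n) 0 = fps_nth (f :: complex fps) 0 ^ n"
  by (induction n) auto

lemma beta_eq: "beta = rr * E 5"
  by (simp add: rr_def mult.assoc)

lemma alpha_rr: "alpha * rr = E 5"
proof -
  have "(alpha * rr - E 5) * E 5 = 0" using alpha_beta beta_eq by algebra
  then show ?thesis by simp
qed

lemma dil_2_beta: "dil 2 beta = rr2 * E 10" and dil_2_alpha: "dil 2 alpha * rr2 = E 10"
  using arg_cong[OF beta_eq, of "dil 2"] arg_cong[OF alpha_rr, of "dil 2"]
  by (simp_all add: rr2_def dil_mult dil_E)

text \<open>The residue 2 and 1 relations determine the sum and the difference of
  \<open>psi1\<close> and \<open>rr * psi0\<close>; solving the linear system brings in
  \<open>kk\<close>.\<close>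

lemma rr2_psi1: "rr2 * psi1 = dil 5 psi * kc" and rr_rr2_psi0: "rr * rr2 * psi0 = dil 5 psi * kd"
proof -
  let ?P = "dil 5 psi"
  have e: "?P * E 5 = E 10 ^ 2" by (rule dil_psi_E)
  have "(2 * ?P - rr2 * (psi1 + rr * psi0)) * E 5 = 0"
    using psi_E_components(3) beta_eq dil_2_alpha e by algebra
  then have 1: "rr2 * (psi1 + rr * psi0) = 2 * ?P" by simp
  have "(2 * fps_X * ?P * rr * rr2 - (psi1 - rr * psi0)) * E 5 = 0"
    using psi_E_components(4) alpha_rr dil_2_beta e by algebra
  then have 2: "psi1 - rr * psi0 = 2 * fps_X * ?P * rr * rr2" by simp
  have "2 * (rr2 * psi1) = 2 * (?P * kc)" using 1 2 unfolding kk_def by algebra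
  then show "rr2 * psi1 = ?P * kc" by simp
  have "2 * (rr * rr2 * psi0) = 2 * (?P * kd)" using 1 2 unfolding kk_def by algebra
  then show "rr * rr2 * psi0 = ?P * kd" by simp
qed

lemma dil_5_psi_nonzero: "dil 5 psi \<noteq> 0"
  using dil_psi_E E_nonzero[of 10] by auto

text \<open>From the residue 3 relation. This is the classical modular equation (v - u^2) / (v +
  u^2) = u v^2 for u = R(q) and v = R(q^2), R being the Rogers-Ramanujan continued fraction.\<close>

lemma rr2_kd: "rr2 * kd = rr ^ 2 * kc"
proof -
  let ?P = "dil 5 psi"
  have "(rr2 * kd - rr ^ 2 * kc) * (?P * E 5) = 0"
    using psi_E_components(2) alpha_rr beta_eq dil_2_beta dil_psi_E rr2_psi1 unfolding kk_def by algebra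
  then show ?thesis using dil_5_psi_nonzero by simp
qed

lemma rr_psi1: "rr ^ 2 * psi1 = dil 5 psi * kd"
proof -
  have "(rr ^ 2 * psi1 - dil 5 psi * kd) * kc = 0" using rr2_psi1 rr2_kd by algebra
  moreover have "kc \<noteq> 0" by (rule nonzero_if_nth_0) simp
  ultimately show ?thesis by simp
qed

lemma rr_psi0: "rr ^ 3 * kc * psi0 = dil 5 psi * kd ^ 2"
  using rr_rr2_psi0 rr2_kd by algebra

text \<open>Multiply the formulas for \<open>psi0\<close> and \<open>psi1\<close> and evaluate their
  product by \<open>theta_5_product\<close>. In other words, k / (1 - k^2) = q E_1 E_10^5 / (E_2
  E_5^5).\<close>

lemma level_10_first: "rr * rr2 ^ 2 * (E 2 * E 5 ^ 5) = (1 - kk ^ 2) * (E 1 * E 10 ^ 5)"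
proof -
  have t: "psi1 * psi0 * (E 1 * E 10) = E 2 * E 5 ^ 3"
    unfolding psi0_def psi1_def by (rule theta_5_product)
  show ?thesis using t rr2_psi1 rr_rr2_psi0 dil_psi_E by algebra
qed

text \<open>Together with \<open>rr2_5_kd\<close> the parametrisation R(q)^5 = k ((1 - k) / (1 +
  k))^2 and R(q^2)^5 = k^2 (1 + k) / (1 - k).\<close>

lemma rr_5_kc: "fps_X * rr ^ 5 * kc ^ 2 = kk * kd ^ 2"
  using rr2_kd unfolding kk_def by algebra

lemma rr2_5_kd: "fps_X ^ 2 * rr2 ^ 5 * kd = kk ^ 2 * kc"
  using rr2_kd unfolding kk_def by algebra

subsection \<open>The norm of \<open>E 1\<close> over the fifth roots of unity\<close>

definition zeta :: complex where "zeta = cis (2 * pi / 5)"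

lemma zeta_5: "zeta ^ 5 = 1"
proof -
  have "zeta ^ 5 = cis (real 5 * (2 * pi / 5))" unfolding zeta_def by (rule Complex.DeMoivre)
  also have "real 5 * (2 * pi / 5) = 2 * pi" by simp
  finally show ?thesis by simp
qed

lemma zeta_neq_1: "zeta \<noteq> 1"
proof
  assume "zeta = 1"
  then have "cos (2 * pi / 5) = 1" by (simp add: zeta_def complex_eq_iff)
  moreover have "cos (2 * pi / 5) < cos 0" by (rule cos_monotone_0_pi) auto
  ultimately show False by simp
qed

lemma fifth_root_sum:
  assumes "(z :: complex) ^ 5 = 1" "z \<noteq> 1"
  shows "1 + z + z ^ 2 + z ^ 3 + z ^ 4 = 0"
proof -
  have "(z - 1) * (1 + z + z ^ 2 + z ^ 3 + z ^ 4) = 0" using assms(1) by algebra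
  then show ?thesis using assms(2) by simp
qed

lemma zeta_power_neq_1:
  assumes "\<not> 5 dvd m"
  shows "zeta ^ m \<noteq> 1"
proof -
  have s: "1 + zeta + zeta ^ 2 + zeta ^ 3 + zeta ^ 4 = 0"
    by (rule fifth_root_sum[OF zeta_5 zeta_neq_1])
  have "zeta ^ m = zeta ^ (5 * (m div 5) + m mod 5)" by simp
  also have "\<dots> = zeta ^ (m mod 5)" by (simp only: power_add power_mult zeta_5) simp
  finally have m: "zeta ^ m = zeta ^ (m mod 5)" .
  have "m mod 5 = 1 \<or> m mod 5 = 2 \<or> m mod 5 = 3 \<or> m mod 5 = 4" using assms by presburger
  moreover have "zeta = 1" if "zeta ^ 2 = 1 \<or> zeta ^ 3 = 1 \<or> zeta ^ 4 = 1"
    using that zeta_5 by (elim disjE) algebra+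
  then have "zeta ^ 2 \<noteq> 1" "zeta ^ 3 \<noteq> 1" "zeta ^ 4 \<noteq> 1"
    using zeta_neq_1 by blast+
  ultimately show ?thesis unfolding m using zeta_neq_1 by auto
qed

section \<open>Rotations by fifth roots of unity and the norm\<close>

definition rot :: "'a \<Rightarrow> 'a::idom fps \<Rightarrow> 'a fps" where
  "rot z f = f oo (fps_const z * fps_X)"

lemma rot_nth: "fps_nth (rot z f) m = z ^ m * fps_nth f m"
proof -
  have "fps_nth (rot z f) m = (\<Sum>i=0..m. fps_nth f i * (z ^ i * fps_nth (fps_X ^ i) m))"
    unfolding rot_def fps_compose_def by (simp add: power_mult_distrib fps_const_power)
  also have "\<dots> = (\<Sum>i\<in>{m}. fps_nth f i * (z ^ i * fps_nth (fps_X ^ i) m))"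
    by (intro sum.mono_neutral_right) auto
  finally show ?thesis by simp
qed

lemma rot_mult: "rot z (f * g) = rot z f * rot z g"
  unfolding rot_def by (rule fps_compose_mult_distrib) simp

lemma rot_power: "rot z (f ^ n) = rot z f ^ n"
  unfolding rot_def by (rule fps_compose_power[symmetric]) simp

lemma rot_diff: "rot z (f - g) = rot z f - rot z g"
  by (simp add: fps_eq_iff rot_nth algebra_simps)

lemma rot_1 [simp]: "rot z 1 = 1"
  by (simp add: rot_def)

lemma rot_X: "rot z fps_X = fps_const z * fps_X"
  by (simp add: rot_def)

lemma rot_dil_5: "z ^ 5 = 1 \<Longrightarrow> rot z (dil 5 f) = dil 5 f"
  by (auto simp: fps_eq_iff rot_nth dil_nth power_mult elim!: dvdE)

lemma rot_tendsto:
  assumes "(f \<longlongrightarrow> a) F"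
  shows "((\<lambda>x. rot z (f x)) \<longlongrightarrow> rot z a) F"
proof (rule tendsto_fpsI)
  fix m
  have "eventually (\<lambda>x. fps_nth (f x) m = fps_nth a m) F"
    using assms by (auto simp: tendsto_fps_iff)
  then show "eventually (\<lambda>x. fps_nth (rot z (f x)) m = fps_nth (rot z a) m) F"
    by eventually_elim (simp add: rot_nth)
qed

definition norm5 :: "complex fps \<Rightarrow> complex fps" where
  "norm5 f = f * rot zeta f * rot (zeta ^ 2) f * rot (zeta ^ 3) f * rot (zeta ^ 4) f"

lemma norm5_mult: "norm5 (f * g) = norm5 f * norm5 g"
  by (simp add: norm5_def rot_mult mult_ac)

lemma norm5_tendsto: "(f \<longlongrightarrow> a) F \<Longrightarrow> ((\<lambda>x. norm5 (f x)) \<longlongrightarrow> norm5 a) F"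
  unfolding norm5_def by (intro fps_tendsto_mult rot_tendsto)

text \<open>If 5 does not divide m, then zeta^m is again a primitive fifth root of unity and the
  conjugates multiply to 1 - Y^5 with Y = q^m; otherwise the rotations fix the factor.\<close>

lemma norm5_factor:
  "norm5 (1 - fps_X ^ m) = (if 5 dvd m then (1 - fps_X ^ m) ^ 5 else 1 - fps_X ^ (5 * m))"
proof -
  have r: "rot (zeta ^ i) (1 - fps_X ^ m) = 1 - fps_const (zeta ^ m) ^ i * fps_X ^ m" for i
  proof -
    have "(zeta ^ i) ^ m = (zeta ^ m) ^ i" by (simp only: mult.commute flip: power_mult)
    then show ?thesis
      by (simp add: rot_diff rot_power rot_X power_mult_distrib)
  qed
  note r1 = r[of 1, unfolded power_one_right]
  show ?thesis
  proof (cases "5 dvd m")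
    case True
    then have "zeta ^ m = 1" using zeta_5 by (auto simp: power_mult elim!: dvdE)
    then have "norm5 (1 - fps_X ^ m) = (1 - fps_X ^ m) * (1 - fps_X ^ m) * (1 - fps_X ^ m) * (1 - fps_X ^ m) * (1 - fps_X ^ m)"
      unfolding norm5_def r r1 by simp
    also have "\<dots> = (1 - fps_X ^ m) ^ 5" by algebra
    finally show ?thesis using True by simp
  next
    case False
    define z where "z = fps_const (zeta ^ m)"
    have "(zeta ^ m) ^ 5 = (zeta ^ 5) ^ m" by (simp only: mult.commute flip: power_mult)
    then have "1 + zeta ^ m + (zeta ^ m) ^ 2 + (zeta ^ m) ^ 3 + (zeta ^ m) ^ 4 = 0"
      using zeta_power_neq_1[OF False] zeta_5 by (intro fifth_root_sum) auto
    then have "fps_const (1 + zeta ^ m + (zeta ^ m) ^ 2 + (zeta ^ m) ^ 3 + (zeta ^ m) ^ 4) = fps_const 0"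
      by (simp only:)
    then have z: "1 + z + z ^ 2 + z ^ 3 + z ^ 4 = 0"
      by (simp add: z_def flip: fps_const_add)
    have "(1 - Y) * (1 - z * Y) * (1 - z ^ 2 * Y) * (1 - z ^ 3 * Y) * (1 - z ^ 4 * Y) = 1 - Y ^ 5" for Y
      using z by algebra
    then have "norm5 (1 - fps_X ^ m) = 1 - (fps_X ^ m) ^ 5"
      unfolding norm5_def r r1 z_def[symmetric] by simp
    then show ?thesis using False by (simp add: mult.commute flip: power_mult)
  qed
qed

text \<open>Indices divisible by 5 give fifth powers in place of factors 1 - q^(5m);
  \<open>eprod 25 n\<close> restores the missing factors, so that \<open>eprod 5 (5 * n)\<close> is
  complete.\<close>

lemma norm5_eprod: "norm5 (eprod 1 (5 * n)) * eprod 25 n = eprod 5 (5 * n) * eprod 5 n ^ 5"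
proof (induction n)
  case (Suc n)
  have 5: "5 * Suc n = Suc (Suc (Suc (Suc (Suc (5 * n)))))" by simp
  have nd: "\<not> 5 dvd 5 * n + 1" "\<not> 5 dvd 5 * n + 2" "\<not> 5 dvd 5 * n + 3" "\<not> 5 dvd 5 * n + 4" "5 dvd 5 * n + 5"
    by presburger+
  have e: "eprod j (5 * Suc n) = eprod j (5 * n) * (1 - fps_X ^ (j * (5 * n + 1))) * (1 - fps_X ^ (j * (5 * n + 2)))
     * (1 - fps_X ^ (j * (5 * n + 3))) * (1 - fps_X ^ (j * (5 * n + 4))) * (1 - fps_X ^ (j * (5 * n + 5)))" for j
  proof -
    have "Suc (5 * n) + 1 = 5 * n + 2" "Suc (Suc (5 * n)) + 1 = 5 * n + 3" "Suc (Suc (Suc (5 * n))) + 1 = 5 * n + 4"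
      "Suc (Suc (Suc (Suc (5 * n)))) + 1 = 5 * n + 5" by simp_all
    then show ?thesis unfolding 5 eprod_Suc by (simp only:)
  qed
  have "norm5 (eprod 1 (5 * Suc n)) = norm5 (eprod 1 (5 * n)) * (1 - fps_X ^ (5 * (5 * n + 1))) * (1 - fps_X ^ (5 * (5 * n + 2)))
     * (1 - fps_X ^ (5 * (5 * n + 3))) * (1 - fps_X ^ (5 * (5 * n + 4))) * (1 - fps_X ^ (5 * n + 5)) ^ 5"
    unfolding e norm5_mult mult_1 norm5_factor using nd by (simp only: if_True if_False)
  then have "norm5 (eprod 1 (5 * Suc n)) * eprod 25 (Suc n) = (norm5 (eprod 1 (5 * n)) * eprod 25 n) * ((1 - fps_X ^ (5 * (5 * n + 1))) * (1 - fps_X ^ (5 * (5 * n + 2)))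
     * (1 - fps_X ^ (5 * (5 * n + 3))) * (1 - fps_X ^ (5 * (5 * n + 4))) * (1 - fps_X ^ (5 * n + 5)) ^ 5 * (1 - fps_X ^ (25 * (n + 1))))"
    by (simp only: eprod_Suc mult_ac)
  also have "25 * (n + 1) = 5 * (5 * n + 5)" by simp
  also have "norm5 (eprod 1 (5 * n)) * eprod 25 n = eprod 5 (5 * n) * eprod 5 n ^ 5" by (rule Suc.IH)
  also have "eprod 5 (5 * n) * eprod 5 n ^ 5 * ((1 - fps_X ^ (5 * (5 * n + 1))) * (1 - fps_X ^ (5 * (5 * n + 2)))
     * (1 - fps_X ^ (5 * (5 * n + 3))) * (1 - fps_X ^ (5 * (5 * n + 4))) * (1 - fps_X ^ (5 * n + 5)) ^ 5 * (1 - fps_X ^ (5 * (5 * n + 5))))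
     = eprod 5 (5 * Suc n) * eprod 5 (Suc n) ^ 5"
  proof -
    have "5 * (n + 1) = 5 * n + 5" by simp
    then show ?thesis unfolding e eprod_Suc power_mult_distrib by (simp only: mult_ac)
  qed
  finally show ?case .
qed (simp add: norm5_def)

lemma norm5_E: "norm5 (E 1) * E 25 = E 5 ^ 6"
proof -
  have "(\<lambda>n. norm5 (eprod 1 (5 * n)) * eprod 25 n) \<longlonglongrightarrow> norm5 (E 1) * E 25"
    by (intro fps_tendsto_mult norm5_tendsto filterlim_compose[OF eprod_tendsto mult_at_top] eprod_tendsto) auto
  moreover have "(\<lambda>n. eprod 5 (5 * n) * eprod 5 n ^ 5) \<longlonglongrightarrow> E 5 * E 5 ^ 5"
    by (intro fps_tendsto_mult fps_tendsto_power filterlim_compose[OF eprod_tendsto mult_at_top] eprod_tendsto) auto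
  ultimately have "norm5 (E 1) * E 25 = E 5 * E 5 ^ 5"
    unfolding norm5_eprod by (rule LIMSEQ_unique)
  then show ?thesis by (simp flip: power_Suc)
qed

text \<open>Under the hypothesis the trinomial is, up to a factor, 1 - u - u^2 = (1 - g u)(1 + u /
  g) with the golden ratio g, and 11 is g^5 - g^(-5).\<close>

lemma norm5_trinomial:
  fixes f g h s :: "complex fps"
  assumes "dil 5 f * dil 5 h = dil 5 g ^ 2"
  shows "norm5 (dil 5 f - fps_X * dil 5 g - fps_X ^ 2 * dil 5 h) = dil 5 (f ^ 5 - 11 * fps_X * g ^ 5 - fps_X ^ 2 * h ^ 5)"
proof -
  define z :: "complex fps" where "z = fps_const zeta"
  have r: "rot (zeta ^ i) (dil 5 f - fps_X * dil 5 g - fps_X ^ 2 * dil 5 h) =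
      dil 5 f - z ^ i * fps_X * dil 5 g - (z ^ i * fps_X) ^ 2 * dil 5 h" for i
  proof -
    have "(zeta ^ i) ^ 5 = (zeta ^ 5) ^ i" by (simp only: mult.commute flip: power_mult)
    then have "(zeta ^ i) ^ 5 = 1" using zeta_5 by simp
    then show ?thesis
      by (simp add: rot_diff rot_mult rot_power rot_X rot_dil_5 z_def)
  qed
  note r1 = r[of 1, unfolded power_one_right]
  have "fps_const (1 + zeta + zeta ^ 2 + zeta ^ 3 + zeta ^ 4) = fps_const 0"
    by (simp only: fifth_root_sum[OF zeta_5 zeta_neq_1])
  then have "1 + z + z ^ 2 + z ^ 3 + z ^ 4 = 0"
    by (simp add: z_def flip: fps_const_add)
  note z = this
  then have z5: "z ^ 5 = 1" by algebra
  have "(a - b - c) * (a - z * b - z ^ 2 * c) * (a - z ^ 2 * b - (z ^ 2) ^ 2 * c) * (a - z ^ 3 * b - (z ^ 3) ^ 2 * c) * (a - z ^ 4 * b - (z ^ 4) ^ 2 * c)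
      = a ^ 5 - 11 * b ^ 5 - c ^ 5" if ac: "a * c = b ^ 2" for a b c :: "complex fps"
  proof -
    \<comment> \<open>Conjugate factors are paired. \<open>p\<close> and \<open>r\<close> are the
      Gaussian periods, the two roots of t^2 + t - 1.\<close>
    define p r where "p = z + z ^ 4" and "r = z ^ 2 + z ^ 3"
    have pr: "p + r = -1" "p * r = -1" using z z5 unfolding p_def r_def by algebra+
    have 1: "(a - z * b - z ^ 2 * c) * (a - z ^ 4 * b - (z ^ 4) ^ 2 * c)
        = a ^ 2 + b ^ 2 + c ^ 2 - p * (a * b) - r * (a * c) + p * (b * c)"
      using z5 unfolding p_def r_def by algebra
    have 2: "(a - z ^ 2 * b - (z ^ 2) ^ 2 * c) * (a - z ^ 3 * b - (z ^ 3) ^ 2 * c)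
        = a ^ 2 + b ^ 2 + c ^ 2 - r * (a * b) - p * (a * c) + r * (b * c)"
      using z5 unfolding p_def r_def by algebra
    have "(a - b - c) * ((a ^ 2 + b ^ 2 + c ^ 2 - p * (a * b) - r * (a * c) + p * (b * c)) *
        (a ^ 2 + b ^ 2 + c ^ 2 - r * (a * b) - p * (a * c) + r * (b * c))) = a ^ 5 - 11 * b ^ 5 - c ^ 5"
      using pr ac by algebra
    then show ?thesis unfolding 1[symmetric] 2[symmetric] by (simp only: mult_ac)
  qed
  from this[of "dil 5 f" "fps_X ^ 2 * dil 5 h" "fps_X * dil 5 g"]
  have "norm5 (dil 5 f - fps_X * dil 5 g - fps_X ^ 2 * dil 5 h) =
      dil 5 f ^ 5 - 11 * (fps_X * dil 5 g) ^ 5 - (fps_X ^ 2 * dil 5 h) ^ 5"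
    using assms unfolding norm5_def r r1 by (simp add: power_mult_distrib mult_ac)
  also have "\<dots> = dil 5 (f ^ 5 - 11 * fps_X * g ^ 5 - fps_X ^ 2 * h ^ 5)"
    by (simp add: dil_diff dil_mult dil_power dil_X dil_numeral power_mult_distrib flip: power_mult)
  finally show ?thesis .
qed

text \<open>Evaluate the norm of E_1 once from its product and once from its 5-dissection. The
  result is the classical 1 / R^5 - 11 - R^5 = E_1^6 / (q E_5^6).\<close>

lemma E_quotient_rr: "E 1 ^ 6 * rr ^ 5 = E 5 ^ 6 * (1 - 11 * (fps_X * rr ^ 5) - (fps_X * rr ^ 5) ^ 2)"
proof -
  have "dil 5 alpha * dil 5 beta = dil 5 (E 5) ^ 2"
    using arg_cong[OF alpha_beta, of "dil 5"] by (simp add: dil_mult dil_power)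
  from norm5_trinomial[OF this]
  have "norm5 (E 1) = dil 5 (alpha ^ 5 - 11 * fps_X * E 5 ^ 5 - fps_X ^ 2 * beta ^ 5)"
    using E_1_dissection by (simp add: dil_E)
  then have "dil 5 (alpha ^ 5 - 11 * fps_X * E 5 ^ 5 - fps_X ^ 2 * beta ^ 5) * dil 5 (E 5) = dil 5 (E 1 ^ 6)"
    using norm5_E by (simp add: dil_E dil_power)
  then have "dil 5 ((alpha ^ 5 - 11 * fps_X * E 5 ^ 5 - fps_X ^ 2 * beta ^ 5) * E 5) = dil 5 (E 1 ^ 6)"
    by (simp add: dil_mult)
  then have "(alpha ^ 5 - 11 * fps_X * E 5 ^ 5 - fps_X ^ 2 * beta ^ 5) * E 5 = E 1 ^ 6"
    by (simp add: dil_inject)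
  then show ?thesis using alpha_rr beta_eq by algebra
qed

lemma E_quotient_rr2: "E 2 ^ 6 * rr2 ^ 5 = E 10 ^ 6 * (1 - 11 * (fps_X ^ 2 * rr2 ^ 5) - (fps_X ^ 2 * rr2 ^ 5) ^ 2)"
  using arg_cong[OF E_quotient_rr, of "dil 2"]
  by (simp add: dil_mult dil_power dil_diff dil_1 dil_numeral dil_X dil_E rr2_def)

lemma norm_kk: "(1 - 11 * (fps_X * rr ^ 5) - (fps_X * rr ^ 5) ^ 2) * kc ^ 4 = kappa ^ 2 * lambda"
  using rr_5_kc unfolding kappa_def lambda_def by algebra

lemma norm2_kk: "(1 - 11 * (fps_X ^ 2 * rr2 ^ 5) - (fps_X ^ 2 * rr2 ^ 5) ^ 2) * kd ^ 2 = kappa * lambda ^ 2"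
  using rr2_5_kd unfolding kappa_def lambda_def by algebra

lemma fps_cube_cancel:
  fixes f g :: "complex fps"
  assumes "f ^ 3 = g ^ 3" "fps_nth f 0 = 1" "fps_nth g 0 = 1"
  shows "f = g"
proof -
  have "(f - g) * (f ^ 2 + f * g + g ^ 2) = 0" using assms(1) by algebra
  moreover have "fps_nth (f ^ 2 + f * g + g ^ 2) 0 = 3" using assms by simp
  then have "f ^ 2 + f * g + g ^ 2 \<noteq> 0" by force
  ultimately show ?thesis by simp
qed

text \<open>Eliminating \<open>lambda\<close> from the norm identities for q and q^2 determines only
  kappa^3 as an eta quotient, so equality is first shown for cubes. The constant terms 1 then single
  out the cube root.\<close>

lemma level_10_second: "rr * rr2 ^ 2 * (E 1 ^ 3 * E 5) = kappa * (E 2 * E 10 ^ 3)"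
proof (rule fps_cube_cancel)
  let ?m = "rr * rr2 ^ 2"
  have 1: "E 1 ^ 12 * (rr ^ 10 * kc ^ 8) = E 5 ^ 12 * (kappa ^ 4 * lambda ^ 2)"
    using E_quotient_rr norm_kk by algebra
  have 2: "E 2 ^ 6 * (rr2 ^ 5 * kd ^ 2) = E 10 ^ 6 * (kappa * lambda ^ 2)"
    using E_quotient_rr2 norm2_kk by algebra
  have 3: "?m ^ 3 * (E 2 ^ 3 * E 5 ^ 15) = (1 - kk ^ 2) ^ 3 * (E 1 ^ 3 * E 10 ^ 15)"
    using level_10_first by algebra
  have 4: "rr2 ^ 5 * kd ^ 5 = rr ^ 10 * kc ^ 5" using rr2_kd by algebra
  have "((?m * (E 1 ^ 3 * E 5)) ^ 3 - (kappa * (E 2 * E 10 ^ 3)) ^ 3) *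
    (E 1 ^ 3 * E 10 ^ 6 * rr ^ 10 * kc ^ 8 * kappa * lambda ^ 2 * (1 - kk ^ 2) ^ 3) = 0"
  proof -
    have "(?m * (E 1 ^ 3 * E 5)) ^ 3 * (E 1 ^ 3 * E 10 ^ 6 * rr ^ 10 * kc ^ 8 * kappa * lambda ^ 2 * (1 - kk ^ 2) ^ 3)
      = ?m ^ 3 * E 5 ^ 3 * (1 - kk ^ 2) ^ 3 * (E 1 ^ 12 * (rr ^ 10 * kc ^ 8)) * (E 10 ^ 6 * (kappa * lambda ^ 2))"
      by algebra
    also have "\<dots> = ?m ^ 3 * E 5 ^ 15 * (kappa ^ 4 * lambda ^ 2) * E 2 ^ 6 * kc ^ 3 * (rr2 ^ 5 * kd ^ 5)"
      unfolding 1 2[symmetric] by algebra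
    also have "\<dots> = kappa ^ 4 * lambda ^ 2 * E 2 ^ 3 * (?m ^ 3 * (E 2 ^ 3 * E 5 ^ 15)) * rr ^ 10 * kc ^ 8"
      unfolding 4 by algebra
    also have "\<dots> = (kappa * (E 2 * E 10 ^ 3)) ^ 3 * (E 1 ^ 3 * E 10 ^ 6 * rr ^ 10 * kc ^ 8 * kappa * lambda ^ 2 * (1 - kk ^ 2) ^ 3)"
      unfolding 3 by algebra
    finally show ?thesis by (simp only: left_diff_distrib) simp
  qed
  moreover have "E 1 ^ 3 * E 10 ^ 6 * rr ^ 10 * kc ^ 8 * kappa * lambda ^ 2 * (1 - kk ^ 2) ^ 3 \<noteq> 0"
    by (rule nonzero_if_nth_0) simp
  ultimately show "(?m * (E 1 ^ 3 * E 5)) ^ 3 = (kappa * (E 2 * E 10 ^ 3)) ^ 3" by simp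
qed simp_all

subsection \<open>Extracting the section\<close>

lemmas dil_5_simps = dil_mult[of 5, OF zero_less_numeral] dil_add[of 5] dil_diff[of 5] dil_power[of 5, OF zero_less_numeral]
  dil_numeral[of 5, OF zero_less_numeral] dil_1[of 5]

definition quot :: "complex fps" where "quot = E 2 ^ 10 * inverse (E 1) ^ 9"

lemma quot_E: "quot * E 1 ^ 9 = E 2 ^ 10"
proof -
  have "inverse (E 1) * E 1 = 1" by simp
  then show ?thesis unfolding quot_def by algebra
qed

text \<open>In this form only the fourth power of E_1 has to be cleared by the norm, instead of the
  ninth.\<close>

lemma quot_psi: "quot * E 1 ^ 4 = psi ^ 5"
proof -
  have "(quot * E 1 ^ 4 - psi ^ 5) * E 1 ^ 5 = 0" using quot_E psi_E by algebra
  then show ?thesis by simp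
qed

definition vv :: "complex fps" where "vv = fps_X * rr ^ 5"

text \<open>Once E_1^4 is completed to a power of its norm, every factor beside \<open>quot\<close>
  is a series in q^5 and leaves the section by \<open>sect_mult_dil\<close>.\<close>

lemma sect_quot_aux:
  "sect 5 1 quot * (E 5 ^ 4 * (1 - 11 * vv - vv ^ 2) ^ 4 * rr ^ 11 * kc ^ 5) = dil 5 psi ^ 5 * rr * main_coeff kd kc vv"
proof -
  define x K P u where "x = dil 5 rr" and "K = dil 5 kk" and "P = dil 25 psi" and "u = fps_X * x"
  have u5: "u ^ 5 = dil 5 vv"
    by (simp add: u_def x_def vv_def dil_5_simps dil_X power_mult_distrib)
  have K: "1 + K = dil 5 kc" "1 - K = dil 5 kd" by (simp_all add: K_def dil_5_simps)
  have ab: "dil 5 alpha * x = E 25" "dil 5 beta = x * E 25"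
    using arg_cong[OF alpha_rr, of "dil 5"] arg_cong[OF beta_eq, of "dil 5"] by (simp_all add: x_def dil_5_simps dil_E)
  have "x * E 1 = dil 5 alpha * x - fps_X * x * E 25 - fps_X ^ 2 * x * dil 5 beta"
    by (subst E_1_dissection) algebra
  then have 1: "x * E 1 = E 25 * (1 - u - u ^ 2)"
    unfolding ab u_def by algebra
  have "x ^ 3 * (1 + K) * dil 5 psi0 = P * (1 - K) ^ 2" "x ^ 2 * dil 5 psi1 = P * (1 - K)"
    using arg_cong[OF rr_psi0, of "dil 5"] arg_cong[OF rr_psi1, of "dil 5"]
    by (simp_all add: x_def K_def P_def dil_5_simps dil_dil)
  then have 2: "psi * x ^ 3 * (1 + K) = P * ((1 - K) ^ 2 + u * (1 - K) * (1 + K) + u ^ 3 * (1 + K))"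
    using psi_dissection unfolding u_def P_def by algebra
  define C where "C = 1 + u + 2 * u ^ 2 + 3 * u ^ 3 + 5 * u ^ 4 - 3 * u ^ 5 + 2 * u ^ 6 - u ^ 7 + u ^ 8"
  \<comment> \<open>The powers of x add up to x^15: x^4 normalises the dissection of E_1^4, and
    (x^3)^5 that of psi^5.\<close>
  have "quot * (x * E 1) ^ 4 * x ^ 11 * (1 + K) ^ 5 = (psi * x ^ 3 * (1 + K)) ^ 5"
    using quot_psi by algebra
  then have "quot * E 25 ^ 4 * ((1 - u - u ^ 2) * C) ^ 4 * x ^ 11 * (1 + K) ^ 5
     = P ^ 5 * (((1 - K) ^ 2 + u * (1 - K) * (1 + K) + u ^ 3 * (1 + K)) ^ 5 * C ^ 4)"
    unfolding 1 2 by algebra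
  also have "(1 - u - u ^ 2) * C = 1 - 11 * u ^ 5 - (u ^ 5) ^ 2"
    unfolding C_def den_factor by (simp flip: power_mult)
  also have "((1 - K) ^ 2 + u * (1 - K) * (1 + K) + u ^ 3 * (1 + K)) ^ 5 * C ^ 4 =
     (num_coeff0 (1 - K) (1 + K) (u ^ 5) + u * num_coeff1 (1 - K) (1 + K) (u ^ 5) + u ^ 2 * num_coeff2 (1 - K) (1 + K) (u ^ 5)
       + u ^ 3 * num_coeff3 (1 - K) (1 + K) (u ^ 5) + u ^ 4 * num_coeff4 (1 - K) (1 + K) (u ^ 5)) *
     (den_coeff0 (u ^ 5) + u * den_coeff1 (u ^ 5) + u ^ 2 * den_coeff2 (u ^ 5) + u ^ 3 * den_coeff3 (u ^ 5) + u ^ 4 * den_coeff4 (u ^ 5))"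
    unfolding C_def num_expand den_expand ..
  finally have eq: "quot * E 25 ^ 4 * (1 - 11 * u ^ 5 - (u ^ 5) ^ 2) ^ 4 * x ^ 11 * (1 + K) ^ 5 = P ^ 5 * \<dots>" .
  have num: "num_coeff0 (dil 5 d) (dil 5 c) (dil 5 v) = dil 5 (num_coeff0 d c v)"
    "num_coeff1 (dil 5 d) (dil 5 c) (dil 5 v) = dil 5 (num_coeff1 d c v)"
    "num_coeff2 (dil 5 d) (dil 5 c) (dil 5 v) = dil 5 (num_coeff2 d c v)"
    "num_coeff3 (dil 5 d) (dil 5 c) (dil 5 v) = dil 5 (num_coeff3 d c v)"
    "num_coeff4 (dil 5 d) (dil 5 c) (dil 5 v) = dil 5 (num_coeff4 d c v)" for c d v :: "complex fps"
    unfolding num_coeff0_def num_coeff1_def num_coeff2_def num_coeff3_def num_coeff4_def by (simp_all only: dil_5_simps)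
  have den: "den_coeff0 (dil 5 v) = dil 5 (den_coeff0 v)" "den_coeff1 (dil 5 v) = dil 5 (den_coeff1 v)"
    "den_coeff2 (dil 5 v) = dil 5 (den_coeff2 v)" "den_coeff3 (dil 5 v) = dil 5 (den_coeff3 v)"
    "den_coeff4 (dil 5 v) = dil 5 (den_coeff4 v)" for v :: "complex fps"
    unfolding den_coeff0_def den_coeff1_def den_coeff2_def den_coeff3_def den_coeff4_def by (simp_all only: dil_5_simps)
  \<comment> \<open>Index sums of at least 5 wrap around with the factor u^5, a series in q^5. Since
    u = q x, the r-th component carries x^r.\<close>
  have conv: "p * ((n0 + u * n1 + u ^ 2 * n2 + u ^ 3 * n3 + u ^ 4 * n4) * (d0 + u * d1 + u ^ 2 * d2 + u ^ 3 * d3 + u ^ 4 * d4)) =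
     p * (n0 * d0 + w * (n1 * d4 + n2 * d3 + n3 * d2 + n4 * d1))
     + fps_X * (p * x * (n0 * d1 + n1 * d0 + w * (n2 * d4 + n3 * d3 + n4 * d2)))
     + fps_X ^ 2 * (p * x ^ 2 * (n0 * d2 + n1 * d1 + n2 * d0 + w * (n3 * d4 + n4 * d3)))
     + fps_X ^ 3 * (p * x ^ 3 * (n0 * d3 + n1 * d2 + n2 * d1 + n3 * d0 + w * (n4 * d4)))
     + fps_X ^ 4 * (p * x ^ 4 * (n0 * d4 + n1 * d3 + n2 * d2 + n3 * d1 + n4 * d0))"
     if "w = u ^ 5" for p n0 n1 n2 n3 n4 d0 d1 d2 d3 d4 w
    using that unfolding u_def by algebra
  have PE: "P ^ 5 = dil 5 (dil 5 psi ^ 5)" "E 25 = dil 5 (E 5)" by (simp_all add: P_def dil_5_simps dil_dil dil_E)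
  have st: "quot * dil 5 (E 5 ^ 4 * (1 - 11 * vv - vv ^ 2) ^ 4 * rr ^ 11 * kc ^ 5) =
     quot * E 25 ^ 4 * (1 - 11 * u ^ 5 - (u ^ 5) ^ 2) ^ 4 * x ^ 11 * (1 + K) ^ 5"
    unfolding u5 K(1) PE x_def by (simp only: dil_5_simps mult.assoc)
  note eq' = trans[OF trans[OF st eq] conv[OF refl], unfolded u5 K num den PE x_def dil_power[OF zero_less_numeral, symmetric]
    dil_mult[OF zero_less_numeral, symmetric] dil_add[OF zero_less_numeral, symmetric]]
  have less_5: "1 < (5::nat)" by simp
  show ?thesis
    unfolding sect_mult_dil[OF less_5, symmetric] eq'
    by (subst sect_5_components) (simp_all add: main_coeff_def dil_power)
qed

text \<open>Both sides are multiplied by a nonzero series chosen so that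
  \<open>sect_quot_aux\<close>, \<open>main_identity\<close> and the level 10 relations can be
  substituted one after another.\<close>

lemma sect_quot_kk: "sect 5 1 quot * (E 1 ^ 2 * kappa ^ 8) = E 2 ^ 2 * E 5 * target_poly kk kappa"
proof -
  define S G T N m where "S = sect 5 1 quot" and "G = main_coeff kd kc vv" and "T = target_poly kk kappa"
    and "N = 1 - 11 * vv - vv ^ 2" and "m = rr * rr2 ^ 2"
  have a: "S * (E 5 ^ 4 * N ^ 4 * rr ^ 11 * kc ^ 5) = dil 5 psi ^ 5 * rr * G"
    unfolding S_def N_def G_def by (rule sect_quot_aux)
  have c: "m * (E 2 * E 5 ^ 5) = kc * kd * (E 1 * E 10 ^ 5)"
    using level_10_first unfolding m_def by algebra
  have e: "N * kc ^ 4 = kappa ^ 2 * lambda" using norm_kk unfolding N_def vv_def .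
  have f: "kc ^ 18 * G = kc ^ 5 * kd ^ 6 * lambda ^ 4 * T"
    using main_identity[of vv kk] rr_5_kc unfolding G_def T_def vv_def kappa_def lambda_def by simp
  have "S * (E 1 ^ 2 * kappa ^ 8) * (E 5 ^ 9 * N ^ 4 * rr ^ 11 * kc ^ 23 * m ^ 2)
     = (S * (E 5 ^ 4 * N ^ 4 * rr ^ 11 * kc ^ 5)) * E 5 ^ 5 * E 1 ^ 2 * kappa ^ 8 * kc ^ 18 * m ^ 2" by algebra
  also have "\<dots> = (dil 5 psi * E 5) ^ 5 * rr * E 1 ^ 2 * kappa ^ 8 * m ^ 2 * (kc ^ 18 * G)"
    unfolding a by algebra
  also have "\<dots> = E 10 ^ 10 * rr ^ 3 * E 1 ^ 2 * kappa ^ 8 * (rr2 * kd) ^ 4 * (kc ^ 5 * kd ^ 2 * lambda ^ 4 * T)"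
    unfolding dil_psi_E f m_def by algebra
  also have "\<dots> = (kc * kd * (E 1 * E 10 ^ 5)) ^ 2 * kappa ^ 8 * rr ^ 11 * kc ^ 7 * lambda ^ 4 * T"
    unfolding rr2_kd by algebra
  also have "\<dots> = (m * (E 2 * E 5 ^ 5)) ^ 2 * (N * kc ^ 4) ^ 4 * rr ^ 11 * kc ^ 7 * T"
    unfolding c e by algebra
  also have "\<dots> = E 2 ^ 2 * E 5 * T * (E 5 ^ 9 * N ^ 4 * rr ^ 11 * kc ^ 23 * m ^ 2)" by algebra
  finally have "(S * (E 1 ^ 2 * kappa ^ 8) - E 2 ^ 2 * E 5 * T) * (E 5 ^ 9 * N ^ 4 * rr ^ 11 * kc ^ 23 * m ^ 2) = 0"
    by (simp only: left_diff_distrib) simp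
  moreover have "E 5 ^ 9 * N ^ 4 * rr ^ 11 * kc ^ 23 * m ^ 2 \<noteq> 0"
    by (rule nonzero_if_nth_0) (simp add: N_def vv_def m_def)
  ultimately show ?thesis unfolding S_def T_def by simp
qed

theorem sect_quot:
  "sect 5 1 quot = 9 * (E 2 ^ 2 * E 5 / E 1 ^ 2)
       + 3975 * fps_X * (E 2 ^ 3 * E 10 ^ 3 / E 1 ^ 5)
       + 207425 * fps_X ^ 2 * (E 2 ^ 4 * E 10 ^ 6 / (E 1 ^ 8 * E 5))
       + 4229000 * fps_X ^ 3 * (E 2 ^ 5 * E 10 ^ 9 / (E 1 ^ 11 * E 5 ^ 2))
       + 44850000 * fps_X ^ 4 * (E 2 ^ 6 * E 10 ^ 12 / (E 1 ^ 14 * E 5 ^ 3))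
       + 274000000 * fps_X ^ 5 * (E 2 ^ 7 * E 10 ^ 15 / (E 1 ^ 17 * E 5 ^ 4))
       + 980000000 * fps_X ^ 6 * (E 2 ^ 8 * E 10 ^ 18 / (E 1 ^ 20 * E 5 ^ 5))
       + 1920000000 * fps_X ^ 7 * (E 2 ^ 9 * E 10 ^ 21 / (E 1 ^ 23 * E 5 ^ 6))
       + 1600000000 * fps_X ^ 8 * (E 2 ^ 10 * E 10 ^ 24 / (E 1 ^ 26 * E 5 ^ 7))" (is "_ = ?R")
proof -
  define i1 i5 where "i1 = inverse (E 1)" and "i5 = inverse (E 5)"
  have i: "i1 * E 1 = 1" "i5 * E 5 = 1" by (simp_all add: i1_def i5_def)
  have div: "f / (E 1 ^ m * E 5 ^ n) = f * (i1 ^ m * i5 ^ n)" "f / (E 1 ^ m * E 5) = f * (i1 ^ m * i5)"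
    "f / E 1 ^ m = f * i1 ^ m" for f m n
    by (simp_all add: fps_divide_unit fps_inverse_mult fps_inverse_power i1_def i5_def)
  \<comment> \<open>The ratio of consecutive terms of the right side. As
    \<open>kk = kappa * w\<close>, that side times kappa^8 is \<open>target_poly\<close> times E_2^2
    E_5 / E_1^2.\<close>
  define w where "w = fps_X * E 2 * E 10 ^ 3 * i1 ^ 3 * i5"
  have kw: "kk = kappa * w"
  proof -
    have "kk * (E 1 ^ 3 * E 5) = kappa * (fps_X * E 2 * E 10 ^ 3)"
      using level_10_second unfolding kk_def by algebra
    then show ?thesis using i unfolding w_def by algebra
  qed
  have "?R = E 2 ^ 2 * E 5 * i1 ^ 2 * (9 + 3975 * w + 207425 * w ^ 2 + 4229000 * w ^ 3 + 44850000 * w ^ 4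
      + 274000000 * w ^ 5 + 980000000 * w ^ 6 + 1920000000 * w ^ 7 + 1600000000 * w ^ 8)"
    unfolding div w_def using i(2) by algebra
  then have "?R * (E 1 ^ 2 * kappa ^ 8) = E 2 ^ 2 * E 5 * target_poly kk kappa"
    using i(1) unfolding target_poly_def kw by algebra
  then have "(sect 5 1 quot - ?R) * (E 1 ^ 2 * kappa ^ 8) = 0"
    using sect_quot_kk by (simp only: left_diff_distrib) simp
  moreover have "E 1 ^ 2 * kappa ^ 8 \<noteq> 0" by (rule nonzero_if_nth_0) simp
  ultimately show ?thesis by simp
qed

theorem theorem1p4:
  shows "Abs_fps (\<lambda>n. of_nat (p_omega (40 * n + 12))) =
    4 * (9 * (E 2 ^ 2 * E 5 / E 1 ^ 2)
       + 3975 * fps_X * (E 2 ^ 3 * E 10 ^ 3 / E 1 ^ 5)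
       + 207425 * fps_X ^ 2 * (E 2 ^ 4 * E 10 ^ 6 / (E 1 ^ 8 * E 5))
       + 4229000 * fps_X ^ 3 * (E 2 ^ 5 * E 10 ^ 9 / (E 1 ^ 11 * E 5 ^ 2))
       + 44850000 * fps_X ^ 4 * (E 2 ^ 6 * E 10 ^ 12 / (E 1 ^ 14 * E 5 ^ 3))
       + 274000000 * fps_X ^ 5 * (E 2 ^ 7 * E 10 ^ 15 / (E 1 ^ 17 * E 5 ^ 4))
       + 980000000 * fps_X ^ 6 * (E 2 ^ 8 * E 10 ^ 18 / (E 1 ^ 20 * E 5 ^ 5))
       + 1920000000 * fps_X ^ 7 * (E 2 ^ 9 * E 10 ^ 21 / (E 1 ^ 23 * E 5 ^ 6))
       + 1600000000 * fps_X ^ 8 * (E 2 ^ 10 * E 10 ^ 24 / (E 1 ^ 26 * E 5 ^ 7)))"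
proof -
  have "omega_8_4 = fps_const 4 * quot" by (simp add: omega_8_4_eq quot_def numeral_fps_const mult.assoc)
  moreover have "sect 5 1 (fps_const 4 * quot) = fps_const 4 * sect 5 1 quot"
    by (intro fps_ext) (simp add: sect_def)
  ultimately have "Abs_fps (\<lambda>n. of_nat (p_omega (40 * n + 12))) = 4 * sect 5 1 quot"
    using sect_omega_8_4 by (simp add: numeral_fps_const)
  then show ?thesis unfolding sect_quot .
qed

end
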